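(* Consider the stable $M^X/G/1$ retrial queue (so $\rho=\lambda\beta_1\chi_1<1$) under the tail assumptions A1 and A2 given in the context, where one of the following three cases holds: (1) $d_X>d_B>1$; (2) $1<d_X<d_B$ and $c_X>0$; (3) $d_X=d_B>1$ and $c_X>0$. Put $a=\min(d_B,d_X)>1$, $\psi=\dfrac{\lambda(\rho+\chi_1-1)}{\mu(1-\rho)}$, $$c_{K^{\circ}}=\begin{cases}\dfrac{(\lambda\chi_1)^{a}}{(a-1)(1-\rho)} & \text{in case (1)},\\[2mm] \dfrac{\lambda\beta_1c_X}{(a-1)(1-\rho)} & \text{in case (2)},\\[2mm] \dfrac{(\lambda\chi_1)^{a}+\lambda\beta_1c_X}{(a-1)(1-\rho)} & \text{in case (3)},\end{cases}\qquad c_{D^{(0)}}=\begin{cases}\dfrac{(\lambda\chi_1)^{a+1}}{a\mu(1-\rho)^2} & \text{in case (1)},\\[2mm] \dfrac{\lambda c_X}{a\mu(1-\rho)^2} & \text{in case (2)},\\[2mm] \dfrac{(\lambda\chi_1)^{a+1}+\lambda c_X}{a\mu(1-\rho)^2} & \text{in case (3)}.\end{cases}$$ Then, as $j\to\infty$, $$P\{L_{\mu}>j\}\sim P\{L_{\infty}>j\}\sim c_{K^{\circ}}\cdot j^{-a+1}L(j).$$ Furthermore, if $P\{L_{\infty}=j\}$ is ultimately decreasing in $j$, then, as $j\to\infty$, $$P\{L_{\mu}>j\}-P\{L_{\infty}>j\}\sim\left[(a-1)\psi c_{K^{\circ}}+c_{D^{(0)}}\right]\cdot j^{-a}L(j)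.$$
   Context: The $M^X/G/1$ retrial queue: primary customers arrive in batches at the epochs of a Poisson process of rate $\lambda>0$; batch sizes are i.i.d. copies of a random variable $X$ with values in $\{1,2,\dots\}$, finite mean $\chi_1=E(X)$ and generating function $X(z)=E(z^X)$. If the server is free at an arrival epoch, one customer of the batch starts service immediately and the others join the orbit; if the server is busy, all customers of the batch join the orbit. Each customer in the orbit independently retries after exponential times of rate $\mu>0$ until it finds the server idle, and then starts service immediately. Service times are i.i.d. copies of $B$ with distribution function $B(x)$, $B(0)=0$, finite mean $\beta_1$ and Laplace–Stieltjes transform $\beta(s)=E(e^{-sB})$. Let $\rho=\lambda\beta_1\chi_1$; the system is stable iff $\rho<1$, which is assumed. In stationarity let $N_{orb}$ be the number of customers in the orbit and $C_{ser}\in\{0,1\}$ the indicator that the server is busy. $L_{\mu}=N_{orb}+C_{ser}$ is the stationary total number of customers in the retrial system, and $L_{\infty}$ is the stationary total number of customers in the corresponding standard (non-retrial) $M^X/G/1$ queue. Their distributions are given by the known formulas $$E(z^{L_{\infty}})=\beta(\lambda-\lambda X(z))\cdot\frac{(1-\rho)(1-z)}{\beta(\lambda-\lambda X(z))-z},\qquad E(z^{L_{\mu}})=E(z^{L_{\infty}})\cdot D^{(0)}(z),$$ where $$D^{(0)}(z)=E(z^{N_{orb}}\mid C_{ser}=0)=\exp\left\{-\frac{\lambda}{\mu}\int_z^1\frac{1-\beta(\lambda-\lambda X(u))X_0(u)}{\beta(\lambda-\lambda X(u))-u}\,du\right\},\qquad X_0(u)=X(u)/u,$$ i.e. $L_\mu$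 has the law of $L_\infty+D^{(0)}$ with $L_\infty$ and $D^{(0)}$ independent, $D^{(0)}$ being a nonnegative integer random variable with generating function $D^{(0)}(z)$. Tail assumptions, with $L(\cdot)$ a slowly varying function at $\infty$ (positive, measurable, $L(tx)/L(x)\to1$ as $x\to\infty$ for all $t>0$), the same in both: A1. $P\{B>x\}\sim x^{-d_B}L(x)$ as $x\to\infty$, where $d_B>1$. A2. $P\{X>j\}\sim c_X\, j^{-d_X}L(j)$ as $j\to\infty$, where $d_X>1$ and $c_X\ge0$; when $c_X=0$ this means $\lim_{j\to\infty}P\{X>j\}/(j^{-d_X}L(j))=0$. A sequence is ultimately decreasing if it is decreasing from some index on. $f\sim g$ means $f/g\to1$. *)

theory Defs
  imports "HOL-Probability.Probability" "HOL-Library.Landau_Symbols"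
begin

definition slowly_varying :: "(real \<Rightarrow> real) \<Rightarrow> bool" where
  "slowly_varying L \<longleftrightarrow>
     (\<forall>x>0. L x > 0) \<and>
     L \<in> borel_measurable (restrict_space borel {0<..}) \<and>
     (\<forall>t>0. ((\<lambda>x. L (t * x) / L x) \<longlongrightarrow> 1) at_top)"

(* "Decreasing" in the weak sense. *)
definition ultimately_decreasing :: "(nat \<Rightarrow> real) \<Rightarrow> bool" where
  "ultimately_decreasing u \<longleftrightarrow> (\<exists>n0. \<forall>n\<ge>n0. u (Suc n) \<le> u n)"

definition pgf :: "nat pmf \<Rightarrow> real \<Rightarrow> real" where
  "pgf p z = measure_pmf.expectation p (\<lambda>k. z ^ k)"

definition laplace_stieltjes :: "real measure \<Rightarrow> real \<Rightarrow> real" where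
  "laplace_stieltjes B s = (LINT x|B. exp (- s * x))"

definition mean_batch :: "nat pmf \<Rightarrow> real" where
  "mean_batch X = measure_pmf.expectation X real"

definition mean_service :: "real measure \<Rightarrow> real" where
  "mean_service B = (LINT x|B. x)"

definition traffic :: "real \<Rightarrow> nat pmf \<Rightarrow> real measure \<Rightarrow> real" where
  "traffic lam X B = lam * mean_service B * mean_batch X"

(* The generating function of the number of customers arriving during one
   service time: beta (lam - lam X(z)). *)
definition service_arrivals_gf ::
    "real \<Rightarrow> nat pmf \<Rightarrow> real measure \<Rightarrow> real \<Rightarrow> real" where
  "service_arrivals_gf lam X B z = laplace_stieltjes B (lam - lam * pgf X z)"

(* Stationary number of customers in the standard M^X/G/1 queue; meant for
   0 <= z < 1, where the denominator is positive if the traffic is below 1. *)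
definition standard_queue_gf ::
    "real \<Rightarrow> nat pmf \<Rightarrow> real measure \<Rightarrow> real \<Rightarrow> real" where
  "standard_queue_gf lam X B z =
     service_arrivals_gf lam X B z *
       ((1 - traffic lam X B) * (1 - z) / (service_arrivals_gf lam X B z - z))"

(* Orbit size given an idle server in the M^X/G/1 retrial queue.  The factor
   pgf X u / u is X_0(u); the integrand has removable singularities at u = 0 and
   u = 1, whose values there do not affect the integral. *)
definition idle_orbit_gf ::
    "real \<Rightarrow> real \<Rightarrow> nat pmf \<Rightarrow> real measure \<Rightarrow> real \<Rightarrow> real" where
  "idle_orbit_gf lam mu X B z =
     exp (- (lam / mu) * integral {z..1} (\<lambda>u.
       (1 - service_arrivals_gf lam X B u * (pgf X u / u)) /
         (service_arrivals_gf lam X B u - u)))"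

(* A law S on nat \<times> bool is the joint law of (N_orb, C_ser), with True standing
   for C_ser = 1 (server busy). *)

definition total_customers :: "(nat \<times> bool) pmf \<Rightarrow> nat pmf" where
  "total_customers S = map_pmf (\<lambda>(n, c). n + of_bool c) S"

(* E(z^N_orb | C_ser = 0), as the elementary quotient
   E(z^N_orb; C_ser = 0) / P(C_ser = 0). *)
definition orbit_gf_given_idle :: "(nat \<times> bool) pmf \<Rightarrow> real \<Rightarrow> real" where
  "orbit_gf_given_idle S z =
     measure_pmf.expectation S (\<lambda>(n, c). if c then 0 else z ^ n) /
     measure_pmf.prob S {(n, c). \<not> c}"

(* The stationary joint law is taken through the known formulas for its generating
   functions, as is the stationary law of the standard queue. *)
definition standard_queue_law ::
    "real \<Rightarrow> nat pmf \<Rightarrow> real measure \<Rightarrow> nat pmf \<Rightarrow> bool" where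
  "standard_queue_law lam X B Linf \<longleftrightarrow>
     (\<forall>z\<in>{0..<1}. pgf Linf z = standard_queue_gf lam X B z)"

definition retrial_queue_law ::
    "real \<Rightarrow> real \<Rightarrow> nat pmf \<Rightarrow> real measure \<Rightarrow> (nat \<times> bool) pmf \<Rightarrow> bool" where
  "retrial_queue_law lam mu X B S \<longleftrightarrow>
     (\<forall>z\<in>{0..<1}.
        orbit_gf_given_idle S z = idle_orbit_gf lam mu X B z \<and>
        pgf (total_customers S) z = standard_queue_gf lam X B z * orbit_gf_given_idle S z)"

end

(* Every generating function in the theorem has nonnegative coefficients, so the whole argument
   takes place on sequences. Let r be the tail sequence of the number of customers arriving during
   one service time, R its generating function, and note that the service generating function is
   1 - (1 - z) R(z). The standard queue then has the generating function
   (1 - rho) (1 + z (E(z) - 1)) with E = 1 / (1 - R), a renewal sequence, and the orbit size d given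
   an idle server satisfies (n + 1) d(n+1) = (lam / mu) (h * d)(n), where h is the coefficient
   sequence of the integrand. Convolution and renewal preserve asymptotics against the regularly
   varying weight n^(-a) L(n), so everything is reduced to the asymptotics of r. That is the big
   jump principle for a compound Poisson sum stopped at a service time: services longer than about
   n / (lam chi) exceed n by the law of large numbers, while for shorter services a truncated
   exponential Chebyshev bound justifies dominated convergence.
   The point probabilities of the standard queue come out regularly varying, so the difference of
   the two tails is just the convolution of these with the tail of d. *)
theory Submission
  imports Defs "HOL-Real_Asymp.Real_Asymp"
begin

section \<open>Convolution and renewal sequences\<close>

text \<open>The difference of the two tails is \<open>conv p db\<close>, with \<open>p\<close> the
  point probabilities of the standard queue and \<open>db\<close> the tail of the idle orbit size. A
  large index of \<open>p\<close> is weighted by the sum of \<open>db\<close>, the mean \<psi>, and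
  a large index of \<open>db\<close> by the sum 1 of \<open>p\<close>; hence the two terms of the
  constant. Both sequences live on the scale n^(-a) L(n): for \<open>p\<close>, renewal keeps the
  scale of \<open>r\<close> because \<rho> < 1; for \<open>db\<close>, the division by n + 1 in the
  recursion costs one power, which summation gives back. The tail of the standard queue, a sum of
  \<open>p\<close>, lies one power higher, so the difference is invisible at first order.

  The delicate point is \<open>r\<close>. The tail limit of a compound Poisson sum is not uniform in
  the service time, and when \<open>dB = dX\<close> a long service and a single large batch
  contribute at the same order. The bound on compound sums must therefore be linear in the mean
  number of batches, so that a finite mean service time suffices to integrate it, and must hold
  right up to the threshold where the law of large numbers takes over.\<close>

definition conv :: "(nat \<Rightarrow> real) \<Rightarrow> (nat \<Rightarrow> real) \<Rightarrow> nat \<Rightarrow> real" where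
  "conv u v n = (\<Sum>k\<le>n. u k * v (n - k))"

lemma conv_nonneg: "(\<And>k. u k \<ge> 0) \<Longrightarrow> (\<And>k. v k \<ge> 0) \<Longrightarrow> conv u v n \<ge> 0"
  by (auto simp: conv_def intro!: sum_nonneg)

text \<open>In both sums the factor evaluated at n - k has index at least n/2, where the weight is
  comparable with its value at n. Exchanging the roles of \<open>u\<close> and \<open>v\<close> in
  the second sum lets one lemma treat both.\<close>

lemma conv_split_half:
  "conv u v n = (\<Sum>k\<le>n div 2. u k * v (n - k)) + (\<Sum>k<n - n div 2. v k * u (n - k))"
proof -
  have "conv u v n = (\<Sum>k\<le>n div 2. u k * v (n - k)) + (\<Sum>k\<in>{n div 2<..n}. u k * v (n - k))"
    unfolding conv_def
    by (subst sum.union_disjoint[symmetric]) (auto intro!: sum.cong)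
  also have "(\<Sum>k\<in>{n div 2<..n}. u k * v (n - k)) = (\<Sum>k<n - n div 2. v k * u (n - k))"
    by (rule sum.reindex_bij_witness[where i = "\<lambda>k. n - k" and j = "\<lambda>k. n - k"]) auto
  finally show ?thesis .
qed

lemma conv_sums:
  assumes "\<And>k. u k \<ge> (0::real)" "\<And>k. v k \<ge> 0" "z \<ge> 0"
    and u: "(\<lambda>k. u k * z ^ k) sums U" and v: "(\<lambda>k. v k * z ^ k) sums V"
  shows "(\<lambda>k. conv u v k * z ^ k) sums (U * V)"
proof -
  have "(\<lambda>n. \<Sum>i\<le>n. (u i * z ^ i) * (v (n - i) * z ^ (n - i))) sums
      ((\<Sum>k. u k * z ^ k) * (\<Sum>k. v k * z ^ k))"
    by (rule Cauchy_product_sums) (use assms in \<open>auto simp: sums_iff abs_mult\<close>)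
  moreover have "(\<Sum>i\<le>n. (u i * z ^ i) * (v (n - i) * z ^ (n - i))) = conv u v n * z ^ n" for n
    unfolding conv_def sum_distrib_right
  proof (rule sum.cong)
    fix i assume "i \<in> {..n}"
    then have "z ^ n = z ^ i * z ^ (n - i)" by (simp flip: power_add)
    then show "(u i * z ^ i) * (v (n - i) * z ^ (n - i)) = u i * v (n - i) * z ^ n" by simp
  qed simp
  ultimately show ?thesis using u v by (simp add: sums_iff)
qed

lemma conv_sums_1:
  assumes "\<And>k. u k \<ge> (0::real)" "\<And>k. v k \<ge> 0" "u sums U" "v sums V"
  shows "conv u v sums (U * V)"
  using conv_sums[of u v 1] assms by simp

text \<open>The usual subexponential property, conv g g n / g n -> 2 * suminf g, is a consequence
  (\<open>conv_limit\<close> with u = v = g). Long-tailedness and domination on [n/2, n] are simpler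
  to verify for regularly varying weights and are what dominated convergence asks for.\<close>

locale subexponential_weight =
  fixes g :: "nat \<Rightarrow> real"
  assumes pos: "\<And>n. g n > 0"
    and summable_weight: "summable g"
    and long_tailed: "(\<lambda>n. g (Suc n) / g n) \<longlonglongrightarrow> 1"
    and half_dominated: "\<exists>C. \<forall>k n. k \<le> n \<longrightarrow> n \<le> 2 * k \<longrightarrow> g k \<le> C * g n"
begin

lemma nonneg: "g n \<ge> 0"
  using pos[of n] by linarith

lemma long_tailed_diff: "(\<lambda>n. g (n - k) / g n) \<longlonglongrightarrow> 1"
proof (induction k)
  case 0
  then show ?case using pos by (simp add: less_imp_neq[symmetric])
next
  case (Suc k)
  have "(\<lambda>n. g n / g (Suc n) * (g (n - k) / g n)) \<longlonglongrightarrow> 1 * 1"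
    using tendsto_inverse[OF long_tailed] by (intro tendsto_mult Suc) (simp add: inverse_eq_divide)
  then have "(\<lambda>n. g (Suc n - Suc k) / g (Suc n)) \<longlonglongrightarrow> 1"
    using pos by (simp add: less_imp_neq[symmetric])
  then show ?case by (subst (asm) filterlim_sequentially_Suc)
qed

text \<open>Dominated convergence for series: long-tailedness gives the limit of each term with k
  fixed, and domination on [n/2, n] the summable bound. The index set \<open>A n\<close> is abstract
  because the two halves of \<open>conv_split_half\<close> have different upper ends.\<close>

lemma half_convolution_limit:
  assumes u: "summable (\<lambda>k. \<bar>u k\<bar>)"
    and v: "(\<lambda>n. v n / g n) \<longlonglongrightarrow> c"
    and A: "\<And>n. finite (A n)" "\<And>n k. k \<in> A n \<Longrightarrow> k \<le> n \<and> n \<le> 2 * (n - k)"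
      "\<And>k. eventually (\<lambda>n. k \<in> A n) sequentially"
  shows "(\<lambda>n. (\<Sum>k\<in>A n. u k * v (n - k)) / g n) \<longlonglongrightarrow> (\<Sum>k. u k) * c"
proof -
  obtain C where C: "\<And>k n. k \<le> n \<Longrightarrow> n \<le> 2 * k \<Longrightarrow> g k \<le> C * g n"
    using half_dominated by blast
  have "Bseq (\<lambda>n. v n / g n)" using v by (intro convergent_imp_Bseq convergentI)
  then obtain D where D: "D > 0" "\<And>n. \<bar>v n / g n\<bar> \<le> D" unfolding Bseq_def by auto
  define f where "f k n = (if k \<in> A n then u k * (v (n - k) / g n) else 0)" for k n
  have bd: "norm (f k n) \<le> \<bar>u k\<bar> * (D * C)" for k n
  proof (cases "k \<in> A n")
    case True
    then have "n - k \<le> n" "n \<le> 2 * (n - k)" using A(2) by auto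
    then have "g (n - k) \<le> C * g n" by (rule C)
    then have 1: "g (n - k) / g n \<le> C" using pos[of n] by (simp add: divide_le_eq mult.commute)
    have "\<bar>v (n - k) / g n\<bar> = \<bar>v (n - k) / g (n - k)\<bar> * (g (n - k) / g n)"
      using pos[of "n - k"] pos[of n] by (simp add: abs_mult abs_divide)
    also have "\<dots> \<le> D * C" using D(1) D(2)[of "n - k"] 1 pos[of "n - k"] pos[of n]
      by (intro mult_mono) (auto simp: less_imp_le simp del: abs_divide)
    finally have "\<bar>u k\<bar> * \<bar>v (n - k) / g n\<bar> \<le> \<bar>u k\<bar> * (D * C)" by (rule mult_left_mono) simp
    then show ?thesis by (simp only: f_def if_P[OF True] real_norm_def abs_mult)
  next
    case False
    have "0 < C * g 0" using C[of 0 0] pos[of 0] by simp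
    then have "0 < C" using pos[of 0] by (simp add: zero_less_mult_iff)
    then show ?thesis using False D(1) by (simp add: f_def)
  qed
  have "((\<lambda>n. \<Sum>k. f k n) \<longlonglongrightarrow> (\<Sum>k. u k * c))"
  proof (rule tannerys_theorem[THEN conjunct2, THEN conjunct2])
    show "(\<lambda>n. f k n) \<longlonglongrightarrow> u k * c" for k
    proof -
      have "(\<lambda>n. v (n - k) / g (n - k)) \<longlonglongrightarrow> c"
        using v filterlim_minus_const_nat_at_top[of k] by (rule filterlim_compose)
      then have "(\<lambda>n. u k * (v (n - k) / g (n - k) * (g (n - k) / g n))) \<longlonglongrightarrow> u k * (c * 1)"
        by (intro tendsto_intros long_tailed_diff)
      moreover have "eventually (\<lambda>n. u k * (v (n - k) / g (n - k) * (g (n - k) / g n)) = f k n) sequentially"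
        using A(3)[of k] by eventually_elim (use pos in \<open>auto simp: f_def less_imp_neq[symmetric]\<close>)
      ultimately show ?thesis by (subst (asm) mult_1_right) (rule Lim_transform_eventually)
    qed
    show "eventually (\<lambda>(k,n). norm (f k n) \<le> \<bar>u k\<bar> * (D * C)) (at_top \<times>\<^sub>F sequentially)"
      using bd by (intro always_eventually) auto
    show "summable (\<lambda>k. \<bar>u k\<bar> * (D * C))" using u by (rule summable_mult2)
  qed simp
  moreover have "(\<Sum>k. f k n) = (\<Sum>k\<in>A n. u k * v (n - k)) / g n" for n
  proof -
    have "(\<Sum>k. f k n) = (\<Sum>k\<in>A n. f k n)" by (rule suminf_finite) (auto simp: f_def A)
    then show ?thesis by (simp add: f_def sum_divide_distrib)
  qed
  moreover have "(\<Sum>k. u k * c) = (\<Sum>k. u k) * c"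
    using summable_rabs_cancel[OF u] by (rule suminf_mult2[symmetric])
  ultimately show ?thesis by simp
qed

lemma lower_half_limit:
  assumes "summable (\<lambda>k. \<bar>u k\<bar>)" "(\<lambda>n. v n / g n) \<longlonglongrightarrow> c"
  shows "(\<lambda>n. (\<Sum>k\<le>n div 2. u k * v (n - k)) / g n) \<longlonglongrightarrow> (\<Sum>k. u k) * c"
  using assms
proof (rule half_convolution_limit)
  show "eventually (\<lambda>n. k \<in> {..n div 2}) sequentially" for k
    using eventually_ge_at_top[of "2 * k"] by eventually_elim auto
qed auto

lemma upper_half_limit:
  assumes "summable (\<lambda>k. \<bar>u k\<bar>)" "(\<lambda>n. v n / g n) \<longlonglongrightarrow> c"
  shows "(\<lambda>n. (\<Sum>k<n - n div 2. u k * v (n - k)) / g n) \<longlonglongrightarrow> (\<Sum>k. u k) * c"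
  using assms
proof (rule half_convolution_limit)
  show "eventually (\<lambda>n. k \<in> {..<n - n div 2}) sequentially" for k
    using eventually_ge_at_top[of "2 * k + 2"] by eventually_elim auto
qed auto

text \<open>One big jump: the large index falls to one of the factors, and the other one is summed
  out.\<close>

lemma conv_limit:
  assumes "summable (\<lambda>k. \<bar>u k\<bar>)" "summable (\<lambda>k. \<bar>v k\<bar>)"
    and "(\<lambda>n. u n / g n) \<longlonglongrightarrow> c" "(\<lambda>n. v n / g n) \<longlonglongrightarrow> d"
  shows "(\<lambda>n. conv u v n / g n) \<longlonglongrightarrow> (\<Sum>k. u k) * d + (\<Sum>k. v k) * c"
  unfolding conv_split_half add_divide_distrib
  by (intro tendsto_add lower_half_limit upper_half_limit assms)

lemma conv_limit_nonneg:
  assumes "\<And>k. u k \<ge> 0" "\<And>k. v k \<ge> 0" "u sums U" "v sums V"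
    and "(\<lambda>n. u n / g n) \<longlonglongrightarrow> c" "(\<lambda>n. v n / g n) \<longlonglongrightarrow> d"
  shows "(\<lambda>n. conv u v n / g n) \<longlonglongrightarrow> U * d + V * c"
  using conv_limit[of u v c d] assms by (simp add: sums_iff)

lemma weight_limit: "(\<lambda>n. g n / g n) \<longlonglongrightarrow> 1"
  using pos by (simp add: less_imp_neq[symmetric])

lemma bounded_ratio:
  assumes "(\<lambda>n. v n / g n) \<longlonglongrightarrow> c"
  obtains C where "C > 0" "\<And>n. \<bar>v n\<bar> \<le> C * g n"
proof -
  have "Bseq (\<lambda>n. v n / g n)" using assms by (intro convergent_imp_Bseq convergentI)
  then obtain D where D: "D > 0" "\<And>n. \<bar>v n / g n\<bar> \<le> D" unfolding Bseq_def by auto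
  then have "\<bar>v n\<bar> \<le> D * g n" for n
    using D(2)[of n] pos[of n] by (simp add: abs_divide divide_le_eq)
  with D(1) show thesis by (rule that)
qed

text \<open>In the lower half of \<open>conv r e\<close> a bound M * g on \<open>e\<close>
  reproduces itself with a factor close to \<rho> < 1. The upper half is O(g) by the limit of
  \<open>r\<close> and the summability of \<open>e\<close> alone, so the induction closes.\<close>

lemma renewal_bounded:
  assumes r: "\<And>k. r k \<ge> 0" "r sums \<rho>" "\<rho> < 1" "(\<lambda>n. r n / g n) \<longlonglongrightarrow> c"
    and e: "\<And>k. e k \<ge> 0" "summable e" "\<And>n. e n = (if n = 0 then 1 else 0) + conv r e n"
  shows "\<exists>M>0. \<forall>n. e n \<le> M * g n"
proof -
  have sr: "summable (\<lambda>k. \<bar>r k\<bar>)" and se: "summable (\<lambda>k. \<bar>e k\<bar>)"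
    using r(1,2) e(1,2) by (auto simp: sums_iff)
  define \<theta> where "\<theta> = (1 + \<rho>) / 2"
  have \<theta>: "\<rho> < \<theta>" "\<theta> < 1" using r by (auto simp: \<theta>_def)
  have "(\<lambda>n. (\<Sum>k\<le>n div 2. r k * g (n - k)) / g n) \<longlonglongrightarrow> \<rho> * 1"
    using lower_half_limit[OF sr weight_limit] r by (simp add: sums_iff)
  then have "eventually (\<lambda>n. (\<Sum>k\<le>n div 2. r k * g (n - k)) / g n < \<theta>) sequentially"
    using \<theta> by (intro order_tendstoD(2)[where y = "\<rho> * 1"]) auto
  then obtain N where N: "\<And>n. n \<ge> N \<Longrightarrow> (\<Sum>k\<le>n div 2. r k * g (n - k)) / g n < \<theta>"
    unfolding eventually_sequentially by blast
  obtain C where C: "C > 0" "\<And>n. \<bar>\<Sum>k<n - n div 2. e k * r (n - k)\<bar> \<le> C * g n"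
    using bounded_ratio[OF upper_half_limit[OF se r(4)]] by blast
  \<comment> \<open>C / (1 - \<theta>) is the fixed point of M = M * \<theta> + C; the maximum
    covers the indices before the contraction sets in.\<close>
  define M where "M = Max ((\<lambda>n. e n / g n) ` {..N}) + C / (1 - \<theta>)"
  have Max0: "Max ((\<lambda>n. e n / g n) ` {..N}) \<ge> e n / g n" if "n \<le> N" for n
    using that by (intro Max_ge) auto
  have "Max ((\<lambda>n. e n / g n) ` {..N}) \<ge> 0"
    using Max0[of 0] e(1)[of 0] pos[of 0] by (intro order_trans[OF divide_nonneg_pos Max0]) auto
  then have M: "C / (1 - \<theta>) \<le> M" "M > 0" "\<And>n. n \<le> N \<Longrightarrow> e n / g n \<le> M"
    using Max0 C \<theta> by (auto simp: M_def intro: add_increasing2 add_nonneg_pos)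
  have "e n \<le> M * g n" for n
  proof (induction n rule: less_induct)
    case (less n)
    show ?case
    proof (cases "n \<le> N")
      case True
      then show ?thesis using M(3)[of n] pos[of n] by (simp add: divide_le_eq)
    next
      case False
      show ?thesis
      proof (rule ccontr)
        assume "\<not> ?thesis"
        then have gt: "e n > M * g n" by simp
        \<comment> \<open>The term k = 0 of the lower half contains \<open>e n\<close> itself, so
          the bound on earlier values does not suffice. The supposed violation at n supplies a
          constant that is valid for all i \<le> n.\<close>
        define M' where "M' = e n / g n"
        have M': "M' > M" "e n = M' * g n"
          using gt pos[of n] by (auto simp: M'_def less_divide_eq less_imp_neq[symmetric])
        have le: "e i \<le> M' * g i" if "i \<le> n" for i
        proof (cases "i = n")
          case False
          then have "e i \<le> M * g i" using less that by auto
          also have "\<dots> \<le> M' * g i" using M' nonneg[of i] by (intro mult_right_mono) auto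
          finally show ?thesis .
        qed (use M' in auto)
        have "e n = (\<Sum>k\<le>n div 2. r k * e (n - k)) + (\<Sum>k<n - n div 2. e k * r (n - k))"
          using e(3)[of n] False by (simp add: conv_split_half)
        also have "(\<Sum>k\<le>n div 2. r k * e (n - k)) \<le> (\<Sum>k\<le>n div 2. r k * (M' * g (n - k)))"
          using r le by (intro sum_mono mult_left_mono) auto
        also have "\<dots> = M' * (\<Sum>k\<le>n div 2. r k * g (n - k))"
          by (simp add: sum_distrib_left mult_ac)
        also have "\<dots> \<le> M' * (\<theta> * g n)"
          using N[of n] False M' M pos[of n] by (intro mult_left_mono) (auto simp: divide_less_eq)
        also have "(\<Sum>k<n - n div 2. e k * r (n - k)) \<le> C * g n" using C(2)[of n] by auto
        finally have "M' * g n \<le> (M' * \<theta> + C) * g n" using M' by (simp add: algebra_simps)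
        then have "M' \<le> M' * \<theta> + C" using pos[of n] by simp
        then have "M' \<le> C / (1 - \<theta>)" using \<theta> by (simp add: field_simps)
        with M M' show False by simp
      qed
    qed
  qed
  with M show ?thesis by blast
qed

text \<open>The limit superior of \<open>\<bar>e n / g n - l\<bar>\<close>, finite by the preceding lemma, is at most \<open>\<rho>\<close> times itself.\<close>
lemma renewal_limit:
  assumes r: "\<And>k. r k \<ge> 0" "r sums \<rho>" "\<rho> < 1" "(\<lambda>n. r n / g n) \<longlonglongrightarrow> c"
    and e: "\<And>k. e k \<ge> 0" "e sums (1 / (1 - \<rho>))" "\<And>n. e n = (if n = 0 then 1 else 0) + conv r e n"
  shows "(\<lambda>n. e n / g n) \<longlonglongrightarrow> c / (1 - \<rho>)\<^sup>2"
proof -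
  have sr: "summable (\<lambda>k. \<bar>r k\<bar>)" and se: "summable (\<lambda>k. \<bar>e k\<bar>)"
    using r(1,2) e(1,2) by (auto simp: sums_iff)
  have \<rho>0: "\<rho> \<ge> 0" using suminf_nonneg[of r] r(1,2) by (auto simp: sums_iff)
  obtain M where M: "M > 0" "\<And>n. e n \<le> M * g n"
    using renewal_bounded[OF r e(1) _ e(3)] e(2) by (auto simp: sums_iff)
  \<comment> \<open>Passing to the limit in the renewal equation forces l = c / (1 - \<rho>) +
    \<rho> * l.\<close>
  define l where "l = c / (1 - \<rho>)\<^sup>2"
  define x where "x n = \<bar>e n / g n - l\<bar>" for n
  define w where "w n = (\<Sum>k\<le>n div 2. r k * g (n - k)) / g n" for n
  define y where "y n = \<bar>(if n = 0 then 1 else 0) + (\<Sum>k<n - n div 2. e k * r (n - k)) / g n + l * w n - l\<bar>" for n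
  have w: "w \<longlonglongrightarrow> \<rho>"
    using lower_half_limit[OF sr weight_limit] r unfolding w_def by (simp add: sums_iff)
  have y: "y \<longlonglongrightarrow> 0"
  proof -
    have "(\<lambda>n. (if n = 0 then 1 else 0) :: real) \<longlonglongrightarrow> 0"
      by (rule tendsto_eventually) (use eventually_gt_at_top[of 0] in \<open>eventually_elim, auto\<close>)
    then have "y \<longlonglongrightarrow> \<bar>0 + (\<Sum>k. e k) * c + l * \<rho> - l\<bar>"
      unfolding y_def by (intro tendsto_intros upper_half_limit se r w) auto
    moreover have "0 + (\<Sum>k. e k) * c + l * \<rho> - l = 0"
    proof -
      have "1 / q * c + c / q\<^sup>2 * (1 - q) - c / q\<^sup>2 = 0" if "q \<noteq> 0" for q :: real
        using that by (simp add: field_simps power2_eq_square)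
      from this[of "1 - \<rho>"] show ?thesis using e(2) \<open>\<rho> < 1\<close> by (simp add: sums_iff l_def)
    qed
    ultimately show ?thesis by simp
  qed
  \<comment> \<open>The lower half minus \<open>l * w n\<close> is a weighted sum of deviations at
    indices at least n div 2, with total weight \<open>w n\<close>; everything else is collected in
    \<open>y n\<close>.\<close>
  have step: "x n \<le> s * w n + y n" if s: "\<And>k. k \<ge> n div 2 \<Longrightarrow> x k \<le> s" and n: "n > 0" for n s
  proof -
    have yn: "y n = \<bar>0 + (\<Sum>k<n - n div 2. e k * r (n - k)) / g n + l * w n - l\<bar>"
      using n by (simp add: y_def)
    have "e n / g n - l = (\<Sum>k\<le>n div 2. r k * e (n - k)) / g n - l * w n
        + (0 + (\<Sum>k<n - n div 2. e k * r (n - k)) / g n + l * w n - l)"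
      using e(3)[of n] n by (simp add: conv_split_half add_divide_distrib)
    also have "(\<Sum>k\<le>n div 2. r k * e (n - k)) / g n - l * w n =
        (\<Sum>k\<le>n div 2. r k * g (n - k) / g n * (e (n - k) / g (n - k) - l))"
      unfolding w_def sum_divide_distrib sum_distrib_left sum_subtractf[symmetric]
      using pos by (intro sum.cong refl) (simp add: field_simps less_imp_neq[symmetric])
    finally have "x n \<le> \<bar>\<Sum>k\<le>n div 2. r k * g (n - k) / g n * (e (n - k) / g (n - k) - l)\<bar> + y n"
      unfolding x_def yn by (simp only: abs_triangle_ineq)
    also have "\<bar>\<Sum>k\<le>n div 2. r k * g (n - k) / g n * (e (n - k) / g (n - k) - l)\<bar>
        \<le> (\<Sum>k\<le>n div 2. \<bar>r k * g (n - k) / g n * (e (n - k) / g (n - k) - l)\<bar>)"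
      by (rule sum_abs)
    also have "\<dots> = (\<Sum>k\<le>n div 2. r k * g (n - k) / g n * x (n - k))"
      unfolding x_def abs_mult using r nonneg by (intro sum.cong refl) (simp add: abs_mult)
    also have "\<dots> \<le> (\<Sum>k\<le>n div 2. r k * g (n - k) / g n * s)"
      using r nonneg s by (intro sum_mono mult_left_mono) auto
    also have "\<dots> = s * w n"
      by (simp add: w_def sum_divide_distrib sum_distrib_left mult_ac)
    finally show ?thesis by simp
  qed
  define \<theta> where "\<theta> = (1 + \<rho>) / 2"
  have \<theta>: "\<rho> < \<theta>" "\<theta> < 1" "\<theta> > 0" using r \<rho>0 by (auto simp: \<theta>_def)
  \<comment> \<open>\<open>Inf S\<close> is the limit superior of \<open>x\<close>.\<close>
  define S where "S = {s. s \<ge> 0 \<and> eventually (\<lambda>n. x n \<le> s) sequentially}"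
  have contr: "s * \<theta> + \<eta> \<in> S" if s: "s \<in> S" and \<eta>: "\<eta> > 0" for s \<eta>
  proof -
    obtain N where N: "\<And>n. n \<ge> N \<Longrightarrow> x n \<le> s"
      using s unfolding S_def eventually_sequentially by auto
    have "eventually (\<lambda>n. x n \<le> s * \<theta> + \<eta>) sequentially"
      using order_tendstoD(2)[OF w \<theta>(1)] order_tendstoD(2)[OF y \<eta>] eventually_ge_at_top[of "2 * N + 2"]
    proof eventually_elim
      case (elim n)
      have "x n \<le> s * w n + y n" by (rule step) (use elim in \<open>auto intro!: N\<close>)
      moreover have "s * w n \<le> s * \<theta>" using s elim by (intro mult_left_mono) (auto simp: S_def)
      ultimately show ?case using elim by simp
    qed
    then show ?thesis using s \<eta> \<theta> by (auto simp: S_def)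
  qed
  have "x n \<le> M + \<bar>l\<bar>" for n
  proof -
    have "0 \<le> e n / g n" "e n / g n \<le> M" 
      using e(1)[of n] M(2)[of n] pos[of n] by (auto simp: divide_le_eq)
    then show ?thesis unfolding x_def by linarith
  qed
  then have ne: "M + \<bar>l\<bar> \<in> S" using M by (auto simp: S_def)
  have bb: "bdd_below S" by (rule bdd_belowI[of _ 0]) (auto simp: S_def)
  have Inf0: "Inf S = 0"
  proof (rule ccontr)
    assume "Inf S \<noteq> 0"
    moreover have "Inf S \<ge> 0" using ne by (intro cInf_greatest) (auto simp: S_def)
    ultimately have I: "Inf S > 0" by simp
    define \<eta> where "\<eta> = Inf S * (1 - \<theta>) / 3"
    have \<eta>: "\<eta> > 0" using I \<theta> by (auto simp: \<eta>_def)
    obtain s where s: "s \<in> S" "s < Inf S + \<eta>"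
      using cInf_lessD[of S "Inf S + \<eta>"] ne \<eta> by auto
    have "Inf S \<le> s * \<theta> + \<eta>" using contr[OF s(1) \<eta>] bb by (rule cInf_lower)
    also have "s * \<theta> \<le> (Inf S + \<eta>) * \<theta>" using s \<theta> by (intro mult_right_mono) auto
    also have "\<dots> \<le> Inf S * \<theta> + \<eta>" using \<theta> \<eta> by (simp add: algebra_simps)
    finally have "Inf S * (1 - \<theta>) \<le> 2 * \<eta>" by (simp add: algebra_simps)
    moreover have "3 * \<eta> = Inf S * (1 - \<theta>)" by (simp add: \<eta>_def)
    ultimately show False using \<eta> by linarith
  qed
  have "x \<longlonglongrightarrow> 0"
  proof (rule order_tendstoI)
    fix a :: real assume "0 < a"
    then obtain s where s: "s \<in> S" "s < a" using cInf_lessD[of S a] ne Inf0 by auto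
    then have "eventually (\<lambda>n. x n \<le> s) sequentially" by (simp add: S_def)
    then show "eventually (\<lambda>n. x n < a) sequentially" using s by (auto elim: eventually_mono)
  qed (auto simp: x_def intro!: always_eventually intro: less_le_trans)
  then have "(\<lambda>n. e n / g n - l) \<longlonglongrightarrow> 0" unfolding x_def by (rule tendsto_rabs_zero_cancel)
  then show ?thesis unfolding l_def by (rule LIM_zero_cancel)
qed

end

section \<open>Slow variation\<close>

lemma filterlim_real_Suc: "filterlim (\<lambda>n. real (Suc n)) at_top sequentially"
  by (rule filterlim_compose[OF filterlim_real_sequentially filterlim_Suc])

text \<open>The Potter bound with a single parameter: exp \<epsilon> is the constant factor, and the
  remaining factor is the larger of y / x and x / y raised to the power \<epsilon>.\<close>

locale slow_variation =
  fixes L :: "real \<Rightarrow> real"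
  assumes L_pos: "\<And>x. x > 0 \<Longrightarrow> L x > 0"
    and potter: "\<And>\<epsilon>. \<epsilon> > 0 \<Longrightarrow>
      \<exists>x0>0. \<forall>x\<ge>x0. \<forall>y\<ge>x0. L y \<le> exp (\<epsilon> * (1 + \<bar>ln (y / x)\<bar>)) * L x"

text \<open>Monotonicity of \<open>G\<close> upgrades the pointwise limits of \<open>L (t * x) / L x\<close> to Potter bounds,
  in place of the uniform convergence theorem for measurable \<open>L\<close>.\<close>
lemma slow_variationI:
  fixes L G :: "real \<Rightarrow> real"
  assumes L_pos: "\<And>x. x > 0 \<Longrightarrow> L x > 0"
    and slow: "\<And>t. t > 0 \<Longrightarrow> ((\<lambda>x. L (t * x) / L x) \<longlongrightarrow> 1) at_top"
    and G: "\<And>x y. x \<le> y \<Longrightarrow> G y \<le> G x"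
    and LG: "((\<lambda>x. G x / (x powr (- d) * L x)) \<longlongrightarrow> 1) at_top" and d: "d > 0"
  shows "slow_variation L"
proof
  fix \<epsilon> :: real assume \<epsilon>: "\<epsilon> > 0"
  \<comment> \<open>The budget: two replacements of \<open>G\<close> by its asymptotics cost exp
    (\<epsilon> / 8) each and the factor t powr d at most exp (\<epsilon> / 4), in total exp
    (\<epsilon> / 2). A step between L x and L (t * x) costs exp (\<epsilon> * \<tau>).\<close>
  define \<tau> where "\<tau> = min (1/4) (\<epsilon> / (4 * d))"
  have \<tau>: "\<tau> > 0" "\<tau> \<le> 1/4" "d * \<tau> \<le> \<epsilon> / 4"
    using \<epsilon> d by (auto simp: \<tau>_def min_def field_simps)
  define t where "t = exp \<tau>"
  have t: "t > 1" "t > 0" using \<tau> by (auto simp: t_def)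
  have c1: "1 < exp (\<epsilon> / 8)" "exp (- \<epsilon> / 8) < 1" "1 < exp (\<epsilon> * \<tau>)" "exp (- (\<epsilon> * \<tau>)) < 1"
    using \<epsilon> \<tau> by auto
  have "eventually (\<lambda>x. x > 0 \<and> exp (- \<epsilon> / 8) < G x / (x powr (- d) * L x) \<and>
      G x / (x powr (- d) * L x) < exp (\<epsilon> / 8) \<and>
      exp (- (\<epsilon> * \<tau>)) < L (t * x) / L x \<and> L (t * x) / L x < exp (\<epsilon> * \<tau>)) at_top"
    by (intro eventually_conj eventually_gt_at_top order_tendstoD[OF LG] order_tendstoD[OF slow[OF t(2)]] c1)
  then obtain x0 where x0: "\<And>x. x \<ge> x0 \<Longrightarrow> x > 0 \<and> exp (- \<epsilon> / 8) < G x / (x powr (- d) * L x) \<and>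
      G x / (x powr (- d) * L x) < exp (\<epsilon> / 8) \<and>
      exp (- (\<epsilon> * \<tau>)) < L (t * x) / L x \<and> L (t * x) / L x < exp (\<epsilon> * \<tau>)"
    unfolding eventually_at_top_linorder by blast
  have x0p: "x0 > 0" using x0[of x0] by simp
  have lo: "x powr (- d) * L x \<le> exp (\<epsilon> / 8) * G x"
    and hi: "G x \<le> exp (\<epsilon> / 8) * (x powr (- d) * L x)" if "x \<ge> x0" for x
  proof -
    have *: "x powr (- d) * L x > 0" using x0[OF that] L_pos by simp
    have "exp (- \<epsilon> / 8) * (x powr (- d) * L x) < G x"
      using x0[OF that] * by (subst (asm) pos_less_divide_eq) auto
    then have "exp (\<epsilon> / 8) * (exp (- \<epsilon> / 8) * (x powr (- d) * L x)) \<le> exp (\<epsilon> / 8) * G x"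
      by (intro mult_left_mono) auto
    then show "x powr (- d) * L x \<le> exp (\<epsilon> / 8) * G x"
      by (simp flip: exp_add mult.assoc)
    show "G x \<le> exp (\<epsilon> / 8) * (x powr (- d) * L x)"
      using x0[OF that] * by (simp add: pos_divide_less_eq)
  qed
  have compare: "L y \<le> exp (\<epsilon> / 2) * L x" if "x0 \<le> x" "x \<le> y" "y \<le> t * x" for x y
  proof -
    have xy: "x > 0" "y > 0" using x0p that by auto
    have "y powr (- d) * L y \<le> exp (\<epsilon> / 8) * G y" by (rule lo) (use that in auto)
    also have "\<dots> \<le> exp (\<epsilon> / 8) * G x" using that by (intro mult_left_mono G) auto
    also have "\<dots> \<le> exp (\<epsilon> / 8) * (exp (\<epsilon> / 8) * (x powr (- d) * L x))"
      using that by (intro mult_left_mono hi) auto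
    finally have "y powr d * (y powr (- d) * L y) \<le> y powr d * (exp (\<epsilon> / 4) * (x powr (- d) * L x))"
      by (intro mult_left_mono) (simp_all flip: mult.assoc exp_add)
    then have "L y \<le> y powr d * (exp (\<epsilon> / 4) * (x powr (- d) * L x))"
      using xy by (simp flip: mult.assoc powr_add)
    also have "\<dots> \<le> (t * x) powr d * (exp (\<epsilon> / 4) * (x powr (- d) * L x))"
      using xy that L_pos[of x] d by (intro mult_right_mono powr_mono2) auto
    also have "\<dots> = exp (d * \<tau> + \<epsilon> / 4) * L x"
    proof -
      have "(t * x) powr d = exp (d * \<tau>) * x powr d"
        using xy t by (simp add: powr_mult) (simp add: t_def powr_def)
      then show ?thesis using xy by (simp add: powr_minus exp_add)
    qed
    also have "\<dots> \<le> exp (\<epsilon> / 2) * L x"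
      using \<tau> L_pos[of x] xy by (intro mult_right_mono) auto
    finally show ?thesis .
  qed
  have tstep: "L (t * x) \<le> exp (\<epsilon> * \<tau>) * L x" "L x \<le> exp (\<epsilon> * \<tau>) * L (t * x)" if "x \<ge> x0" for x
  proof -
    have *: "L x > 0" using that x0p L_pos by auto
    show "L (t * x) \<le> exp (\<epsilon> * \<tau>) * L x" using x0[OF that] * by (simp add: pos_divide_less_eq)
    have "exp (- (\<epsilon> * \<tau>)) * L x \<le> L (t * x)" using x0[OF that] * by (simp add: pos_less_divide_eq)
    then have "exp (\<epsilon> * \<tau>) * (exp (- (\<epsilon> * \<tau>)) * L x) \<le> exp (\<epsilon> * \<tau>) * L (t * x)"
      by (intro mult_left_mono) auto
    then show "L x \<le> exp (\<epsilon> * \<tau>) * L (t * x)" by (simp flip: mult.assoc exp_add)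
  qed
  have base: "L y \<le> exp \<epsilon> * L x \<and> L x \<le> exp \<epsilon> * L y" if "x0 \<le> x" "x \<le> y" "y \<le> t * x" for x y
  proof
    have xy: "L x > 0" "L y > 0" using x0p that L_pos by auto
    have "L y \<le> exp (\<epsilon> / 2) * L x" using that by (rule compare)
    also have "\<dots> \<le> exp \<epsilon> * L x" using xy \<epsilon> by (intro mult_right_mono) auto
    finally show "L y \<le> exp \<epsilon> * L x" .
    \<comment> \<open>\<open>compare\<close> bounds L only in the direction of growing arguments.
      The reverse inequality goes from x to t * x, which is at least y, and then back to y by
      \<open>compare\<close>.\<close>
    have "L x \<le> exp (\<epsilon> * \<tau>) * L (t * x)" using that by (intro tstep)
    also have "\<dots> \<le> exp (\<epsilon> * \<tau>) * (exp (\<epsilon> / 2) * L y)"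
      using that t x0p by (intro mult_left_mono compare) auto
    also have "\<dots> = exp (\<epsilon> * \<tau> + \<epsilon> / 2) * L y" by (simp add: exp_add)
    also have "\<dots> \<le> exp \<epsilon> * L y"
    proof -
      have "\<epsilon> * \<tau> \<le> \<epsilon> * (1/4)" using \<epsilon> \<tau> by (intro mult_left_mono) auto
      then have "\<epsilon> * \<tau> + \<epsilon> / 2 \<le> \<epsilon>" using \<epsilon> by linarith
      then show ?thesis
          by (intro mult_right_mono[OF iffD2[OF exp_le_cancel_iff] less_imp_le[OF xy(2)]])
    qed
    finally show "L x \<le> exp \<epsilon> * L y" .
  qed
  \<comment> \<open>Every full factor t in y / x costs exp (\<epsilon> * \<tau>), exactly \<epsilon>
    times its logarithm; the last incomplete factor costs exp \<epsilon> once, which is the 1 in the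
    exponent.\<close>
  have chain: "L y \<le> exp (\<epsilon> * (1 + ln (y / x))) * L x \<and> L x \<le> exp (\<epsilon> * (1 + ln (y / x))) * L y"
    if "x0 \<le> x" "x \<le> y" "y \<le> t ^ n * x" for x y n
    using that
  proof (induction n arbitrary: x)
    case 0
    then have "x = y" by simp
    moreover have "L y \<le> exp \<epsilon> * L y" by (rule base[THEN conjunct1]) (use 0 t x0p \<open>x = y\<close> in auto)
    ultimately show ?case using 0 x0p by simp
  next
    case (Suc n)
    then have xy: "x > 0" "y > 0" "L x > 0" "L y > 0" using x0p L_pos by auto
    show ?case
    proof (cases "y \<le> t * x")
      case True
      have "exp \<epsilon> \<le> exp (\<epsilon> * (1 + ln (y / x)))" using xy Suc.prems \<epsilon> by (simp add: distrib_left)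
      then have "exp \<epsilon> * L x \<le> exp (\<epsilon> * (1 + ln (y / x))) * L x"
        "exp \<epsilon> * L y \<le> exp (\<epsilon> * (1 + ln (y / x))) * L y" using xy by auto
      with base[OF Suc.prems(1,2) True] show ?thesis by linarith
    next
      case False
      have "1 * x \<le> t * x" using t xy by (intro mult_right_mono) auto
      then have "x0 \<le> t * x" using Suc.prems by linarith
      then have IH: "L y \<le> exp (\<epsilon> * (1 + ln (y / (t * x)))) * L (t * x) \<and>
          L (t * x) \<le> exp (\<epsilon> * (1 + ln (y / (t * x)))) * L y"
        using False Suc.prems by (intro Suc.IH) (auto simp: mult_ac)
      have *: "\<epsilon> * (1 + ln (y / (t * x))) + \<epsilon> * \<tau> = \<epsilon> * (1 + ln (y / x))"
        using xy t by (simp add: ln_div ln_mult t_def algebra_simps)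
      have e: "exp (\<epsilon> * (1 + ln (y / (t * x)))) * exp (\<epsilon> * \<tau>) = exp (\<epsilon> * (1 + ln (y / x)))"
        by (simp only: exp_add[symmetric] *)
      have "L y \<le> exp (\<epsilon> * (1 + ln (y / (t * x)))) * (exp (\<epsilon> * \<tau>) * L x)"
        using IH tstep(1)[OF Suc.prems(1)] by (meson exp_ge_zero mult_left_mono order_trans)
      moreover have "L x \<le> exp (\<epsilon> * \<tau>) * (exp (\<epsilon> * (1 + ln (y / (t * x)))) * L y)"
        using IH tstep(2)[OF Suc.prems(1)] by (meson exp_ge_zero mult_left_mono order_trans)
      ultimately show ?thesis unfolding e[symmetric] by (simp add: mult_ac)
    qed
  qed
  have "L y \<le> exp (\<epsilon> * (1 + \<bar>ln (y / x)\<bar>)) * L x" if "x \<ge> x0" "y \<ge> x0" for x y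
  proof -
    have ex: "\<exists>n. v \<le> t ^ n * u" if "u > 0" "v > 0" for u v
    proof -
      obtain n where "v / u < t ^ n" using real_arch_pow[OF t(1)] by blast
      then show ?thesis using that by (intro exI[of _ n]) (simp add: divide_less_eq)
    qed
    have xy: "x > 0" "y > 0" using that x0p by auto
    show ?thesis
    proof (cases "x \<le> y")
      case True
      obtain n where "y \<le> t ^ n * x" using ex xy by blast
      from chain[OF that(1) True this] show ?thesis using True xy by simp
    next
      case False
      obtain n where "x \<le> t ^ n * y" using ex xy by blast
      moreover have "\<bar>ln (y / x)\<bar> = ln (x / y)" using False xy by (simp add: ln_div)
      ultimately show ?thesis using chain[OF that(2), of x n] False xy by simp
    qed
  qed
  then show "\<exists>x0>0. \<forall>x\<ge>x0. \<forall>y\<ge>x0. L y \<le> exp (\<epsilon> * (1 + \<bar>ln (y / x)\<bar>)) * L x"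
    using x0p by blast
qed (use L_pos in auto)

section \<open>Consequences of the Potter bounds\<close>

context slow_variation
begin

text \<open>The arguments need not have the exact ratio t: while ln (y n / x n) stays bounded, the
  Potter exponent is a bounded multiple of an arbitrary \<epsilon>.\<close>

lemma ratio_limit:
  assumes x: "filterlim x at_top F" and y: "((\<lambda>n. y n / x n) \<longlongrightarrow> t) F" and t: "t > 0"
  shows "((\<lambda>n. L (y n) / L (x n)) \<longlongrightarrow> 1) F"
proof -
  have yt: "filterlim y at_top F"
  proof -
    have "filterlim (\<lambda>n. (y n / x n) * x n) at_top F"
      by (rule filterlim_tendsto_pos_mult_at_top[OF y t x])
    moreover have "eventually (\<lambda>n. (y n / x n) * x n = y n) F"
      using filterlim_at_top_dense[THEN iffD1, OF x, rule_format, of 0] by eventually_elim auto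
    ultimately show ?thesis by (simp cong: filterlim_cong)
  qed
  have ln_lim: "((\<lambda>n. ln (y n / x n)) \<longlongrightarrow> ln t) F" using y t by (intro tendsto_intros) auto
  have "((\<lambda>n. ln (L (y n) / L (x n))) \<longlongrightarrow> 0) F"
  proof (rule tendstoI)
    fix e :: real assume e: "e > 0"
    \<comment> \<open>Eventually ln (y n / x n) has absolute value at most 1 + |ln t|, so the Potter
      exponent is at most \<epsilon> * (2 + |ln t|) < e.\<close>
    define \<epsilon> where "\<epsilon> = e / (3 + \<bar>ln t\<bar>)"
    have \<epsilon>: "\<epsilon> > 0" "\<epsilon> * (2 + \<bar>ln t\<bar>) < e" using e by (auto simp: \<epsilon>_def field_simps)
    obtain x0 where x0: "x0 > 0" "\<And>x y. x \<ge> x0 \<Longrightarrow> y \<ge> x0 \<Longrightarrow> L y \<le> exp (\<epsilon> * (1 + \<bar>ln (y / x)\<bar>)) * L x"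
      using potter[OF \<epsilon>(1)] by blast
    have "eventually (\<lambda>n. dist (ln (y n / x n)) (ln t) < 1) F" using ln_lim by (rule tendstoD) simp
    moreover have "eventually (\<lambda>n. x n \<ge> x0) F" "eventually (\<lambda>n. y n \<ge> x0) F"
      using x yt by (auto simp: filterlim_at_top)
    ultimately show "eventually (\<lambda>n. dist (ln (L (y n) / L (x n))) 0 < e) F"
    proof eventually_elim
      case (elim n)
      have pos: "x n > 0" "y n > 0" "L (x n) > 0" "L (y n) > 0" using elim x0 L_pos by auto
      define q where "q = \<epsilon> * (1 + \<bar>ln (y n / x n)\<bar>)"
      have "\<bar>ln (y n / x n)\<bar> \<le> 1 + \<bar>ln t\<bar>" using elim(1) by (simp add: dist_real_def)
      then have "q \<le> \<epsilon> * (2 + \<bar>ln t\<bar>)" unfolding q_def using \<epsilon> by (intro mult_left_mono) auto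
      then have q: "q < e" using \<epsilon> by simp
      have "L (y n) \<le> exp q * L (x n)" using x0(2)[of "x n" "y n"] elim by (simp add: q_def)
      then have "ln (L (y n)) \<le> ln (exp q * L (x n))" using pos by (subst ln_le_cancel_iff) auto
      moreover have "L (x n) \<le> exp q * L (y n)"
      proof -
        have "\<bar>ln (x n / y n)\<bar> = \<bar>ln (y n / x n)\<bar>" using pos by (simp add: ln_div)
        then show ?thesis using x0(2)[of "y n" "x n"] elim by (simp add: q_def)
      qed
      then have "ln (L (x n)) \<le> ln (exp q * L (y n))" using pos by (subst ln_le_cancel_iff) auto
      ultimately show ?case using pos q by (simp add: ln_mult ln_div dist_real_def)
    qed
  qed
  then have "((\<lambda>n. exp (ln (L (y n) / L (x n)))) \<longlongrightarrow> exp 0) F" by (rule tendsto_exp)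
  moreover have "eventually (\<lambda>n. exp (ln (L (y n) / L (x n))) = L (y n) / L (x n)) F"
    using filterlim_at_top_dense[THEN iffD1, OF x, rule_format, of 0]
      filterlim_at_top_dense[THEN iffD1, OF yt, rule_format, of 0]
    by eventually_elim (use L_pos in auto)
  ultimately show ?thesis using Lim_transform_eventually by fastforce
qed

lemma powr_ratio_limit:
  assumes x: "filterlim x at_top F" and y: "((\<lambda>n. y n / x n) \<longlongrightarrow> t) F" and t: "t > 0"
  shows "((\<lambda>n. (y n powr p * L (y n)) / (x n powr p * L (x n))) \<longlongrightarrow> t powr p) F"
proof -
  have "((\<lambda>n. (y n / x n) powr p * (L (y n) / L (x n))) \<longlongrightarrow> t powr p * 1) F"
    using t by (intro tendsto_intros y ratio_limit[OF x y t]) auto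
  then have "((\<lambda>n. (y n / x n) powr p * (L (y n) / L (x n))) \<longlongrightarrow> t powr p) F" by simp
  moreover have "eventually (\<lambda>n. (y n / x n) powr p * (L (y n) / L (x n)) =
      (y n powr p * L (y n)) / (x n powr p * L (x n))) F"
    using filterlim_at_top_dense[THEN iffD1, OF x, rule_format, of 0] order_tendstoD(1)[OF y t]
    by eventually_elim (auto simp: powr_divide zero_less_divide_iff)
  ultimately show ?thesis by (rule Lim_transform_eventually)
qed

lemma power_bounds:
  assumes "\<delta> > 0"
  shows "\<exists>C>0. eventually (\<lambda>x. L x \<le> C * x powr \<delta> \<and> x powr (- \<delta>) \<le> C * L x) at_top"
proof -
  obtain x0 where x0: "x0 > 0" "\<And>x y. x \<ge> x0 \<Longrightarrow> y \<ge> x0 \<Longrightarrow> L y \<le> exp (\<delta> * (1 + \<bar>ln (y / x)\<bar>)) * L x"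
    using potter[OF assms] by blast
  define K where "K = exp (\<delta> * (1 - ln x0))"
  define C where "C = K * L x0 + K / L x0"
  have Lx0: "L x0 > 0" using x0 L_pos by auto
  have K: "K > 0" by (simp add: K_def)
  have C: "C > 0" "K * L x0 \<le> C" "K / L x0 \<le> C" using Lx0 K by (auto simp: C_def add_pos_pos)
  have "eventually (\<lambda>x. L x \<le> C * x powr \<delta> \<and> x powr (- \<delta>) \<le> C * L x) at_top"
    using eventually_ge_at_top[of x0]
  proof eventually_elim
    case (elim x)
    have x: "x > 0" "L x > 0" using elim x0 L_pos by auto
    have e: "exp (\<delta> * (1 + ln (x / x0))) = K * x powr \<delta>"
      using x x0 by (simp add: K_def powr_def ln_div algebra_simps flip: exp_add)
    have a: "\<bar>ln (x / x0)\<bar> = ln (x / x0)" "\<bar>ln (x0 / x)\<bar> = ln (x / x0)" using elim x x0 by (auto simp: ln_div)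
    have "L x \<le> (K * x powr \<delta>) * L x0" using x0(2)[of x0 x] elim unfolding a e by simp
    also have "\<dots> = (K * L x0) * x powr \<delta>" by simp
    also have "\<dots> \<le> C * x powr \<delta>" using C by (intro mult_right_mono) auto
    finally have 1: "L x \<le> C * x powr \<delta>" .
    have "L x0 \<le> (K * x powr \<delta>) * L x" using x0(2)[of x x0] elim unfolding a e by simp
    then have "x powr (- \<delta>) \<le> (K / L x0) * L x"
      using Lx0 x by (simp add: powr_minus field_simps)
    also have "\<dots> \<le> C * L x" using C x by (intro mult_right_mono) auto
    finally show ?case using 1 by simp
  qed
  with C show ?thesis by blast
qed

lemma powr_weight_summable:
  assumes "p < -1"
  shows "summable (\<lambda>n. real (Suc n) powr p * L (real (Suc n)))"
proof -
  define \<delta> where "\<delta> = (-1 - p) / 2"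
  have \<delta>: "\<delta> > 0" "p + \<delta> < -1" using assms by (auto simp: \<delta>_def field_simps)
  obtain C where C: "C > 0" "eventually (\<lambda>x. L x \<le> C * x powr \<delta> \<and> x powr (- \<delta>) \<le> C * L x) at_top"
    using power_bounds[OF \<delta>(1)] by blast
  have ev: "eventually (\<lambda>n. norm (real (Suc n) powr p * L (real (Suc n))) \<le>
      C * real (Suc n) powr (p + \<delta>)) sequentially"
    using eventually_compose_filterlim[OF C(2) filterlim_real_Suc]
  proof eventually_elim
    case (elim n)
    have "real (Suc n) powr p * L (real (Suc n)) \<le> real (Suc n) powr p * (C * real (Suc n) powr \<delta>)"
      using elim by (intro mult_left_mono) auto
    also have "\<dots> = C * real (Suc n) powr (p + \<delta>)" by (simp add: powr_add)
    finally show ?case using L_pos[of "real (Suc n)"] by (simp add: abs_mult)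
  qed
  show ?thesis
  proof (rule summable_comparison_test_ev[OF ev])
    show "summable (\<lambda>n. C * real (Suc n) powr (p + \<delta>))"
      using \<delta> by (intro summable_mult) (subst summable_Suc_iff, simp add: summable_real_powr_iff)
  qed
qed

text \<open>The shift to \<open>Suc n\<close> keeps the weight positive at n = 0, since positivity
  of L is known for positive arguments only.\<close>

lemma subexponential_weight:
  assumes a: "a > 1"
  shows "subexponential_weight (\<lambda>n. real (Suc n) powr (- a) * L (real (Suc n)))" (is "subexponential_weight ?g")
proof
  show gpos: "?g n > 0" for n using L_pos[of "real (Suc n)"] by simp
  show "summable ?g" using a by (intro powr_weight_summable) auto
  have "(\<lambda>n. real (Suc (Suc n)) / real (Suc n)) \<longlonglongrightarrow> 1" by real_asymp
  from powr_ratio_limit[OF filterlim_real_Suc this, of "-a"] show "(\<lambda>n. ?g (Suc n) / ?g n) \<longlonglongrightarrow> 1" by simp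
  obtain x0 where x0: "x0 > 0" "\<And>x y. x \<ge> x0 \<Longrightarrow> y \<ge> x0 \<Longrightarrow> L y \<le> exp (1 * (1 + \<bar>ln (y / x)\<bar>)) * L x"
    using potter[of 1] by auto
  define N where "N = nat \<lceil>x0\<rceil>"
  have N: "real n \<ge> x0" if "n \<ge> N" for n using that unfolding N_def by linarith
  define C1 where "C1 = 2 powr a * exp (1 + ln 2)"
  \<comment> \<open>Below the Potter threshold only finitely many pairs (k, n) are left, as n \<le>
    2 * k \<le> 2 * N.\<close>
  define S where "S = (\<lambda>(k, n). ?g k / ?g n) ` ({..N} \<times> {..2 * N})"
  show "\<exists>C. \<forall>k n. k \<le> n \<longrightarrow> n \<le> 2 * k \<longrightarrow> ?g k \<le> C * ?g n"
  proof (intro exI allI impI)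
    fix k n :: nat assume kn: "k \<le> n" "n \<le> 2 * k"
    have C1: "C1 > 0" by (simp add: C1_def)
    show "?g k \<le> max C1 (Max S) * ?g n"
    proof (cases "k \<le> N")
      case True
      then have "?g k / ?g n \<le> Max S" using kn by (intro Max_ge) (auto simp: S_def intro!: image_eqI[of _ _ "(k, n)"])
      also have "\<dots> \<le> max C1 (Max S)" by simp
      finally show ?thesis using gpos[of n] by (subst (asm) pos_divide_le_eq)
    next
      case False
      have q: "real (Suc n) / real (Suc k) \<ge> 1" "real (Suc n) / real (Suc k) \<le> 2"
        using kn by (auto simp: field_simps)
      have "\<bar>ln (real (Suc k) / real (Suc n))\<bar> = ln (real (Suc n) / real (Suc k))"
        using kn by (simp add: ln_div)
      also have "\<dots> \<le> ln 2" using q by (subst ln_le_cancel_iff) auto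
      finally have l: "\<bar>ln (real (Suc k) / real (Suc n))\<bar> \<le> ln 2" .
      have "L (real (Suc k)) \<le> exp (1 * (1 + \<bar>ln (real (Suc k) / real (Suc n))\<bar>)) * L (real (Suc n))"
        using False kn by (intro x0(2) N) auto
      also have "\<dots> \<le> exp (1 + ln 2) * L (real (Suc n))"
        using l L_pos[of "real (Suc n)"] by (intro mult_right_mono) auto
      finally have 1: "L (real (Suc k)) \<le> exp (1 + ln 2) * L (real (Suc n))" .
      have "real (Suc k) powr (- a) = (real (Suc n) / real (Suc k)) powr a * real (Suc n) powr (- a)"
        by (simp add: powr_divide powr_minus field_simps)
      also have "\<dots> \<le> 2 powr a * real (Suc n) powr (- a)"
        using q a by (intro mult_right_mono powr_mono2) auto
      finally have "?g k \<le> (2 powr a * real (Suc n) powr (- a)) * (exp (1 + ln 2) * L (real (Suc n)))"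
        using L_pos[of "real (Suc k)"] 1 by (intro mult_mono) auto
      also have "\<dots> = C1 * ?g n" by (simp add: C1_def)
      also have "\<dots> \<le> max C1 (Max S) * ?g n" using gpos[of n] by (intro mult_right_mono) auto
      finally show ?thesis .
    qed
  qed
qed

end

section \<open>Karamata's theorem for sums\<close>

lemma powr_tail_sum_bounds:
  assumes q: "q > 1" and n: "n \<ge> (1::nat)"
  shows "summable (\<lambda>k. real (k + Suc n) powr (- q))"
    and "(\<Sum>k. real (k + Suc n) powr (- q)) \<le> real n powr (1 - q) / (q - 1)"
    and "real (Suc n) powr (1 - q) / (q - 1) \<le> (\<Sum>k. real (k + Suc n) powr (- q))"
proof -
  \<comment> \<open>The mean value theorem for x powr (1 - q) compares each summand with a
    telescoping difference on either side, in place of an integral comparison.\<close>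
  have step: "(q - 1) * (x + 1) powr (- q) \<le> x powr (1 - q) - (x + 1) powr (1 - q)"
     "x powr (1 - q) - (x + 1) powr (1 - q) \<le> (q - 1) * x powr (- q)" if x: "x > 0" for x
  proof -
    have "\<exists>z>x. z < x + 1 \<and> (x + 1) powr (1 - q) - x powr (1 - q) = (x + 1 - x) * ((1 - q) * z powr (- q))"
    proof (rule MVT2)
      fix z assume "x \<le> z" "z \<le> x + 1"
      then show "((\<lambda>z. z powr (1 - q)) has_real_derivative (1 - q) * z powr (- q)) (at z)"
        using x by (auto intro!: derivative_eq_intros)
    qed simp
    then obtain z where z: "x < z" "z < x + 1"
      "(x + 1) powr (1 - q) - x powr (1 - q) = (1 - q) * z powr (- q)" by auto
    have "(x + 1) powr (- q) \<le> z powr (- q)" "z powr (- q) \<le> x powr (- q)"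
      using x z q by (auto intro!: powr_mono2')
    then have "(q - 1) * (x + 1) powr (- q) \<le> (q - 1) * z powr (- q)"
      "(q - 1) * z powr (- q) \<le> (q - 1) * x powr (- q)" using q by (auto intro: mult_left_mono)
    with z show "(q - 1) * (x + 1) powr (- q) \<le> x powr (1 - q) - (x + 1) powr (1 - q)"
     "x powr (1 - q) - (x + 1) powr (1 - q) \<le> (q - 1) * x powr (- q)" by (auto simp: algebra_simps)
  qed
  have lim: "(\<lambda>k. real (k + m) powr (1 - q)) \<longlonglongrightarrow> 0" for m :: nat
    using q by real_asymp
  have tele: "(\<lambda>k. real (k + m) powr (1 - q) - real (Suc k + m) powr (1 - q)) sums (real m powr (1 - q))" for m :: nat
    using telescope_sums'[OF lim[of m]] by simp
  show s: "summable (\<lambda>k. real (k + Suc n) powr (- q))"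
    using q by (subst summable_iff_shift) (simp add: summable_real_powr_iff)
  have "(\<Sum>k. (q - 1) * real (k + Suc n) powr (- q)) \<le> (\<Sum>k. real (k + n) powr (1 - q) - real (Suc k + n) powr (1 - q))"
    using step(1)[of "real (_ + n)"] n s tele[of n] by (intro suminf_le summable_mult) (auto simp: sums_iff add_ac)
  then show "(\<Sum>k. real (k + Suc n) powr (- q)) \<le> real n powr (1 - q) / (q - 1)"
    unfolding suminf_mult[OF s] sums_unique[OF tele, symmetric]
    using q by (simp add: pos_le_divide_eq mult.commute)
  have "(\<Sum>k. real (k + Suc n) powr (1 - q) - real (Suc k + Suc n) powr (1 - q)) \<le> (\<Sum>k. (q - 1) * real (k + Suc n) powr (- q))"
    using step(2)[of "real (_ + Suc n)"] n s tele[of "Suc n"] by (intro suminf_le summable_mult) (auto simp: sums_iff add_ac)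
  then show "real (Suc n) powr (1 - q) / (q - 1) \<le> (\<Sum>k. real (k + Suc n) powr (- q))"
    unfolding suminf_mult[OF s] sums_unique[OF tele, symmetric]
    using q by (simp add: pos_divide_le_eq mult.commute)
qed

text \<open>For k > n the Potter bounds replace L k by L n times a power of k / n with exponent
  \<epsilon> or - \<epsilon>. What remains are pure power sums with explicit bounds, and \<epsilon>
  is sent to 0 last.\<close>

lemma (in slow_variation) karamata_tail_sum:
  assumes p: "p > 1" and u: "\<And>n. u n \<ge> 0" "summable u"
    and lim: "(\<lambda>n. u n / (real n powr (- p) * L (real n))) \<longlonglongrightarrow> c"
  shows "(\<lambda>n. (\<Sum>k. u (k + Suc n)) / (real n powr (1 - p) * L (real n))) \<longlonglongrightarrow> c / (p - 1)"
proof -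
  have c: "c \<ge> 0"
    using lim by (rule LIMSEQ_le_const) (use u L_pos in \<open>auto intro!: exI[of _ 1] divide_nonneg_pos\<close>)
  define f where "f n = (\<Sum>k. u (k + Suc n)) / (real n powr (1 - p) * L (real n))" for n
  \<comment> \<open>The maximum with 0 keeps the lower coefficient nonnegative even if c <
    \<epsilon>, as monotonicity requires. The ratio of \<open>Suc n\<close> to \<open>n\<close>
    appears because the lower bound of the power sum over k > n starts at n + 1.\<close>
  have key: "eventually (\<lambda>n. f n \<le> (c + \<epsilon>) * exp \<epsilon> / (p - 1 - \<epsilon>) \<and>
      max 0 (c - \<epsilon>) * exp (- \<epsilon>) / (p - 1 + \<epsilon>) * (real (Suc n) / real n) powr (1 - p - \<epsilon>) \<le> f n) sequentially"
    if \<epsilon>: "\<epsilon> > 0" "\<epsilon> < p - 1" for \<epsilon>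
  proof -
    obtain x0 where x0: "x0 > 0" "\<And>x y. x \<ge> x0 \<Longrightarrow> y \<ge> x0 \<Longrightarrow> L y \<le> exp (\<epsilon> * (1 + \<bar>ln (y / x)\<bar>)) * L x"
      using potter[OF \<epsilon>(1)] by blast
    obtain N0 where N0: "\<And>n. n \<ge> N0 \<Longrightarrow> u n / (real n powr (- p) * L (real n)) < c + \<epsilon> \<and>
        c - \<epsilon> < u n / (real n powr (- p) * L (real n))"
      using eventually_conj[OF order_tendstoD(2)[OF lim, of "c + \<epsilon>"] order_tendstoD(1)[OF lim, of "c - \<epsilon>"]] \<epsilon>
      unfolding eventually_sequentially by auto
    define N where "N = max 1 (max N0 (nat \<lceil>x0\<rceil>))"
    have "f n \<le> (c + \<epsilon>) * exp \<epsilon> / (p - 1 - \<epsilon>) \<and>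
      max 0 (c - \<epsilon>) * exp (- \<epsilon>) / (p - 1 + \<epsilon>) * (real (Suc n) / real n) powr (1 - p - \<epsilon>) \<le> f n" if n: "n \<ge> N" for n
    proof -
      have n': "n \<ge> 1" "real n \<ge> x0" "n \<ge> N0" using n by (auto simp: N_def)
      have Ln: "L (real n) > 0" "real n > 0" using n' x0 L_pos by auto
      have sh: "summable (\<lambda>k. u (k + Suc n))" using u by (subst summable_iff_shift)
      have ub: "u k \<le> (c + \<epsilon>) * exp \<epsilon> * real n powr (- \<epsilon>) * L (real n) * real k powr (- (p - \<epsilon>))"
        and lb: "max 0 (c - \<epsilon>) * exp (- \<epsilon>) * real n powr \<epsilon> * L (real n) * real k powr (- (p + \<epsilon>)) \<le> u k" if k: "k > n" for k
      proof -
        have k': "real k > 0" "L (real k) > 0" "real k \<ge> x0" "k \<ge> N0" "real k powr (- p) > 0" using k n' x0 L_pos by auto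
        have e: "exp (\<epsilon> * (1 + ln (real k / real n))) = exp \<epsilon> * (real k powr \<epsilon> * real n powr (- \<epsilon>))"
          using k' Ln by (simp add: ln_div powr_def algebra_simps flip: exp_add)
        have ab: "\<bar>ln (real k / real n)\<bar> = ln (real k / real n)" "\<bar>ln (real n / real k)\<bar> = ln (real k / real n)"
          using k k' Ln by (auto simp: ln_div)
        have Lk: "L (real k) \<le> exp \<epsilon> * (real k powr \<epsilon> * real n powr (- \<epsilon>)) * L (real n)"
          using x0(2)[of "real n" "real k"] k' n' unfolding ab e by simp
        have Ln': "L (real n) \<le> exp \<epsilon> * (real k powr \<epsilon> * real n powr (- \<epsilon>)) * L (real k)"
          using x0(2)[of "real k" "real n"] k' n' unfolding ab e by simp
        have "u k \<le> (c + \<epsilon>) * (real k powr (- p) * L (real k))"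
          using N0[of k] k' by (simp add: divide_less_eq)
        also have "\<dots> \<le> (c + \<epsilon>) * (real k powr (- p) * (exp \<epsilon> * (real k powr \<epsilon> * real n powr (- \<epsilon>)) * L (real n)))"
          using Lk c \<epsilon> by (intro mult_left_mono) auto
        also have "\<dots> = (c + \<epsilon>) * exp \<epsilon> * real n powr (- \<epsilon>) * L (real n) * (real k powr (- p) * real k powr \<epsilon>)"
          by simp
        finally show "u k \<le> (c + \<epsilon>) * exp \<epsilon> * real n powr (- \<epsilon>) * L (real n) * real k powr (- (p - \<epsilon>))"
          by (simp flip: powr_add)
        have cancel: "real n powr \<epsilon> * (real n powr (- \<epsilon>) * (exp \<epsilon> * exp (- \<epsilon>))) = 1"
          "real k powr (- \<epsilon>) * real k powr \<epsilon> = 1"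
          using Ln k' by (simp_all flip: powr_add exp_add mult.assoc)
        have "- (p + \<epsilon>) = - \<epsilon> + - p" by simp
        then have "real k powr (- (p + \<epsilon>)) = real k powr (- \<epsilon>) * real k powr (- p)"
          by (simp only: powr_add)
        then have "max 0 (c - \<epsilon>) * exp (- \<epsilon>) * real n powr \<epsilon> * L (real n) * real k powr (- (p + \<epsilon>)) =
           max 0 (c - \<epsilon>) * (exp (- \<epsilon>) * real n powr \<epsilon> * real k powr (- \<epsilon>)) * real k powr (- p) * L (real n)"
          by (simp only: mult_ac)
        also have "\<dots> \<le> max 0 (c - \<epsilon>) * (exp (- \<epsilon>) * real n powr \<epsilon> * real k powr (- \<epsilon>)) * real k powr (- p) *
            (exp \<epsilon> * (real k powr \<epsilon> * real n powr (- \<epsilon>)) * L (real k))"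
          using Ln' by (intro mult_left_mono) auto
        also have "\<dots> = max 0 (c - \<epsilon>) * (real n powr \<epsilon> * (real n powr (- \<epsilon>) * (exp \<epsilon> * exp (- \<epsilon>)))) *
            (real k powr (- \<epsilon>) * real k powr \<epsilon>) * (real k powr (- p) * L (real k))"
          by (simp only: mult_ac)
        also have "\<dots> = max 0 (c - \<epsilon>) * (real k powr (- p) * L (real k))"
          by (simp only: cancel mult_1_right)
        also have "\<dots> \<le> u k"
          using N0[of k] k' u(1)[of k] by (auto simp: max_def less_divide_eq)
        finally show "max 0 (c - \<epsilon>) * exp (- \<epsilon>) * real n powr \<epsilon> * L (real n) * real k powr (- (p + \<epsilon>)) \<le> u k" .
      qed
      have pe: "p - \<epsilon> - 1 = p - 1 - \<epsilon>" "p + \<epsilon> - 1 = p - 1 + \<epsilon>" "1 - (p + \<epsilon>) = 1 - p - \<epsilon>" by auto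
      have q: "p - \<epsilon> > 1" "p + \<epsilon> > 1" using \<epsilon> p by auto
      have cc: "(c + \<epsilon>) * exp \<epsilon> * real n powr (- \<epsilon>) * L (real n) \<ge> 0" 
        "max 0 (c - \<epsilon>) * exp (- \<epsilon>) * real n powr \<epsilon> * L (real n) \<ge> 0"
        using c \<epsilon> Ln by auto
      have "(\<Sum>k. u (k + Suc n)) \<le> (\<Sum>k. (c + \<epsilon>) * exp \<epsilon> * real n powr (- \<epsilon>) * L (real n) * real (k + Suc n) powr (- (p - \<epsilon>)))"
        by (intro suminf_le ub summable_mult powr_tail_sum_bounds q n' sh) auto
      also have "\<dots> = (c + \<epsilon>) * exp \<epsilon> * real n powr (- \<epsilon>) * L (real n) * (\<Sum>k. real (k + Suc n) powr (- (p - \<epsilon>)))"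
        by (rule suminf_mult) (intro powr_tail_sum_bounds q n')
      also have "\<dots> \<le> (c + \<epsilon>) * exp \<epsilon> * real n powr (- \<epsilon>) * L (real n) * (real n powr (1 - (p - \<epsilon>)) / (p - \<epsilon> - 1))"
        by (intro mult_left_mono powr_tail_sum_bounds q n' cc)
      also have "\<dots> = (c + \<epsilon>) * exp \<epsilon> / (p - 1 - \<epsilon>) * (L (real n) * (real n powr (- \<epsilon>) * real n powr (1 - (p - \<epsilon>))))"
        unfolding pe by (simp only: times_divide_eq_left times_divide_eq_right mult_ac)
      also have "real n powr (- \<epsilon>) * real n powr (1 - (p - \<epsilon>)) = real n powr (1 - p)"
        by (simp flip: powr_add)
      finally have 1: "f n \<le> (c + \<epsilon>) * exp \<epsilon> / (p - 1 - \<epsilon>)"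
        unfolding f_def using Ln by (subst pos_divide_le_eq) (auto simp: mult_ac)
      have "max 0 (c - \<epsilon>) * exp (- \<epsilon>) / (p - 1 + \<epsilon>) * (real (Suc n) / real n) powr (1 - p - \<epsilon>) * (real n powr (1 - p) * L (real n))
          = max 0 (c - \<epsilon>) * exp (- \<epsilon>) * L (real n) * (real (Suc n) powr (1 - (p + \<epsilon>)) / (p + \<epsilon> - 1)) * (real n powr (1 - p) / real n powr (1 - p - \<epsilon>))"
        unfolding pe by (simp only: powr_divide of_nat_0_le_iff times_divide_eq_left times_divide_eq_right divide_divide_eq_left mult_ac)
      also have "real n powr (1 - p) / real n powr (1 - p - \<epsilon>) = real n powr \<epsilon>"
        by (simp flip: powr_diff)
      also have "max 0 (c - \<epsilon>) * exp (- \<epsilon>) * L (real n) * (real (Suc n) powr (1 - (p + \<epsilon>)) / (p + \<epsilon> - 1)) * real n powr \<epsilon> =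
        max 0 (c - \<epsilon>) * exp (- \<epsilon>) * real n powr \<epsilon> * L (real n) * (real (Suc n) powr (1 - (p + \<epsilon>)) / (p + \<epsilon> - 1))"
        by (simp only: mult_ac)
      also have "\<dots> \<le> max 0 (c - \<epsilon>) * exp (- \<epsilon>) * real n powr \<epsilon> * L (real n) * (\<Sum>k. real (k + Suc n) powr (- (p + \<epsilon>)))"
        by (intro mult_left_mono powr_tail_sum_bounds q n' cc)
      also have "\<dots> = (\<Sum>k. max 0 (c - \<epsilon>) * exp (- \<epsilon>) * real n powr \<epsilon> * L (real n) * real (k + Suc n) powr (- (p + \<epsilon>)))"
        by (rule suminf_mult[symmetric]) (intro powr_tail_sum_bounds q n')
      also have "\<dots> \<le> (\<Sum>k. u (k + Suc n))"
        by (intro suminf_le lb summable_mult powr_tail_sum_bounds q n' sh) auto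
      finally have 2: "max 0 (c - \<epsilon>) * exp (- \<epsilon>) / (p - 1 + \<epsilon>) * (real (Suc n) / real n) powr (1 - p - \<epsilon>) \<le> f n"
        unfolding f_def using Ln by (subst pos_le_divide_eq) auto
      from 1 2 show ?thesis by simp
    qed
    then show ?thesis unfolding eventually_sequentially by blast
  qed
  have up: "((\<lambda>\<epsilon>. (c + \<epsilon>) * exp \<epsilon> / (p - 1 - \<epsilon>)) \<longlongrightarrow> (c + 0) * exp 0 / (p - 1 - 0)) (at_right 0)"
    using p by (intro tendsto_intros) auto
  have lo: "((\<lambda>\<epsilon>. max 0 (c - \<epsilon>) * exp (- \<epsilon>) / (p - 1 + \<epsilon>)) \<longlongrightarrow> max 0 (c - 0) * exp (- 0) / (p - 1 + 0)) (at_right 0)"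
    using p by (intro tendsto_intros) auto
  have e_ev: "eventually (\<lambda>\<epsilon>. \<epsilon> > 0 \<and> \<epsilon> < p - 1) (at_right (0::real))"
    unfolding eventually_at_right_field using p by (intro exI[of _ "p - 1"]) auto
  have "f \<longlonglongrightarrow> c / (p - 1)"
  proof (rule order_tendstoI)
    fix a assume a: "a < c / (p - 1)"
    have "eventually (\<lambda>\<epsilon>. a < max 0 (c - \<epsilon>) * exp (- \<epsilon>) / (p - 1 + \<epsilon>)) (at_right 0)"
      by (rule order_tendstoD(1)[OF lo]) (use a c in simp)
    then obtain \<epsilon> where \<epsilon>: "\<epsilon> > 0" "\<epsilon> < p - 1" "a < max 0 (c - \<epsilon>) * exp (- \<epsilon>) / (p - 1 + \<epsilon>)"
      using eventually_happens'[OF trivial_limit_at_right_real eventually_conj[OF e_ev]] by blast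
    have "(\<lambda>n. (real (Suc n) / real n) powr (1 - p - \<epsilon>)) \<longlonglongrightarrow> 1" by real_asymp
    then have "(\<lambda>n. max 0 (c - \<epsilon>) * exp (- \<epsilon>) / (p - 1 + \<epsilon>) * (real (Suc n) / real n) powr (1 - p - \<epsilon>))
        \<longlonglongrightarrow> max 0 (c - \<epsilon>) * exp (- \<epsilon>) / (p - 1 + \<epsilon>) * 1" by (rule tendsto_mult_left)
    then have "eventually (\<lambda>n. a < max 0 (c - \<epsilon>) * exp (- \<epsilon>) / (p - 1 + \<epsilon>) * (real (Suc n) / real n) powr (1 - p - \<epsilon>)) sequentially"
      by (rule order_tendstoD(1)) (use \<epsilon> in simp)
    then show "eventually (\<lambda>n. a < f n) sequentially"
      using key[OF \<epsilon>(1,2)] by eventually_elim linarith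
  next
    fix a assume a: "c / (p - 1) < a"
    have "eventually (\<lambda>\<epsilon>. (c + \<epsilon>) * exp \<epsilon> / (p - 1 - \<epsilon>) < a) (at_right 0)"
      by (rule order_tendstoD(2)[OF up]) (use a c in simp)
    then obtain \<epsilon> where \<epsilon>: "\<epsilon> > 0" "\<epsilon> < p - 1" "(c + \<epsilon>) * exp \<epsilon> / (p - 1 - \<epsilon>) < a"
      using eventually_happens'[OF trivial_limit_at_right_real eventually_conj[OF e_ev]] by blast
    show "eventually (\<lambda>n. f n < a) sequentially"
      using key[OF \<epsilon>(1,2)] by eventually_elim (use \<epsilon> in linarith)
  qed
  then show ?thesis by (simp only: f_def[abs_def])
qed

section \<open>Compound Poisson tails\<close>

lemma sums_nonneg: "(\<And>n. 0 \<le> f n) \<Longrightarrow> f sums s \<Longrightarrow> 0 \<le> (s :: real)"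
  by (rule sums_le[OF _ sums_zero])

text \<open>Every finite partial sum lies below \<open>F\<close>; this yields both integrability of
  the terms and summability of their integrals.\<close>

lemma sums_integral_nonneg:
  fixes f :: "nat \<Rightarrow> 'a \<Rightarrow> real"
  assumes meas: "\<And>j. f j \<in> borel_measurable M"
    and nonneg: "\<And>j. AE \<omega> in M. 0 \<le> f j \<omega>"
    and sums: "AE \<omega> in M. (\<lambda>j. f j \<omega>) sums F \<omega>" and F: "integrable M F"
  shows "(\<lambda>j. \<integral>\<omega>. f j \<omega> \<partial>M) sums (\<integral>\<omega>. F \<omega> \<partial>M)"
proof -
  have nn: "AE \<omega> in M. \<forall>j. 0 \<le> f j \<omega>" using nonneg by (simp add: AE_all_countable)
  have le: "AE \<omega> in M. (\<Sum>j\<in>A. f j \<omega>) \<le> F \<omega>" if "finite A" for A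
    using sums nn
  proof eventually_elim
    case (elim \<omega>)
    then show ?case using that sum_le_suminf[of "\<lambda>j. f j \<omega>" A] by (simp add: sums_iff)
  qed
  have int: "integrable M (f j)" for j
    using F meas
  proof (rule Bochner_Integration.integrable_bound)
    show "AE \<omega> in M. norm (f j \<omega>) \<le> norm (F \<omega>)"
      using le[of "{j}"] nn by (auto elim!: eventually_elim2)
  qed
  have norm_eq: "(\<integral>\<omega>. norm (f j \<omega>) \<partial>M) = (\<integral>\<omega>. f j \<omega> \<partial>M)" for j
  proof (rule integral_cong_AE)
    show "AE \<omega> in M. norm (f j \<omega>) = f j \<omega>" using nonneg[of j] by eventually_elim simp
  qed (use meas in auto)
  have "(\<lambda>j. \<integral>\<omega>. f j \<omega> \<partial>M) sums (\<integral>\<omega>. (\<Sum>j. f j \<omega>) \<partial>M)"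
  proof (rule sums_integral)
    show "AE \<omega> in M. summable (\<lambda>j. norm (f j \<omega>))"
      using sums nn by eventually_elim (auto simp: sums_iff)
    show "summable (\<lambda>j. \<integral>\<omega>. norm (f j \<omega>) \<partial>M)" unfolding norm_eq
    proof (rule summableI_nonneg_bounded)
      show "(\<Sum>j<n. \<integral>\<omega>. f j \<omega> \<partial>M) \<le> (\<integral>\<omega>. F \<omega> \<partial>M)" for n
        by (subst Bochner_Integration.integral_sum[symmetric])
           (auto intro!: integral_mono_AE le F int Bochner_Integration.integrable_sum)
    qed (use nonneg in \<open>auto intro!: integral_nonneg_AE\<close>)
  qed (rule int)
  also have "(\<integral>\<omega>. (\<Sum>j. f j \<omega>) \<partial>M) = (\<integral>\<omega>. F \<omega> \<partial>M)"
    using sums meas borel_measurable_integrable[OF F]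
    by (intro integral_cong_AE) (auto simp: sums_iff elim!: eventually_mono)
  finally show ?thesis .
qed

lemma sums_swap_nonneg:
  fixes f :: "nat \<Rightarrow> nat \<Rightarrow> real"
  assumes nonneg: "\<And>n j. f n j \<ge> 0" and sums: "\<And>n. f n sums S n" and S: "S sums s"
  shows "(\<lambda>j. \<Sum>n. f n j) sums s"
proof -
  have S0: "S n \<ge> 0" for n using nonneg sums[of n] by (rule sums_nonneg)
  have intS: "integrable (count_space UNIV) S"
    using S S0 by (simp add: integrable_count_space_nat_iff sums_iff)
  have "(\<lambda>j. \<integral>n. f n j \<partial>count_space UNIV) sums (\<integral>n. S n \<partial>count_space UNIV)"
    by (rule sums_integral_nonneg) (use nonneg sums intS in \<open>auto simp: AE_count_space\<close>)
  moreover have "(\<integral>n. f n j \<partial>count_space UNIV) = (\<Sum>n. f n j)" for j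
  proof (rule integral_count_space_nat)
    have "f n j \<le> S n" for n
      using sums[of n] nonneg sum_le_suminf[of "f n" "{j}"] by (auto simp: sums_iff)
    then have "summable (\<lambda>n. norm (f n j))"
      using nonneg S by (intro summable_comparison_test[of "\<lambda>n. norm (f n j)" S]) (auto simp: sums_iff)
    then show "integrable (count_space UNIV) (\<lambda>n. f n j)" by (simp add: integrable_count_space_nat_iff)
  qed
  moreover have "(\<integral>n. S n \<partial>count_space UNIV) = s"
    using integral_count_space_nat[OF intS] S by (simp add: sums_iff)
  ultimately show ?thesis by simp
qed

section \<open>Poisson weights\<close>

definition poisson_weight :: "real \<Rightarrow> nat \<Rightarrow> real" where
  "poisson_weight m n = exp (- m) * m ^ n / fact n"

lemma poisson_weight_nonneg: "m \<ge> 0 \<Longrightarrow> poisson_weight m n \<ge> 0"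
  by (simp add: poisson_weight_def)

lemma poisson_weight_gf: "(\<lambda>n. poisson_weight m n * y ^ n) sums exp (m * (y - 1))"
proof -
  have "(\<lambda>n. exp (- m) * ((m * y) ^ n /\<^sub>R fact n)) sums (exp (- m) * exp (m * y))"
    by (intro sums_mult exp_converges)
  moreover have "exp (- m) * exp (m * y) = exp (m * (y - 1))"
    by (simp add: algebra_simps flip: exp_add)
  moreover have "exp (- m) * ((m * y) ^ n /\<^sub>R fact n) = poisson_weight m n * y ^ n" for n
    by (simp add: poisson_weight_def power_mult_distrib divide_inverse mult_ac)
  ultimately show ?thesis by simp
qed

lemma poisson_weight_sums: "poisson_weight m sums 1"
  using poisson_weight_gf[of m 1] by simp

lemma poisson_weight_mean: "(\<lambda>n. poisson_weight m n * real n) sums m"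
proof -
  have "poisson_weight m (Suc n) * real (Suc n) = m * poisson_weight m n" for n
    by (simp add: poisson_weight_def del: of_nat_Suc)
  then have "(\<lambda>n. poisson_weight m (Suc n) * real (Suc n)) sums (m * 1)"
    using sums_mult[OF poisson_weight_sums[of m], of m] by simp
  then show ?thesis by (subst (asm) sums_Suc_iff) simp
qed

text \<open>\<open>chi\<close> is the mean of the law \<open>x\<close>, obtained as the sum of its
  tails \<open>xb\<close>. Empty batches are allowed here.\<close>

locale batch_sizes =
  fixes x :: "nat \<Rightarrow> real" and xb :: "nat \<Rightarrow> real" and chi :: real
  assumes x_nonneg: "\<And>k. x k \<ge> 0" and x_sums: "x sums 1"
    and xb_eq: "\<And>j. xb j = 1 - (\<Sum>k\<le>j. x k)" and xb_sums: "xb sums chi"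
begin

lemma xb_nonneg: "xb j \<ge> 0"
  using sum_le_suminf[of x "{..j}"] x_nonneg x_sums by (auto simp: xb_eq sums_iff)

lemma xb_Suc: "xb j = x (Suc j) + xb (Suc j)"
  by (simp add: xb_eq)

lemma xb_gf:
  assumes z: "0 \<le> z" "z < 1" and X: "(\<lambda>k. x k * z ^ k) sums X"
  shows "(\<lambda>j. xb j * z ^ j) sums ((1 - X) / (1 - z))"
proof -
  have geo: "(\<lambda>k. 1 * z ^ k) sums (1 / (1 - z))" using geometric_sums[of z] z by simp
  have "(\<lambda>j. 1 * z ^ j - conv x (\<lambda>_. 1) j * z ^ j) sums (1 / (1 - z) - X * (1 / (1 - z)))"
    using z x_nonneg by (intro sums_diff geo conv_sums X) auto
  moreover have "1 * z ^ j - conv x (\<lambda>_. 1) j * z ^ j = xb j * z ^ j" for j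
    by (simp add: xb_eq conv_def algebra_simps)
  ultimately show ?thesis by (simp add: diff_divide_distrib)
qed

text \<open>\<open>sum_tail n j\<close> is the probability that \<open>n\<close> independent batches exceed \<open>j\<close> in total, and
  \<open>compound_tail m j\<close> below the same with a Poisson number of batches of mean \<open>m\<close>.\<close>
primrec sum_tail :: "nat \<Rightarrow> nat \<Rightarrow> real" where
  "sum_tail 0 = (\<lambda>_. 0)"
| "sum_tail (Suc n) = (\<lambda>j. xb j + conv x (sum_tail n) j)"

lemma sum_tail_nonneg: "sum_tail n j \<ge> 0"
  by (induction n arbitrary: j) (auto intro!: add_nonneg_nonneg conv_nonneg x_nonneg xb_nonneg)

lemma sum_tail_le_1: "sum_tail n j \<le> 1"
proof (induction n arbitrary: j)
  case (Suc n)
  have "conv x (sum_tail n) j \<le> (\<Sum>k\<le>j. x k * 1)"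
    unfolding conv_def by (intro sum_mono mult_left_mono Suc x_nonneg)
  then show ?case by (simp add: xb_eq[of j])
qed simp

lemma sum_tail_sums: "sum_tail n sums (real n * chi)"
proof (induction n)
  case (Suc n)
  have "sum_tail (Suc n) sums (chi + 1 * (real n * chi))"
    by (simp only: sum_tail.simps) (intro sums_add xb_sums conv_sums_1 x_sums Suc x_nonneg sum_tail_nonneg)
  then show ?case by (simp add: algebra_simps)
qed simp

lemma sum_tail_gf:
  assumes z: "0 \<le> z" "z < 1" and X: "(\<lambda>k. x k * z ^ k) sums X"
  shows "(\<lambda>j. sum_tail n j * z ^ j) sums ((1 - X ^ n) / (1 - z))"
proof (induction n)
  case (Suc n)
  have "(\<lambda>j. xb j * z ^ j + conv x (sum_tail n) j * z ^ j) sums ((1 - X) / (1 - z) + X * ((1 - X ^ n) / (1 - z)))"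
    by (intro sums_add xb_gf conv_sums X Suc x_nonneg sum_tail_nonneg z)
  moreover have "(1 - X) / (1 - z) + X * ((1 - X ^ n) / (1 - z)) = (1 - X ^ Suc n) / (1 - z)"
    by (simp add: algebra_simps flip: add_divide_distrib)
  ultimately show ?case by (simp add: distrib_right)
qed simp

text \<open>The first factor is the probability that n batches total at most j. As z \<le> 1, this
  is Markov's inequality for z to the power of the total; the induction conditions on the first
  batch.\<close>

lemma sum_tail_chernoff:
  assumes z: "0 < z" "z \<le> 1" and X: "(\<lambda>k. x k * z ^ k) sums X"
  shows "(1 - sum_tail n j) * z ^ j \<le> X ^ n"
proof (induction n arbitrary: j)
  case 0
  then show ?case using z by (simp add: power_le_one)
next
  case (Suc n)
  have X0: "X \<ge> 0" using z x_nonneg by (intro sums_nonneg[OF _ X]) auto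
  have "1 - sum_tail (Suc n) j = (\<Sum>k\<le>j. x k * (1 - sum_tail n (j - k)))"
    by (simp add: xb_eq[of j] conv_def right_diff_distrib sum_subtractf)
  then have "(1 - sum_tail (Suc n) j) * z ^ j = (\<Sum>k\<le>j. x k * (1 - sum_tail n (j - k)) * z ^ j)"
    by (simp only: sum_distrib_right)
  also have "\<dots> = (\<Sum>k\<le>j. x k * z ^ k * ((1 - sum_tail n (j - k)) * z ^ (j - k)))"
  proof (intro sum.cong refl)
    fix k assume "k \<in> {..j}"
    then have "z ^ j = z ^ k * z ^ (j - k)" by (simp flip: power_add)
    then show "x k * (1 - sum_tail n (j - k)) * z ^ j = x k * z ^ k * ((1 - sum_tail n (j - k)) * z ^ (j - k))"
      by simp
  qed
  also have "\<dots> \<le> (\<Sum>k\<le>j. x k * z ^ k * X ^ n)"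
    using z x_nonneg by (intro sum_mono mult_left_mono Suc) auto
  also have "\<dots> = (\<Sum>k\<le>j. x k * z ^ k) * X ^ n" by (simp add: sum_distrib_right)
  also have "\<dots> \<le> X * X ^ n"
    using X z x_nonneg X0 sum_le_suminf[of "\<lambda>k. x k * z ^ k" "{..j}"]
    by (intro mult_right_mono) (auto simp: sums_iff)
  finally show ?case by simp
qed

text \<open>Abel summation. Both sides are the generating function of a batch cut off at
  \<open>y\<close>; the right-hand form involves only tails, which is what the assumptions
  control.\<close>

lemma truncated_gf:
  "(\<Sum>k\<le>y. x k * z ^ k) + xb y * z ^ y = 1 + (z - 1) * (\<Sum>k<y. z ^ k * xb k)"
proof (induction y)
  case 0
  then show ?case by (simp add: xb_eq)
next
  case (Suc y)
  have "(\<Sum>k\<le>Suc y. x k * z ^ k) + xb (Suc y) * z ^ Suc y = 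
      ((\<Sum>k\<le>y. x k * z ^ k) + xb y * z ^ y) + (x (Suc y) + xb (Suc y)) * z ^ Suc y - xb y * z ^ y"
    by (simp add: algebra_simps)
  also have "\<dots> = 1 + (z - 1) * (\<Sum>k<Suc y. z ^ k * xb k)"
    unfolding Suc xb_Suc[of y, symmetric] by (simp add: algebra_simps)
  finally show ?case .
qed

text \<open>Either one of the n batches exceeds \<open>y\<close>, or the total equals that of the
  batches cut off at \<open>y\<close>, whose generating function is \<phi>; Markov's inequality with
  z \<ge> 1 then gives the second term.\<close>

lemma sum_tail_truncation:
  fixes y :: nat and z :: real
  assumes z: "z \<ge> 1"
  defines "\<phi> \<equiv> 1 + (z - 1) * (\<Sum>k<y. z ^ k * xb k)"
  shows "sum_tail n j * z ^ j \<le> real n * xb y * z ^ j + \<phi> ^ n"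
proof (induction n arbitrary: j)
  case (Suc n)
  have z0: "z > 0" using z by simp
  have \<phi>1: "\<phi> \<ge> 1" unfolding \<phi>_def using z xb_nonneg by (auto intro!: mult_nonneg_nonneg sum_nonneg)
  have \<phi>x: "(\<Sum>k\<le>y. x k * z ^ k) \<le> \<phi>"
    unfolding \<phi>_def truncated_gf[symmetric] using xb_nonneg z by auto
  have \<phi>n: "\<phi> ^ n \<ge> 1" using \<phi>1 by (rule one_le_power)
  define S where "S = xb y * z ^ j"
  have S: "S \<ge> 0" using xb_nonneg z0 by (simp add: S_def)
  have summand_le: "x k * sum_tail n (j - k) * z ^ j \<le> x k * (real n * S) + x k * z ^ k * \<phi> ^ n" if "k \<le> j" for k
  proof -
    have zj: "z ^ j = z ^ k * z ^ (j - k)" using that by (simp flip: power_add)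
    have "x k * sum_tail n (j - k) * z ^ j = x k * z ^ k * (sum_tail n (j - k) * z ^ (j - k))"
      by (simp add: zj)
    also have "\<dots> \<le> x k * z ^ k * (real n * xb y * z ^ (j - k) + \<phi> ^ n)"
      using x_nonneg z0 by (intro mult_left_mono Suc) auto
    also have "\<dots> = x k * (real n * S) + x k * z ^ k * \<phi> ^ n"
      by (simp add: S_def zj algebra_simps)
    finally show ?thesis .
  qed
  have x1: "(\<Sum>k\<in>A. x k) \<le> 1" if "finite A" for A
    using sum_le_suminf[of x A] that x_nonneg x_sums by (auto simp: sums_iff)
  \<comment> \<open>A first batch beyond \<open>y\<close> is charged to \<open>xb y\<close>. If j <
    y, a first batch in (j, y] already exceeds j and is charged to \<phi>, as z ^ j \<le> z ^
    k.\<close>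
  have main: "sum_tail (Suc n) j * z ^ j \<le> real n * S + (\<Sum>k\<le>y. x k * z ^ k) * \<phi> ^ n + S"
  proof (cases "y \<le> j")
    case True
    have split: "(\<Sum>k\<le>j. h k) = (\<Sum>k\<le>y. h k) + (\<Sum>k\<in>{y<..j}. h k)" for h :: "nat \<Rightarrow> real"
      using True by (subst sum.union_disjoint[symmetric]) (auto intro!: sum.cong)
    have "sum_tail (Suc n) j * z ^ j = xb j * z ^ j + (\<Sum>k\<le>y. x k * sum_tail n (j - k) * z ^ j)
        + (\<Sum>k\<in>{y<..j}. x k * sum_tail n (j - k) * z ^ j)"
      by (simp add: conv_def split distrib_right sum_distrib_right)
    also have "(\<Sum>k\<in>{y<..j}. x k * sum_tail n (j - k) * z ^ j) \<le> (\<Sum>k\<in>{y<..j}. x k * 1 * z ^ j)"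
      using x_nonneg z0 sum_tail_le_1 by (intro sum_mono mult_right_mono mult_left_mono) auto
    also have "\<dots> = (\<Sum>k\<in>{y<..j}. x k) * z ^ j" by (simp add: sum_distrib_right)
    also have "(\<Sum>k\<le>y. x k * sum_tail n (j - k) * z ^ j) \<le> (\<Sum>k\<le>y. x k * (real n * S) + x k * z ^ k * \<phi> ^ n)"
      using True by (intro sum_mono summand_le) auto
    also have "\<dots> = (\<Sum>k\<le>y. x k) * (real n * S) + (\<Sum>k\<le>y. x k * z ^ k) * \<phi> ^ n"
      by (simp add: sum.distrib sum_distrib_right)
    also have "(\<Sum>k\<le>y. x k) * (real n * S) \<le> 1 * (real n * S)"
      using S by (intro mult_right_mono x1) auto
    also have "xb j * z ^ j + (1 * (real n * S) + (\<Sum>k\<le>y. x k * z ^ k) * \<phi> ^ n) + (\<Sum>k\<in>{y<..j}. x k) * z ^ j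
        = real n * S + (\<Sum>k\<le>y. x k * z ^ k) * \<phi> ^ n + (xb j + (\<Sum>k\<in>{y<..j}. x k)) * z ^ j"
      by (simp add: algebra_simps)
    also have "xb j + (\<Sum>k\<in>{y<..j}. x k) = xb y" by (simp add: xb_eq split)
    finally show ?thesis by (simp add: S_def)
  next
    case False
    have split: "(\<Sum>k\<le>y. h k) = (\<Sum>k\<le>j. h k) + (\<Sum>k\<in>{j<..y}. h k)" for h :: "nat \<Rightarrow> real"
      using False by (subst sum.union_disjoint[symmetric]) (auto intro!: sum.cong)
    have "sum_tail (Suc n) j * z ^ j = xb y * z ^ j + (\<Sum>k\<in>{j<..y}. x k * z ^ j) + (\<Sum>k\<le>j. x k * sum_tail n (j - k) * z ^ j)"
      by (simp add: conv_def split sum_distrib_left xb_eq[of j] xb_eq[of y] algebra_simps)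
    also have "(\<Sum>k\<in>{j<..y}. x k * z ^ j) \<le> (\<Sum>k\<in>{j<..y}. x k * z ^ k * \<phi> ^ n)"
    proof (rule sum_mono)
      fix k assume "k \<in> {j<..y}"
      then have "z ^ j * 1 \<le> z ^ k * \<phi> ^ n" using z \<phi>n by (intro mult_mono power_increasing) auto
      then show "x k * z ^ j \<le> x k * z ^ k * \<phi> ^ n"
        using x_nonneg[of k] by (simp add: mult.assoc mult_left_mono)
    qed
    also have "(\<Sum>k\<le>j. x k * sum_tail n (j - k) * z ^ j) \<le> (\<Sum>k\<le>j. x k * (real n * S) + x k * z ^ k * \<phi> ^ n)"
      by (intro sum_mono summand_le) auto
    also have "\<dots> = (\<Sum>k\<le>j. x k) * (real n * S) + (\<Sum>k\<le>j. x k * z ^ k) * \<phi> ^ n"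
      by (simp add: sum.distrib sum_distrib_right)
    also have "(\<Sum>k\<le>j. x k) * (real n * S) \<le> 1 * (real n * S)"
      using S by (intro mult_right_mono x1) auto
    finally show ?thesis
      unfolding split[of "\<lambda>k. x k * z ^ k"] S_def[symmetric] by (simp add: sum_distrib_left algebra_simps)
  qed
  also have "(\<Sum>k\<le>y. x k * z ^ k) * \<phi> ^ n \<le> \<phi> * \<phi> ^ n"
    using \<phi>x \<phi>n by (intro mult_right_mono) auto
  finally show ?case by (simp add: S_def algebra_simps)
qed simp

section \<open>A Poisson number of batches\<close>

definition compound_tail :: "real \<Rightarrow> nat \<Rightarrow> real" where
  "compound_tail m j = (\<Sum>n. poisson_weight m n * sum_tail n j)"

lemma compound_tail_sums:
  assumes "m \<ge> 0"
  shows "(\<lambda>n. poisson_weight m n * sum_tail n j) sums compound_tail m j"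
  unfolding compound_tail_def
proof (rule summable_sums, rule summable_comparison_test')
  show "summable (poisson_weight m)" using poisson_weight_sums by (simp add: sums_iff)
  show "norm (poisson_weight m n * sum_tail n j) \<le> poisson_weight m n" for n
    using sum_tail_nonneg[of n j] sum_tail_le_1[of n j] poisson_weight_nonneg[OF assms, of n]
    by (simp add: abs_mult mult_left_le)
qed

lemma compound_tail_nonneg: "m \<ge> 0 \<Longrightarrow> compound_tail m j \<ge> 0"
  by (rule sums_nonneg[OF _ compound_tail_sums]) (auto intro!: mult_nonneg_nonneg sum_tail_nonneg poisson_weight_nonneg)

lemma compound_tail_le_1: "m \<ge> 0 \<Longrightarrow> compound_tail m j \<le> 1"
  by (rule sums_le[OF _ compound_tail_sums poisson_weight_sums[of m]])
    (auto intro!: mult_left_le sum_tail_le_1 poisson_weight_nonneg)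

lemma compound_tail_total:
  assumes "m \<ge> 0"
  shows "compound_tail m sums (m * chi)"
proof -
  have "(\<lambda>j. \<Sum>n. poisson_weight m n * sum_tail n j) sums (m * chi)"
  proof (rule sums_swap_nonneg)
    show "(\<lambda>j. poisson_weight m n * sum_tail n j) sums (poisson_weight m n * (real n * chi))" for n
      by (intro sums_mult sum_tail_sums)
    show "(\<lambda>n. poisson_weight m n * (real n * chi)) sums (m * chi)"
      using sums_mult2[OF poisson_weight_mean[of m], of chi] by (simp add: mult.assoc)
  qed (use assms in \<open>auto intro!: mult_nonneg_nonneg poisson_weight_nonneg sum_tail_nonneg\<close>)
  then show ?thesis by (simp add: compound_tail_def[abs_def])
qed

lemma compound_tail_gf:
  assumes m: "m \<ge> 0" and z: "0 \<le> z" "z < 1" and X: "(\<lambda>k. x k * z ^ k) sums X"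
  shows "(\<lambda>j. compound_tail m j * z ^ j) sums ((1 - exp (- (m * (1 - X)))) / (1 - z))"
proof -
  have "(\<lambda>j. \<Sum>n. poisson_weight m n * (sum_tail n j * z ^ j)) sums ((1 - exp (m * (X - 1))) / (1 - z))"
  proof (rule sums_swap_nonneg)
    show "(\<lambda>j. poisson_weight m n * (sum_tail n j * z ^ j)) sums (poisson_weight m n * ((1 - X ^ n) / (1 - z)))" for n
      by (intro sums_mult sum_tail_gf z X)
    have "(\<lambda>n. (poisson_weight m n - poisson_weight m n * X ^ n) / (1 - z)) sums ((1 - exp (m * (X - 1))) / (1 - z))"
      by (intro sums_divide sums_diff poisson_weight_sums poisson_weight_gf)
    then show "(\<lambda>n. poisson_weight m n * ((1 - X ^ n) / (1 - z))) sums ((1 - exp (m * (X - 1))) / (1 - z))"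
      by (simp add: right_diff_distrib)
  qed (use assms in \<open>auto intro!: mult_nonneg_nonneg poisson_weight_nonneg sum_tail_nonneg\<close>)
  moreover have "(\<Sum>n. poisson_weight m n * (sum_tail n j * z ^ j)) = compound_tail m j * z ^ j" for j
    using sums_mult2[OF compound_tail_sums[OF m, of j], of "z ^ j"] by (simp add: sums_iff mult.assoc)
  moreover have "m * (X - 1) = - (m * (1 - X))" by (simp add: algebra_simps)
  ultimately show ?thesis by simp
qed

lemma compound_tail_chernoff:
  assumes m: "m \<ge> 0" and z: "0 < z" "z \<le> 1" and X: "(\<lambda>k. x k * z ^ k) sums X"
  shows "(1 - compound_tail m j) * z ^ j \<le> exp (- (m * (1 - X)))"
proof -
  have "(\<lambda>n. (poisson_weight m n - poisson_weight m n * sum_tail n j) * z ^ j) sums ((1 - compound_tail m j) * z ^ j)"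
    by (intro sums_mult2 sums_diff poisson_weight_sums compound_tail_sums m)
  then have "(\<lambda>n. poisson_weight m n * ((1 - sum_tail n j) * z ^ j)) sums ((1 - compound_tail m j) * z ^ j)"
    by (simp add: algebra_simps)
  from this poisson_weight_gf[of m X] have "(1 - compound_tail m j) * z ^ j \<le> exp (m * (X - 1))"
    by (rule sums_le[rotated]) (intro mult_left_mono sum_tail_chernoff[OF z X] poisson_weight_nonneg m)
  then show ?thesis by (simp add: algebra_simps)
qed

text \<open>Under the Poisson weights n averages to m and \<phi> ^ n to exp (m * (\<phi> -
  1)).\<close>

lemma compound_tail_truncation:
  assumes m: "m \<ge> 0" and z: "z \<ge> 1"
  shows "compound_tail m j * z ^ j \<le> m * xb y * z ^ j + exp (m * ((z - 1) * (\<Sum>k<y. z ^ k * xb k)))"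
proof -
  define \<phi> where "\<phi> = 1 + (z - 1) * (\<Sum>k<y. z ^ k * xb k)"
  have 1: "(\<lambda>n. poisson_weight m n * sum_tail n j * z ^ j) sums (compound_tail m j * z ^ j)"
    by (intro sums_mult2 compound_tail_sums m)
  have 2: "(\<lambda>n. poisson_weight m n * real n * (xb y * z ^ j) + poisson_weight m n * \<phi> ^ n) sums
      (m * (xb y * z ^ j) + exp (m * (\<phi> - 1)))"
    by (intro sums_add sums_mult2 poisson_weight_mean poisson_weight_gf)
  have "poisson_weight m n * sum_tail n j * z ^ j \<le> poisson_weight m n * real n * (xb y * z ^ j) + poisson_weight m n * \<phi> ^ n" for n
  proof -
    have "poisson_weight m n * (sum_tail n j * z ^ j) \<le> poisson_weight m n * (real n * xb y * z ^ j + \<phi> ^ n)"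
      using sum_tail_truncation[OF z, of n j y] poisson_weight_nonneg[OF m]
      by (intro mult_left_mono) (auto simp: \<phi>_def)
    then show ?thesis by (simp add: algebra_simps)
  qed
  from sums_le[OF this 1 2] show ?thesis by (simp add: \<phi>_def mult.assoc)
qed

lemma compound_tail_measurable [measurable]: "(\<lambda>b. compound_tail (l * b) j) \<in> borel_measurable borel"
  unfolding compound_tail_def poisson_weight_def by measurable

end

section \<open>Batch tails on the scale of a subexponential weight\<close>

locale regular_batch_sizes = batch_sizes x xb chi + subexponential_weight g
  for x xb chi g +
  fixes c :: real
  assumes xb_limit: "(\<lambda>n. xb n / g n) \<longlonglongrightarrow> c"
begin

text \<open>By long-tailedness neighbouring tails agree to first order, so their difference is of
  smaller order than \<open>g\<close>.\<close>

lemma x_limit: "(\<lambda>n. x n / g n) \<longlonglongrightarrow> 0"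
proof -
  have "(\<lambda>n. (xb n / g n) / (g (Suc n) / g n) - xb (Suc n) / g (Suc n)) \<longlonglongrightarrow> c / 1 - c"
    by (intro tendsto_intros xb_limit long_tailed LIMSEQ_Suc[OF xb_limit]) auto
  moreover have "(xb n / g n) / (g (Suc n) / g n) - xb (Suc n) / g (Suc n) = x (Suc n) / g (Suc n)" for n
    using pos[of n] pos[of "Suc n"] xb_Suc[of n] by (simp add: field_simps)
  ultimately show ?thesis by (subst filterlim_sequentially_Suc[symmetric]) simp
qed

lemma sum_tail_limit: "(\<lambda>j. sum_tail n j / g j) \<longlonglongrightarrow> real n * c"
proof (induction n)
  case (Suc n)
  have "(\<lambda>j. xb j / g j + conv x (sum_tail n) j / g j) \<longlonglongrightarrow> c + (1 * (real n * c) + (real n * chi) * 0)"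
    by (intro tendsto_add xb_limit conv_limit_nonneg x_nonneg sum_tail_nonneg x_sums sum_tail_sums x_limit Suc)
  then show ?case by (simp add: add_divide_distrib algebra_simps)
qed simp

lemma xb_bound: obtains C where "C > 0" "\<And>n. xb n \<le> C * g n"
  using bounded_ratio[OF xb_limit] by (auto simp: abs_of_nonneg[OF xb_nonneg])

text \<open>A crude Kesten bound. Exponential growth in n is harmless because a Poisson variable has
  all exponential moments.\<close>

lemma sum_tail_bound: "\<exists>C D. C > 0 \<and> D > 0 \<and> (\<forall>n j. sum_tail n j \<le> C * D ^ n * g j)"
proof -
  obtain C where C: "C > 0" "\<And>n. xb n \<le> C * g n" using xb_bound by blast
  have "(\<lambda>j. conv x g j / g j) \<longlonglongrightarrow> 1 * 1 + suminf g * 0"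
    using summable_weight by (intro conv_limit_nonneg x_nonneg nonneg x_sums x_limit weight_limit) (simp add: summable_sums)
  then obtain D where D: "D > 0" "\<And>n. \<bar>conv x g n\<bar> \<le> D * g n" using bounded_ratio by blast
  have "sum_tail n j \<le> C * (1 + D) ^ n * g j" for n j
  proof (induction n arbitrary: j)
    case 0
    then show ?case using C nonneg by simp
  next
    case (Suc n)
    have "conv x (sum_tail n) j \<le> (\<Sum>k\<le>j. x k * (C * (1 + D) ^ n * g (j - k)))"
      unfolding conv_def by (intro sum_mono mult_left_mono Suc x_nonneg)
    also have "\<dots> = C * (1 + D) ^ n * conv x g j" by (simp add: conv_def sum_distrib_left mult_ac)
    also have "\<dots> \<le> C * (1 + D) ^ n * (D * g j)" using C D by (intro mult_left_mono abs_le_D1[OF D(2)]) auto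
    finally have 1: "conv x (sum_tail n) j \<le> C * (1 + D) ^ n * (D * g j)" .
    have "xb j \<le> C * g j" by (rule C)
    also have "\<dots> \<le> C * (1 + D) ^ n * g j"
      using C D nonneg[of j] by (intro mult_right_mono) (auto intro: one_le_power)
    finally show ?case using 1 by (simp add: algebra_simps)
  qed
  then show ?thesis using C D by (intro exI[of _ C] exI[of _ "1 + D"]) auto
qed

text \<open>Dominated convergence over the number of batches, for fixed m. The dominating series
  depends exponentially on m, so integration over the service time needs the separate bound
  \<open>compound_tail_dominated\<close>.\<close>

lemma compound_tail_limit:
  assumes m: "m \<ge> 0"
  shows "(\<lambda>j. compound_tail m j / g j) \<longlonglongrightarrow> m * c"
proof -
  obtain C D where CD: "C > 0" "D > 0" "\<And>n j. sum_tail n j \<le> C * D ^ n * g j"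
    using sum_tail_bound by blast
  have "(\<lambda>j. \<Sum>n. poisson_weight m n * (sum_tail n j / g j)) \<longlonglongrightarrow> (\<Sum>n. poisson_weight m n * (real n * c))"
  proof (rule tannerys_theorem[THEN conjunct2, THEN conjunct2])
    show "(\<lambda>j. poisson_weight m n * (sum_tail n j / g j)) \<longlonglongrightarrow> poisson_weight m n * (real n * c)" for n
      by (intro tendsto_intros sum_tail_limit)
    show "summable (\<lambda>n. C * (poisson_weight m n * D ^ n))"
      using poisson_weight_gf by (intro summable_mult) (auto simp: sums_iff)
    have "norm (poisson_weight m n * (sum_tail n j / g j)) \<le> C * (poisson_weight m n * D ^ n)" for n j
    proof -
      have "sum_tail n j / g j \<le> C * D ^ n" using CD(3)[of n j] pos[of j] by (simp add: divide_le_eq)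
      then have "poisson_weight m n * (sum_tail n j / g j) \<le> poisson_weight m n * (C * D ^ n)"
        by (intro mult_left_mono poisson_weight_nonneg m)
      then show ?thesis
        using poisson_weight_nonneg[OF m, of n] sum_tail_nonneg[of n j] nonneg[of j] by (simp add: mult_ac)
    qed
    then show "eventually (\<lambda>(n, j). norm (poisson_weight m n * (sum_tail n j / g j)) \<le> C * (poisson_weight m n * D ^ n))
        (at_top \<times>\<^sub>F sequentially)"
      by (intro always_eventually) auto
  qed simp
  moreover have "(\<Sum>n. poisson_weight m n * (sum_tail n j / g j)) = compound_tail m j / g j" for j
    using sums_divide[OF compound_tail_sums[OF m, of j], of "g j"] by (simp add: sums_iff)
  moreover have "(\<Sum>n. poisson_weight m n * (real n * c)) = m * c"
    using sums_mult2[OF poisson_weight_mean[of m], of c] by (simp add: sums_iff mult.assoc)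
  ultimately show ?thesis by simp
qed

end

section \<open>Arrivals during a service time\<close>

text \<open>\<open>c\<close> and \<open>cB\<close> are the coefficients of the batch tail and the
  service tail on one common scale; either may be 0, which is how the lighter of two tails enters.
  The service tail is taken at every multiple \<kappa> * j because thresholds on both sides of j /
  (lam * chi) are compared.\<close>

locale compound_service =
  slow_variation L +
  regular_batch_sizes x xb chi "\<lambda>n. real (Suc n) powr (- a) * L (real (Suc n))" c +
  prob_space B
  for L :: "real \<Rightarrow> real" and x xb :: "nat \<Rightarrow> real" and chi a c :: real and B :: "real measure" +
  fixes lam cB :: real
  assumes a_gt: "a > 1" and chi_pos: "chi > 0" and lam_pos: "lam > 0"
    and B_sets: "sets B = sets borel"
    and B_pos: "AE b in B. b > 0" and B_integrable: "integrable B (\<lambda>b. b)"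
    and B_tail: "\<And>\<kappa>. \<kappa> > 0 \<Longrightarrow>
      (\<lambda>j. measure B {\<kappa> * real j<..} / (real (Suc j) powr (- a) * L (real (Suc j)))) \<longlonglongrightarrow> cB * \<kappa> powr (- a)"
begin

abbreviation g :: "nat \<Rightarrow> real" where "g n \<equiv> real (Suc n) powr (- a) * L (real (Suc n))"

text \<open>Serves to absorb the remainder of an exponential bound into \<open>g\<close>; L decays
  more slowly than any negative power.\<close>

lemma g_power_lower: "\<exists>C>0. eventually (\<lambda>j. real j powr (- (a + 1)) \<le> C * g j) sequentially"
proof -
  obtain C where C: "C > 0" "eventually (\<lambda>x. L x \<le> C * x powr 1 \<and> x powr (- 1) \<le> C * L x) at_top"
    using power_bounds[of 1] by auto
  have "eventually (\<lambda>j. real j powr (- (a + 1)) \<le> 2 powr (a + 1) * C * g j) sequentially"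
    using eventually_compose_filterlim[OF C(2) filterlim_real_Suc] eventually_ge_at_top[of 1]
  proof eventually_elim
    case (elim j)
    have "2 powr (a + 1) * 2 powr (- (a + 1)) = (1 :: real)"
      unfolding powr_add[symmetric] by simp
    then have "real j powr (- (a + 1)) = 2 powr (a + 1) * (2 * real j) powr (- (a + 1))"
      by (subst powr_mult) (auto simp only: mult.assoc[symmetric] mult_1_left of_nat_0_le_iff)
    also have "\<dots> \<le> 2 powr (a + 1) * real (Suc j) powr (- (a + 1))"
      using elim a_gt by (intro mult_left_mono powr_mono2') auto
    also have "real (Suc j) powr (- (a + 1)) = real (Suc j) powr (- a) * real (Suc j) powr (- 1)"
      unfolding powr_add[symmetric] by simp
    also have "\<dots> \<le> real (Suc j) powr (- a) * (C * L (real (Suc j)))"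
      using elim by (intro mult_left_mono) auto
    finally show ?case by (simp add: mult_ac)
  qed
  then show ?thesis using C by (intro exI[of _ "2 powr (a + 1) * C"]) auto
qed

lemma g_scale_bound:
  assumes \<delta>: "\<delta> > 0"
  shows "\<exists>C>0. \<forall>j. g (nat \<lfloor>\<delta> * real j\<rfloor>) \<le> C * g j"
proof -
  have lim: "(\<lambda>j. real (Suc (nat \<lfloor>\<delta> * real j\<rfloor>)) / real (Suc j)) \<longlonglongrightarrow> \<delta>"
  proof (rule tendsto_sandwich)
    show "eventually (\<lambda>j. \<delta> * real j / real (Suc j) \<le> real (Suc (nat \<lfloor>\<delta> * real j\<rfloor>)) / real (Suc j)) sequentially"
      using \<delta> by (intro always_eventually allI divide_right_mono) linarith+
    have "real (Suc (nat \<lfloor>\<delta> * real j\<rfloor>)) \<le> \<delta> * real j + 1" for j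
    proof -
      have "0 \<le> \<delta> * real j" using \<delta> by simp
      then show ?thesis by linarith
    qed
    then show "eventually (\<lambda>j. real (Suc (nat \<lfloor>\<delta> * real j\<rfloor>)) / real (Suc j) \<le> (\<delta> * real j + 1) / real (Suc j)) sequentially"
      by (intro always_eventually allI divide_right_mono) auto
    show "(\<lambda>j. \<delta> * real j / real (Suc j)) \<longlonglongrightarrow> \<delta>" by real_asymp
    show "(\<lambda>j. (\<delta> * real j + 1) / real (Suc j)) \<longlonglongrightarrow> \<delta>" by real_asymp
  qed
  obtain C where C: "C > 0" "\<And>j. \<bar>g (nat \<lfloor>\<delta> * real j\<rfloor>)\<bar> \<le> C * g j"
    using bounded_ratio[OF powr_ratio_limit[OF filterlim_real_Suc lim \<delta>, of "- a"]] by blast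
  then show ?thesis by (intro exI[of _ C]) (auto intro: abs_le_D1)
qed

text \<open>For \<eta> > 0 this is finiteness of the batch moment of order 1 + \<eta>, written as a
  sum over tails.\<close>

lemma moment_summable:
  assumes "\<eta> < a - 1"
  shows "summable (\<lambda>k. real (Suc k) powr \<eta> * xb k)"
proof -
  obtain C where C: "C > 0" "\<And>n. xb n \<le> C * g n" using xb_bound by blast
  show ?thesis
  proof (rule summable_comparison_test')
    show "summable (\<lambda>k. C * (real (Suc k) powr (\<eta> - a) * L (real (Suc k))))"
      using assms by (intro summable_mult powr_weight_summable) auto
    show "norm (real (Suc k) powr \<eta> * xb k) \<le> C * (real (Suc k) powr (\<eta> - a) * L (real (Suc k)))" for k
    proof -
      have "real (Suc k) powr \<eta> * xb k \<le> real (Suc k) powr \<eta> * (C * g k)"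
        by (intro mult_left_mono C) auto
      also have "\<dots> = C * ((real (Suc k) powr \<eta> * real (Suc k) powr (- a)) * L (real (Suc k)))" by simp
      also have "real (Suc k) powr \<eta> * real (Suc k) powr (- a) = real (Suc k) powr (\<eta> - a)"
        unfolding powr_add[symmetric] by simp
      finally show ?thesis using xb_nonneg[of k] by (simp add: abs_mult)
    qed
  qed
qed

text \<open>Multiplied by m * (z - 1), with z the tilt, this sum is the exponent in
  \<open>compound_tail_truncation\<close>. With t = \<theta> * k, the excess exp t - 1 is at most t
  * exp t. The cutoff gives exp t \<le> j powr (\<eta> / 2), and k is at most (k + 1) powr \<eta>
  times j powr (1 - \<eta>), so a moment of order 1 + \<eta> absorbs it. As \<theta> carries a
  factor ln j / j, the error has the stated order.\<close>

lemma tilted_tail_sum_bound: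
  assumes \<kappa>: "\<kappa> > 0" and \<eta>: "0 < \<eta>" "\<eta> \<le> 1" "\<eta> < a - 1"
  shows "\<exists>K\<ge>0. \<forall>j\<ge>1. \<forall>y. real y \<le> real j \<longrightarrow> real y * \<kappa> \<le> \<eta> / 2 * real j \<longrightarrow>
    (\<Sum>k<y. exp (\<kappa> * ln (real j) / real j) ^ k * xb k) \<le> chi + K * (ln (real j) * real j powr (- (\<eta> / 2)))"
proof -
  define S where "S = (\<Sum>k. real (Suc k) powr \<eta> * xb k)"
  have sS: "summable (\<lambda>k. real (Suc k) powr \<eta> * xb k)" using \<eta> by (intro moment_summable)
  have S0: "S \<ge> 0" unfolding S_def using sS xb_nonneg by (intro suminf_nonneg) auto
  have "(\<Sum>k<y. exp (\<kappa> * ln (real j) / real j) ^ k * xb k) \<le> chi + (\<kappa> * S) * (ln (real j) * real j powr (- (\<eta> / 2)))"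
    if j: "j \<ge> 1" and y: "real y \<le> real j" "real y * \<kappa> \<le> \<eta> / 2 * real j" for j y
  proof -
    define \<theta> where "\<theta> = \<kappa> * ln (real j) / real j"
    have \<theta>: "\<theta> \<ge> 0" using j \<kappa> by (simp add: \<theta>_def)
    have each: "exp \<theta> ^ k * xb k \<le> xb k + \<theta> * real j powr (\<eta> / 2) * real j powr (1 - \<eta>) * (real (Suc k) powr \<eta> * xb k)"
      if k: "k < y" for k
    proof -
      define t where "t = \<theta> * real k"
      have t0: "t \<ge> 0" using \<theta> by (simp add: t_def)
      have "t * real j = (real k * \<kappa>) * ln (real j)" using j by (simp add: t_def \<theta>_def)
      also have "\<dots> \<le> (real y * \<kappa>) * ln (real j)" using k \<kappa> j by (intro mult_right_mono) auto
      also have "\<dots> \<le> (\<eta> / 2 * real j) * ln (real j)" using y j by (intro mult_right_mono) auto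
      finally have "t * real j \<le> (\<eta> / 2 * ln (real j)) * real j" by (simp add: mult_ac)
      then have "t \<le> \<eta> / 2 * ln (real j)" using j by (subst (asm) mult_le_cancel_right) auto
      then have et: "exp t \<le> real j powr (\<eta> / 2)" using j by (simp add: powr_def)
      have "1 - t \<le> exp (- t)" using exp_ge_add_one_self[of "- t"] by simp
      then have "(1 - t) * exp t \<le> exp (- t) * exp t" by (intro mult_right_mono) auto
      then have "exp t - 1 \<le> t * exp t" by (simp add: algebra_simps flip: exp_add)
      also have "\<dots> \<le> t * real j powr (\<eta> / 2)" using et t0 by (intro mult_left_mono) auto
      finally have e1: "exp t \<le> 1 + t * real j powr (\<eta> / 2)" by simp
      have "real k \<le> real (Suc k) powr 1" by simp
      also have "real (Suc k) powr 1 = real (Suc k) powr \<eta> * real (Suc k) powr (1 - \<eta>)"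
        unfolding powr_add[symmetric] by simp
      also have "\<dots> \<le> real (Suc k) powr \<eta> * real j powr (1 - \<eta>)"
        using k y \<eta> by (intro mult_left_mono powr_mono2) auto
      finally have rk: "real k \<le> real (Suc k) powr \<eta> * real j powr (1 - \<eta>)" .
      have "t * real j powr (\<eta> / 2) \<le> \<theta> * (real (Suc k) powr \<eta> * real j powr (1 - \<eta>)) * real j powr (\<eta> / 2)"
        unfolding t_def using \<theta> rk by (intro mult_right_mono mult_left_mono) auto
      with e1 have "exp t \<le> 1 + \<theta> * real j powr (\<eta> / 2) * real j powr (1 - \<eta>) * real (Suc k) powr \<eta>"
        by (simp add: mult_ac)
      then have "exp t * xb k \<le> (1 + \<theta> * real j powr (\<eta> / 2) * real j powr (1 - \<eta>) * real (Suc k) powr \<eta>) * xb k"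
        by (intro mult_right_mono xb_nonneg)
      moreover have "exp \<theta> ^ k = exp t" by (simp add: t_def mult.commute flip: exp_of_nat_mult)
      ultimately show ?thesis by (simp add: algebra_simps)
    qed
    have "(\<Sum>k<y. exp \<theta> ^ k * xb k) \<le> (\<Sum>k<y. xb k + \<theta> * real j powr (\<eta> / 2) * real j powr (1 - \<eta>) * (real (Suc k) powr \<eta> * xb k))"
      by (intro sum_mono each) auto
    also have "\<dots> = (\<Sum>k<y. xb k) + \<theta> * real j powr (\<eta> / 2) * real j powr (1 - \<eta>) * (\<Sum>k<y. real (Suc k) powr \<eta> * xb k)"
      by (simp add: sum.distrib sum_distrib_left)
    also have "(\<Sum>k<y. xb k) \<le> chi"
      using xb_sums xb_nonneg sum_le_suminf[of xb "{..<y}"] by (simp add: sums_iff)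
    also have "\<theta> * real j powr (\<eta> / 2) * real j powr (1 - \<eta>) * (\<Sum>k<y. real (Suc k) powr \<eta> * xb k)
        \<le> \<theta> * real j powr (\<eta> / 2) * real j powr (1 - \<eta>) * S"
      unfolding S_def using sS xb_nonneg \<theta> by (intro mult_left_mono sum_le_suminf) auto
    also have "\<dots> = \<kappa> * S * (ln (real j) * (real j powr (\<eta> / 2) * real j powr (1 - \<eta>) * real j powr (- 1)))"
      using j by (simp add: \<theta>_def powr_minus field_simps)
    also have "real j powr (\<eta> / 2) * real j powr (1 - \<eta>) * real j powr (- 1) = real j powr (- (\<eta> / 2))"
      unfolding powr_add[symmetric] by simp
    finally show ?thesis by (simp add: \<theta>_def)
  qed
  then show ?thesis using \<kappa> S0 by (intro exI[of _ "\<kappa> * S"]) auto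
qed

text \<open>Batches are truncated at \<open>\<delta> * j\<close> and the sum is tilted by \<open>exp (\<kappa> * ln j / j)\<close>. Taking
  \<open>\<epsilon> / 2 * \<kappa> = a + 1\<close> makes the truncated part \<open>O(j powr - (a + 1))\<close>, and \<open>\<delta> * \<kappa> \<le> \<eta> / 2\<close> keeps the
  tilted mean close to \<open>chi\<close>, since batches have a moment of order \<open>1 + \<eta>\<close>.\<close>
lemma compound_tail_dominated:
  assumes \<epsilon>: "0 < \<epsilon>" "\<epsilon> < 1"
  shows "\<exists>C>0. \<exists>j0. \<forall>j\<ge>j0. \<forall>m\<ge>0. m \<le> (1 - \<epsilon>) * real j / chi \<longrightarrow> compound_tail m j \<le> C * (1 + m) * g j"
proof -
  define \<kappa> where "\<kappa> = 2 * (a + 1) / \<epsilon>"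
  define \<eta> where "\<eta> = min 1 ((a - 1) / 2)"
  define \<delta> where "\<delta> = min 1 (\<eta> / (2 * \<kappa>))"
  have \<kappa>: "\<kappa> > 0" using \<epsilon> a_gt by (simp add: \<kappa>_def)
  have ek: "\<epsilon> / 2 * \<kappa> = a + 1" using \<epsilon> by (simp add: \<kappa>_def)
  have \<eta>: "0 < \<eta>" "\<eta> \<le> 1" "\<eta> < a - 1" using a_gt by (auto simp: \<eta>_def min_def)
  have \<delta>: "\<delta> > 0" "\<delta> \<le> 1" "\<delta> * \<kappa> \<le> \<eta> / 2" using \<kappa> \<eta> by (auto simp: \<delta>_def min_def field_simps)
  obtain K where K: "K \<ge> 0" "\<And>j y. j \<ge> 1 \<Longrightarrow> real y \<le> real j \<Longrightarrow> real y * \<kappa> \<le> \<eta> / 2 * real j \<Longrightarrow>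
    (\<Sum>k<y. exp (\<kappa> * ln (real j) / real j) ^ k * xb k) \<le> chi + K * (ln (real j) * real j powr (- (\<eta> / 2)))"
    using tilted_tail_sum_bound[OF \<kappa> \<eta>] by blast
  obtain C1 where C1: "C1 > 0" "\<And>n. xb n \<le> C1 * g n" using xb_bound by blast
  obtain C2 where C2: "C2 > 0" "\<And>j. g (nat \<lfloor>\<delta> * real j\<rfloor>) \<le> C2 * g j" using g_scale_bound[OF \<delta>(1)] by blast
  obtain C3 where C3: "C3 > 0" "eventually (\<lambda>j. real j powr (- (a + 1)) \<le> C3 * g j) sequentially"
    using g_power_lower by blast
  \<comment> \<open>\<open>h j\<close> bounds the exponent m * (z - 1) * W relative to \<theta> * j.
    It tends to 1 - \<epsilon>, so half of \<epsilon> remains for the decay in j.\<close>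
  define h where "h j = (1 - \<epsilon>) * ((exp (\<kappa> * ln (real j) / real j) - 1) / (\<kappa> * ln (real j) / real j)) *
      (1 + K * (ln (real j) * real j powr (- (\<eta> / 2))) / chi)" for j :: nat
  have "(\<lambda>j. (exp (\<kappa> * ln (real j) / real j) - 1) / (\<kappa> * ln (real j) / real j)) \<longlonglongrightarrow> 1"
    using \<kappa> by real_asymp
  moreover have "(\<lambda>j. ln (real j) * real j powr (- (\<eta> / 2))) \<longlonglongrightarrow> 0"
    using \<eta> by real_asymp
  ultimately have "h \<longlonglongrightarrow> (1 - \<epsilon>) * 1 * (1 + K * 0 / chi)"
    unfolding h_def using chi_pos by (intro tendsto_intros) auto
  then have "eventually (\<lambda>j. h j < 1 - \<epsilon> / 2) sequentially"
    by (rule order_tendstoD) (use \<epsilon> in simp)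
  then have "eventually (\<lambda>j. \<forall>m\<ge>0. m \<le> (1 - \<epsilon>) * real j / chi \<longrightarrow> compound_tail m j \<le> (C1 * C2 + C3) * (1 + m) * g j) sequentially"
    using C3(2) eventually_ge_at_top[of 3]
  proof eventually_elim
    case (elim j)
    show ?case
    proof (intro allI impI)
      fix m assume m: "0 \<le> m" "m \<le> (1 - \<epsilon>) * real j / chi"
      define \<theta> where "\<theta> = \<kappa> * ln (real j) / real j"
      define z where "z = exp \<theta>"
      define y where "y = nat \<lfloor>\<delta> * real j\<rfloor>"
      define W where "W = (\<Sum>k<y. z ^ k * xb k)"
      have j: "real j > 0" "ln (real j) > 0" using elim by auto
      have \<theta>: "\<theta> > 0" using \<kappa> j by (simp add: \<theta>_def)
      have z: "z > 1" using \<theta> by (simp add: z_def)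
      have "0 \<le> \<delta> * real j" using \<delta> by simp
      then have y: "real y \<le> \<delta> * real j" unfolding y_def by linarith
      have yj: "real y \<le> real j" using y mult_right_mono[OF \<delta>(2), of "real j"] by simp
      have "real y * \<kappa> \<le> (\<delta> * real j) * \<kappa>" using y \<kappa> by (intro mult_right_mono) auto
      also have "\<dots> = (\<delta> * \<kappa>) * real j" by simp
      also have "\<dots> \<le> \<eta> / 2 * real j" using \<delta> by (intro mult_right_mono) auto
      finally have yk: "real y * \<kappa> \<le> \<eta> / 2 * real j" .
      have W: "W \<le> chi + K * (ln (real j) * real j powr (- (\<eta> / 2)))"
        unfolding W_def z_def \<theta>_def using elim by (intro K(2) yj yk) auto
      have W0: "W \<ge> 0" unfolding W_def using xb_nonneg z by (intro sum_nonneg) auto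
      have "m * ((z - 1) * W) \<le> ((1 - \<epsilon>) * real j / chi) * ((z - 1) * (chi + K * (ln (real j) * real j powr (- (\<eta> / 2)))))"
        using m z W W0 by (intro mult_mono mult_left_mono) auto
      also have "\<dots> = h j * (\<theta> * real j)"
        unfolding h_def \<theta>_def[symmetric] z_def[symmetric] using \<theta> chi_pos by (simp add: field_simps)
      also have "\<dots> \<le> (1 - \<epsilon> / 2) * (\<theta> * real j)"
        using elim \<theta> by (intro mult_right_mono) auto
      finally have ex: "m * ((z - 1) * W) - \<theta> * real j \<le> - (\<epsilon> / 2 * \<kappa> * ln (real j))"
        using j by (simp add: \<theta>_def algebra_simps)
      have zj: "z ^ j = exp (\<theta> * real j)" by (simp add: z_def mult.commute flip: exp_of_nat_mult)
      have "compound_tail m j * z ^ j \<le> m * xb y * z ^ j + exp (m * ((z - 1) * W))"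
        unfolding W_def using m z by (intro compound_tail_truncation) auto
      then have "compound_tail m j \<le> (m * xb y * z ^ j + exp (m * ((z - 1) * W))) / z ^ j"
        using z by (simp add: pos_le_divide_eq)
      also have "\<dots> = m * xb y + exp (m * ((z - 1) * W) - \<theta> * real j)"
        using z by (simp add: add_divide_distrib exp_diff zj[symmetric])
      also have "exp (m * ((z - 1) * W) - \<theta> * real j) \<le> exp (- (\<epsilon> / 2 * \<kappa> * ln (real j)))" using ex by simp
      also have "\<dots> = real j powr (- (a + 1))" using j unfolding ek powr_def by (simp add: algebra_simps)
      also have "\<dots> \<le> C3 * g j" using elim by simp
      also have "m * xb y \<le> m * (C1 * (C2 * g j))"
        unfolding y_def using m C1(1) by (intro mult_left_mono order_trans[OF C1(2) mult_left_mono[OF C2(2)]]) auto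
      also have "m * (C1 * (C2 * g j)) + C3 * g j \<le> (C1 * C2 + C3) * (1 + m) * g j"
      proof -
        have "0 \<le> C1 * C2 + C3 * m" using C1(1) C2(1) C3(1) m by simp
        then have "0 \<le> (C1 * C2 + C3 * m) * g j" by (rule mult_nonneg_nonneg[OF _ nonneg])
        then show ?thesis by (simp add: algebra_simps)
      qed
      finally show "compound_tail m j \<le> (C1 * C2 + C3) * (1 + m) * g j" by simp
    qed
  qed
  then show ?thesis
    unfolding eventually_sequentially using C1 C2 C3
    by (intro exI[of _ "C1 * C2 + C3"]) (auto intro: add_pos_pos)
qed

text \<open>One fixed z < 1 suffices in \<open>compound_tail_chernoff\<close>: as z -> 1, (1 - X(z))
  / (1 - z) tends to \<open>chi\<close> while - ln z behaves like 1 - z, so near 1 the surplus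
  \<epsilon> makes the base \<open>q\<close> less than 1, uniformly in m.\<close>

lemma compound_tail_lower:
  assumes \<epsilon>: "\<epsilon> > 0"
  shows "\<exists>q. 0 \<le> q \<and> q < 1 \<and> (\<forall>j m. m \<ge> (1 + \<epsilon>) * real j / chi \<longrightarrow> 1 - q ^ j \<le> compound_tail m j)"
proof -
  \<comment> \<open>A finite part of the sum \<open>chi\<close> is enough to use up only part of the
    surplus \<epsilon>. Its generating polynomial is continuous at 1, which replaces Abel's limit
    theorem.\<close>
  have "(\<lambda>n. (1 + \<epsilon>) * (\<Sum>j<n. xb j) / chi) \<longlonglongrightarrow> (1 + \<epsilon>) * chi / chi"
    using xb_sums chi_pos unfolding sums_def by (intro tendsto_intros) auto
  then have "eventually (\<lambda>n. 1 < (1 + \<epsilon>) * (\<Sum>j<n. xb j) / chi) sequentially"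
    by (rule order_tendstoD(1)) (use \<epsilon> chi_pos in simp)
  then obtain N where N: "1 < (1 + \<epsilon>) * (\<Sum>j<N. xb j) / chi"
    by (auto simp: eventually_sequentially)
  have "((\<lambda>z::real. (1 - z) / (- ln z)) \<longlongrightarrow> 1) (at_left 1)" by real_asymp
  then have "((\<lambda>z. (1 + \<epsilon>) * (\<Sum>j<N. xb j * z ^ j) / chi * ((1 - z) / (- ln z))) \<longlongrightarrow>
      (1 + \<epsilon>) * (\<Sum>j<N. xb j * 1 ^ j) / chi * 1) (at_left 1)"
    using chi_pos by (intro tendsto_intros) auto
  then have ev: "eventually (\<lambda>z. 1 < (1 + \<epsilon>) * (\<Sum>j<N. xb j * z ^ j) / chi * ((1 - z) / (- ln z))) (at_left (1::real))"
    by (rule order_tendstoD(1)) (use N in simp)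
  have "eventually (\<lambda>z::real. z \<in> {0<..<1}) (at_left 1)"
    by (rule eventually_at_leftI[of 0]) auto
  from eventually_happens'[OF trivial_limit_at_left_real eventually_conj[OF this ev]] obtain z where z: "0 < z" "z < 1"
    "1 < (1 + \<epsilon>) * (\<Sum>j<N. xb j * z ^ j) / chi * ((1 - z) / (- ln z))"
    by auto
  have sX: "summable (\<lambda>k. x k * z ^ k)"
  proof (rule summable_comparison_test')
    show "summable x" using x_sums by (simp add: sums_iff)
    show "norm (x k * z ^ k) \<le> x k" for k
      using z x_nonneg[of k] by (simp add: abs_mult power_le_one mult_left_le)
  qed
  define X where "X = (\<Sum>k. x k * z ^ k)"
  have X: "(\<lambda>k. x k * z ^ k) sums X" unfolding X_def using sX by (rule summable_sums)
  have gf: "(\<lambda>j. xb j * z ^ j) sums ((1 - X) / (1 - z))" using z X by (intro xb_gf) auto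
  have "(\<Sum>j<N. xb j * z ^ j) \<le> (1 - X) / (1 - z)"
    using sum_le_suminf[of "\<lambda>j. xb j * z ^ j" "{..<N}"] gf xb_nonneg z by (auto simp: sums_iff)
  then have "(\<Sum>j<N. xb j * z ^ j) * (1 - z) \<le> 1 - X" using z by (simp add: pos_le_divide_eq)
  then have "(1 + \<epsilon>) / chi * ((\<Sum>j<N. xb j * z ^ j) * (1 - z)) \<le> (1 + \<epsilon>) / chi * (1 - X)"
    using \<epsilon> chi_pos by (intro mult_left_mono) auto
  moreover have "- ln z < (1 + \<epsilon>) / chi * ((\<Sum>j<N. xb j * z ^ j) * (1 - z))"
  proof -
    define w where "w = - ln z"
    have w: "w > 0" using z by (simp add: w_def)
    have "1 < (1 + \<epsilon>) * (\<Sum>j<N. xb j * z ^ j) / chi * (1 - z) / w"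
      using z(3) by (simp only: w_def times_divide_eq_right)
    then have "w < (1 + \<epsilon>) * (\<Sum>j<N. xb j * z ^ j) / chi * (1 - z)"
      by (simp only: pos_less_divide_eq[OF w] mult_1_left)
    then show ?thesis by (simp add: w_def mult_ac)
  qed
  ultimately have neg: "- ((1 + \<epsilon>) / chi * (1 - X)) - ln z < 0" by linarith
  define q where "q = exp (- ((1 + \<epsilon>) / chi * (1 - X)) - ln z)"
  have X1: "1 - X \<ge> 0"
    using sums_le[OF _ X x_sums] z x_nonneg by (simp add: power_le_one mult_left_le)
  have "1 - q ^ j \<le> compound_tail m j" if m: "m \<ge> (1 + \<epsilon>) * real j / chi" for j m
  proof -
    have m0: "m \<ge> 0" using \<epsilon> chi_pos by (intro order_trans[OF _ m]) auto
    have "(1 - compound_tail m j) * z ^ j \<le> exp (- (m * (1 - X)))"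
      using m0 z X by (intro compound_tail_chernoff) auto
    also have "\<dots> \<le> exp (- ((1 + \<epsilon>) * real j / chi * (1 - X)))"
      using mult_right_mono[OF m X1] by simp
    also have "\<dots> = q ^ j * z ^ j"
    proof -
      have "q * z = exp (- ((1 + \<epsilon>) / chi * (1 - X)))" using z by (simp add: q_def exp_diff)
      then have "q ^ j * z ^ j = exp (- ((1 + \<epsilon>) / chi * (1 - X))) ^ j" by (simp flip: power_mult_distrib)
      also have "\<dots> = exp (real j * - ((1 + \<epsilon>) / chi * (1 - X)))" by (rule exp_of_nat_mult[symmetric])
      finally show ?thesis by (simp add: mult_ac)
    qed
    finally have "1 - compound_tail m j \<le> q ^ j" using z by simp
    then show ?thesis by simp
  qed
  moreover have "q < 1" "0 \<le> q" using neg by (auto simp: q_def)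
  ultimately show ?thesis by blast
qed

section \<open>Averaging over the service time\<close>

definition arrivals_tail :: "nat \<Rightarrow> real" where
  "arrivals_tail j = (\<integral>b. compound_tail (lam * b) j \<partial>B)"

definition mean_service_time :: real where
  "mean_service_time = (\<integral>b. b \<partial>B)"

declare B_sets [measurable_cong]

lemma compound_measurable [measurable]: "(\<lambda>b. compound_tail (lam * b) j) \<in> borel_measurable B"
  by measurable

lemma rate_nonneg: "AE b in B. 0 \<le> lam * b"
  using B_pos lam_pos by (auto elim!: eventually_mono)

lemma arrivals_tail_nonneg: "arrivals_tail j \<ge> 0"
  unfolding arrivals_tail_def
  by (rule integral_nonneg_AE) (use rate_nonneg compound_tail_nonneg in \<open>auto elim!: eventually_mono\<close>)

lemma arrivals_tail_sums: "arrivals_tail sums (lam * mean_service_time * chi)"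
proof -
  have "(\<lambda>j. \<integral>b. compound_tail (lam * b) j \<partial>B) sums (\<integral>b. lam * b * chi \<partial>B)"
  proof (rule sums_integral_nonneg)
    show "AE b in B. 0 \<le> compound_tail (lam * b) j" for j
      using rate_nonneg by eventually_elim (rule compound_tail_nonneg)
    show "AE b in B. (\<lambda>j. compound_tail (lam * b) j) sums (lam * b * chi)"
      using rate_nonneg by eventually_elim (rule compound_tail_total)
  qed (intro compound_measurable integrable_mult_left integrable_mult_right B_integrable)+
  then show ?thesis by (simp add: arrivals_tail_def[abs_def] mean_service_time_def)
qed

lemma arrivals_tail_gf:
  assumes z: "0 \<le> z" "z < 1" and X: "(\<lambda>k. x k * z ^ k) sums X"
  shows "(\<lambda>j. arrivals_tail j * z ^ j) sums ((1 - (\<integral>b. exp (- (lam * b * (1 - X))) \<partial>B)) / (1 - z))"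
proof -
  have X1: "X \<le> 1"
    using sums_le[OF _ X x_sums] z x_nonneg by (simp add: power_le_one mult_left_le)
  have int: "integrable B (\<lambda>b. exp (- (lam * b * (1 - X))))"
    by (rule integrable_const_bound[of _ 1]) (use rate_nonneg X1 in \<open>auto elim!: eventually_mono\<close>)
  have "(\<lambda>j. \<integral>b. compound_tail (lam * b) j * z ^ j \<partial>B) sums (\<integral>b. (1 - exp (- (lam * b * (1 - X)))) / (1 - z) \<partial>B)"
  proof (rule sums_integral_nonneg)
    show "AE b in B. 0 \<le> compound_tail (lam * b) j * z ^ j" for j
      using rate_nonneg by eventually_elim (use z compound_tail_nonneg in auto)
    show "AE b in B. (\<lambda>j. compound_tail (lam * b) j * z ^ j) sums ((1 - exp (- (lam * b * (1 - X)))) / (1 - z))"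
      using rate_nonneg by eventually_elim (intro compound_tail_gf z X)
    show "integrable B (\<lambda>b. (1 - exp (- (lam * b * (1 - X)))) / (1 - z))"
      by (intro integrable_divide Bochner_Integration.integrable_diff int) simp
  qed measurable
  moreover have "(\<integral>b. (1 - exp (- (lam * b * (1 - X)))) / (1 - z) \<partial>B) = (1 - (\<integral>b. exp (- (lam * b * (1 - X))) \<partial>B)) / (1 - z)"
    using int by (simp add: prob_space)
  moreover have "(\<integral>b. compound_tail (lam * b) j * z ^ j \<partial>B) = arrivals_tail j * z ^ j" for j
    by (simp add: arrivals_tail_def)
  ultimately show ?thesis by (simp only:)
qed

text \<open>Such a service is too short for the average arrivals to reach j, so one large batch
  among lam * E(B) expected ones has to do it. \<open>compound_tail_dominated\<close> provides the
  integrable majorant.\<close>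

lemma short_service_limit:
  assumes \<epsilon>: "0 < \<epsilon>" "\<epsilon> < 1"
  shows "(\<lambda>j. (\<integral>b. indicator {..(1 - \<epsilon>) / (lam * chi) * real j} b * compound_tail (lam * b) j \<partial>B) / g j)
    \<longlonglongrightarrow> lam * mean_service_time * c"
proof -
  obtain C j0 where C: "C > 0" "\<And>j m. j \<ge> j0 \<Longrightarrow> m \<ge> 0 \<Longrightarrow> m \<le> (1 - \<epsilon>) * real j / chi \<Longrightarrow>
      compound_tail m j \<le> C * (1 + m) * g j"
    using compound_tail_dominated[OF \<epsilon>] by blast
  define \<kappa> where "\<kappa> = (1 - \<epsilon>) / (lam * chi)"
  have \<kappa>: "\<kappa> > 0" using \<epsilon> lam_pos chi_pos by (simp add: \<kappa>_def)
  define s where "s j b = indicator {..\<kappa> * real j} b * compound_tail (lam * b) j / g j" for j and b :: real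
  have [measurable]: "s j \<in> borel_measurable B" for j unfolding s_def by measurable
  \<comment> \<open>The majorant holds only from \<open>j0\<close> on, hence the shift of the
    sequence.\<close>
  have "(\<lambda>j. integral\<^sup>L B (s (j + j0))) \<longlonglongrightarrow> (\<integral>b. lam * b * c \<partial>B)"
  proof (rule integral_dominated_convergence)
    show "integrable B (\<lambda>b. C * (1 + lam * b))" using B_integrable by simp
    show "AE b in B. (\<lambda>j. s (j + j0) b) \<longlonglongrightarrow> lam * b * c"
      using rate_nonneg
    proof eventually_elim
      case (elim b)
      have "filterlim (\<lambda>j. \<kappa> * real j) at_top sequentially"
        by (rule filterlim_tendsto_pos_mult_at_top[OF tendsto_const \<kappa> filterlim_real_sequentially])
      then have "eventually (\<lambda>j. b \<le> \<kappa> * real j) sequentially" by (simp add: filterlim_at_top)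
      then have "eventually (\<lambda>j. compound_tail (lam * b) j / g j = s j b) sequentially"
        by eventually_elim (simp add: s_def)
      then have "(\<lambda>j. s j b) \<longlonglongrightarrow> lam * b * c"
        by (rule Lim_transform_eventually[OF compound_tail_limit[OF elim]])
      then show ?case by (rule LIMSEQ_ignore_initial_segment)
    qed
    show "AE b in B. norm (s (j + j0) b) \<le> C * (1 + lam * b)" for j
      using rate_nonneg
    proof eventually_elim
      case (elim b)
      show ?case
      proof (cases "b \<le> \<kappa> * real (j + j0)")
        case True
        then have "lam * b \<le> lam * (\<kappa> * real (j + j0))" using lam_pos by (intro mult_left_mono) auto
        also have "\<dots> = (1 - \<epsilon>) * real (j + j0) / chi" using lam_pos by (simp add: \<kappa>_def)
        finally have "compound_tail (lam * b) (j + j0) \<le> C * (1 + lam * b) * g (j + j0)"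
          using elim by (intro C(2)) auto
        then have "compound_tail (lam * b) (j + j0) / g (j + j0) \<le> C * (1 + lam * b)"
          using pos[of "j + j0"] by (simp only: pos_divide_le_eq)
        moreover have "0 \<le> compound_tail (lam * b) (j + j0) / g (j + j0)"
          using compound_tail_nonneg[OF elim] nonneg by (rule divide_nonneg_nonneg)
        ultimately show ?thesis using True by (simp add: s_def)
      next
        case False
        then show ?thesis using C elim by (simp add: s_def)
      qed
    qed
  qed auto
  then have "(\<lambda>j. integral\<^sup>L B (s j)) \<longlonglongrightarrow> (\<integral>b. lam * b * c \<partial>B)" by (rule LIMSEQ_offset)
  then show ?thesis by (simp add: s_def[abs_def] \<kappa>_def mean_service_time_def)
qed

text \<open>Above the upper threshold the compound sum exceeds j up to an exponentially small
  probability. Between the two thresholds only the trivial bounds 0 and 1 are used; regular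
  variation of the service tail closes this gap as \<epsilon> -> 0.\<close>

lemma long_service_bounds:
  assumes \<epsilon>: "0 < \<epsilon>" "\<epsilon> < 1"
  defines "J \<equiv> (\<lambda>j. \<integral>b. indicator {(1 - \<epsilon>) / (lam * chi) * real j<..} b * compound_tail (lam * b) j \<partial>B)"
  shows "J j \<le> measure B {(1 - \<epsilon>) / (lam * chi) * real j<..}"
    and "\<exists>q. 0 \<le> q \<and> q < 1 \<and> (\<forall>j. (1 - q ^ j) * measure B {(1 + \<epsilon>) / (lam * chi) * real j<..} \<le> J j)"
proof -
  define \<kappa> where "\<kappa> = (1 - \<epsilon>) / (lam * chi)"
  define \<kappa>' where "\<kappa>' = (1 + \<epsilon>) / (lam * chi)"
  have le: "\<kappa> \<le> \<kappa>'" using \<epsilon> lam_pos chi_pos by (simp add: \<kappa>_def \<kappa>'_def divide_right_mono)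
  have int: "integrable B (\<lambda>b. indicator {\<kappa> * real j<..} b * compound_tail (lam * b) j)" for j
    by (rule integrable_const_bound[of _ 1])
      (use rate_nonneg compound_tail_le_1 compound_tail_nonneg in \<open>auto elim!: eventually_mono simp: indicator_def\<close>)
  have meas: "measure B {r<..} = (\<integral>b. indicator {r<..} b \<partial>B)" for r
    using B_sets by simp
  have int1: "integrable B (\<lambda>b. indicator {r<..} b :: real)" for r
    using B_sets by (simp add: emeasure_eq_measure)
  show "J j \<le> measure B {(1 - \<epsilon>) / (lam * chi) * real j<..}"
    unfolding J_def \<kappa>_def[symmetric] meas
    by (rule integral_mono_AE[OF int int1])
      (use rate_nonneg compound_tail_le_1 in \<open>auto elim!: eventually_mono simp: indicator_def\<close>)
  obtain q where q: "0 \<le> q" "q < 1" "\<And>j m. m \<ge> (1 + \<epsilon>) * real j / chi \<Longrightarrow> 1 - q ^ j \<le> compound_tail m j"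
    using compound_tail_lower[OF \<epsilon>(1)] by blast
  have "(1 - q ^ j) * measure B {\<kappa>' * real j<..} \<le> J j" for j
  proof -
    have "(1 - q ^ j) * measure B {\<kappa>' * real j<..} = (\<integral>b. (1 - q ^ j) * indicator {\<kappa>' * real j<..} b \<partial>B)"
      by (simp only: meas integral_mult_right_zero)
    also have "\<dots> \<le> J j"
      unfolding J_def \<kappa>_def[symmetric]
    proof (rule integral_mono_AE)
      show "AE b in B. (1 - q ^ j) * indicator {\<kappa>' * real j<..} b \<le> indicator {\<kappa> * real j<..} b * compound_tail (lam * b) j"
        using rate_nonneg
      proof eventually_elim
        case (elim b)
        show ?case
        proof (cases "b > \<kappa>' * real j")
          case True
          have "lam * (\<kappa>' * real j) \<le> lam * b" using True lam_pos by (intro mult_left_mono) auto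
          then have "(1 + \<epsilon>) * real j / chi \<le> lam * b" using lam_pos by (simp add: \<kappa>'_def)
          then have "1 - q ^ j \<le> compound_tail (lam * b) j" by (rule q)
          moreover have "\<kappa> * real j < b" using True mult_right_mono[OF le, of "real j"] by simp
          ultimately show ?thesis using True by simp
        next
          case False
          then show ?thesis using compound_tail_nonneg[OF elim] by simp
        qed
      qed
    qed (intro int int1 integrable_mult_right)+
    finally show ?thesis .
  qed
  then show "\<exists>q. 0 \<le> q \<and> q < 1 \<and> (\<forall>j. (1 - q ^ j) * measure B {(1 + \<epsilon>) / (lam * chi) * real j<..} \<le> J j)"
    unfolding \<kappa>'_def using q(1,2) by (intro exI[of _ q] conjI allI)
qed

lemma arrivals_tail_split:
  "arrivals_tail j = (\<integral>b. indicator {..r} b * compound_tail (lam * b) j \<partial>B) + (\<integral>b. indicator {r<..} b * compound_tail (lam * b) j \<partial>B)"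
proof -
  have int: "integrable B (\<lambda>b. indicator A b * compound_tail (lam * b) j)" if [measurable]: "A \<in> sets borel" for A
    by (rule integrable_const_bound[of _ 1])
      (use rate_nonneg compound_tail_le_1 compound_tail_nonneg in \<open>auto elim!: eventually_mono simp: indicator_def\<close>)
  have "arrivals_tail j = (\<integral>b. indicator {..r} b * compound_tail (lam * b) j + indicator {r<..} b * compound_tail (lam * b) j \<partial>B)"
    unfolding arrivals_tail_def by (intro Bochner_Integration.integral_cong) (auto simp: indicator_def)
  then show ?thesis using int by simp
qed

text \<open>For a given v, \<epsilon> is fixed before j tends to infinity. The short services have
  the same limit for every \<epsilon>, and the two bounds for the long services have limits that are
  continuous in \<epsilon> and agree at 0.\<close>

lemma arrivals_tail_limit:
  "(\<lambda>j. arrivals_tail j / g j) \<longlonglongrightarrow> cB * (lam * chi) powr a + lam * mean_service_time * c"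
proof -
  define K where "K = lam * mean_service_time * c"
  define lo where "lo \<epsilon> = K + cB * ((1 + \<epsilon>) / (lam * chi)) powr (- a)" for \<epsilon>
  define hi where "hi \<epsilon> = K + cB * ((1 - \<epsilon>) / (lam * chi)) powr (- a)" for \<epsilon>
  define l where "l = cB * (lam * chi) powr a + K"
  have lc: "lam * chi > 0" using lam_pos chi_pos by simp
  have at0: "cB * (1 / (lam * chi)) powr (- a) + K = l"
    using lc by (simp add: l_def powr_minus powr_divide)
  have lo_lim: "(lo \<longlongrightarrow> l) (at_right 0)"
  proof -
    have "(lo \<longlongrightarrow> K + cB * ((1 + 0) / (lam * chi)) powr (- a)) (at_right 0)"
      unfolding lo_def using lc by (intro tendsto_intros) auto
    then show ?thesis using at0 by (simp add: add.commute)
  qed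
  have hi_lim: "(hi \<longlongrightarrow> l) (at_right 0)"
  proof -
    have "(hi \<longlongrightarrow> K + cB * ((1 - 0) / (lam * chi)) powr (- a)) (at_right 0)"
      unfolding hi_def using lc by (intro tendsto_intros) auto
    then show ?thesis using at0 by (simp add: add.commute)
  qed
  have e_ev: "eventually (\<lambda>\<epsilon>. \<epsilon> > 0 \<and> \<epsilon> < 1) (at_right (0::real))"
    unfolding eventually_at_right_field by (intro exI[of _ 1]) auto
  have "(\<lambda>j. arrivals_tail j / g j) \<longlonglongrightarrow> l"
  proof (rule order_tendstoI)
    fix v assume "v < l"
    then have "eventually (\<lambda>\<epsilon>. v < lo \<epsilon>) (at_right 0)" using lo_lim by (simp add: order_tendstoD)
    from eventually_happens'[OF trivial_limit_at_right_real eventually_conj[OF e_ev this]]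
    obtain \<epsilon> where \<epsilon>: "0 < \<epsilon>" "\<epsilon> < 1" "v < lo \<epsilon>" by auto
    define I where "I j = (\<integral>b. indicator {..(1 - \<epsilon>) / (lam * chi) * real j} b * compound_tail (lam * b) j \<partial>B)" for j
    obtain q where q: "0 \<le> q" "q < 1" "\<And>j. (1 - q ^ j) * measure B {(1 + \<epsilon>) / (lam * chi) * real j<..}
        \<le> (\<integral>b. indicator {(1 - \<epsilon>) / (lam * chi) * real j<..} b * compound_tail (lam * b) j \<partial>B)"
      using long_service_bounds(2)[OF \<epsilon>(1,2)] by blast
    have \<kappa>: "(1 + \<epsilon>) / (lam * chi) > 0" using \<epsilon> lc by simp
    have "(\<lambda>j. I j / g j + (1 - q ^ j) * (measure B {(1 + \<epsilon>) / (lam * chi) * real j<..} / g j))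
        \<longlonglongrightarrow> K + (1 - 0) * (cB * ((1 + \<epsilon>) / (lam * chi)) powr (- a))"
      unfolding I_def K_def
      by (intro tendsto_intros short_service_limit \<epsilon> B_tail \<kappa> LIMSEQ_power_zero) (use q in auto)
    then have "eventually (\<lambda>j. v < I j / g j + (1 - q ^ j) * (measure B {(1 + \<epsilon>) / (lam * chi) * real j<..} / g j)) sequentially"
      by (rule order_tendstoD) (use \<epsilon> in \<open>simp add: lo_def\<close>)
    then show "eventually (\<lambda>j. v < arrivals_tail j / g j) sequentially"
    proof eventually_elim
      case (elim j)
      have "I j + (1 - q ^ j) * measure B {(1 + \<epsilon>) / (lam * chi) * real j<..} \<le> arrivals_tail j"
        using q(3)[of j] arrivals_tail_split[of j "(1 - \<epsilon>) / (lam * chi) * real j"] by (simp only: I_def)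
      then have "(I j + (1 - q ^ j) * measure B {(1 + \<epsilon>) / (lam * chi) * real j<..}) / g j \<le> arrivals_tail j / g j"
        using nonneg by (rule divide_right_mono)
      with elim show ?case by (simp only: add_divide_distrib times_divide_eq_right)
    qed
  next
    fix v assume "l < v"
    then have "eventually (\<lambda>\<epsilon>. hi \<epsilon> < v) (at_right 0)" using hi_lim by (simp add: order_tendstoD)
    from eventually_happens'[OF trivial_limit_at_right_real eventually_conj[OF e_ev this]]
    obtain \<epsilon> where \<epsilon>: "0 < \<epsilon>" "\<epsilon> < 1" "hi \<epsilon> < v" by auto
    define I where "I j = (\<integral>b. indicator {..(1 - \<epsilon>) / (lam * chi) * real j} b * compound_tail (lam * b) j \<partial>B)" for j
    have \<kappa>: "(1 - \<epsilon>) / (lam * chi) > 0" using \<epsilon> lc by simp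
    have "(\<lambda>j. I j / g j + measure B {(1 - \<epsilon>) / (lam * chi) * real j<..} / g j)
        \<longlonglongrightarrow> K + cB * ((1 - \<epsilon>) / (lam * chi)) powr (- a)"
      unfolding I_def K_def by (intro tendsto_intros short_service_limit \<epsilon> B_tail \<kappa>)
    then have "eventually (\<lambda>j. I j / g j + measure B {(1 - \<epsilon>) / (lam * chi) * real j<..} / g j < v) sequentially"
      by (rule order_tendstoD) (use \<epsilon> in \<open>simp add: hi_def\<close>)
    then show "eventually (\<lambda>j. arrivals_tail j / g j < v) sequentially"
    proof eventually_elim
      case (elim j)
      have "arrivals_tail j \<le> I j + measure B {(1 - \<epsilon>) / (lam * chi) * real j<..}"
        using long_service_bounds(1)[OF \<epsilon>(1,2), of j] arrivals_tail_split[of j "(1 - \<epsilon>) / (lam * chi) * real j"]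
        by (simp only: I_def)
      then have "arrivals_tail j / g j \<le> (I j + measure B {(1 - \<epsilon>) / (lam * chi) * real j<..}) / g j"
        using nonneg by (rule divide_right_mono)
      with elim show ?case by (simp only: add_divide_distrib)
    qed
  qed
  then show ?thesis by (simp only: l_def K_def)
qed

end

section \<open>Generating functions\<close>

text \<open>After division by z ^ m, the first coefficient not yet known to vanish is the limit at 0
  from the right. The open interval suits identities that divide by z or by 1 - z.\<close>

lemma powser_eq_on_unit_interval:
  fixes a b :: "nat \<Rightarrow> real"
  assumes "\<And>z. 0 < z \<Longrightarrow> z < 1 \<Longrightarrow> (\<lambda>n. a n * z ^ n) sums f z"
    and "\<And>z. 0 < z \<Longrightarrow> z < 1 \<Longrightarrow> (\<lambda>n. b n * z ^ n) sums f z"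
  shows "a n = b n"
proof -
  define c where "c n = a n - b n" for n
  have c: "(\<lambda>n. c n * z ^ n) sums 0" if "0 < z" "z < 1" for z
    using sums_diff[OF assms(1)[OF that] assms(2)[OF that]] by (simp add: c_def left_diff_distrib)
  have "c n = 0"
  proof (induction n rule: less_induct)
    case (less m)
    have d: "(\<lambda>n. c (n + m) * z ^ n) sums 0" if z: "0 < z" "z < 1" for z
    proof -
      have "(\<lambda>n. c (n + m) * z ^ (n + m)) sums (0 - (\<Sum>n<m. c n * z ^ n))"
        using c[OF z] by (rule sums_split_initial_segment)
      also have "(\<Sum>n<m. c n * z ^ n) = 0" using less by (intro sum.neutral) auto
      finally have "(\<lambda>n. c (n + m) * z ^ (n + m) / z ^ m) sums ((0 - 0) / z ^ m)" by (rule sums_divide)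
      then show ?thesis using z by (simp add: power_add)
    qed
    define F where "F z = (\<Sum>n. c (n + m) * z ^ n)" for z :: real
    have "isCont F 0"
      unfolding F_def using d[of "1/2"] by (intro isCont_powser[where K = "1/2"]) (auto simp: sums_iff)
    then have "(F \<longlongrightarrow> F 0) (at_right 0)"
      unfolding isCont_def by (rule tendsto_mono[rotated]) (simp add: at_le)
    moreover have "(F \<longlongrightarrow> 0) (at_right 0)"
    proof (rule tendsto_eventually)
      show "eventually (\<lambda>z. F z = 0) (at_right 0)"
        unfolding eventually_at_right_field F_def using d by (intro exI[of _ 1]) (auto simp: sums_iff)
    qed
    ultimately have "F 0 = 0" using tendsto_unique trivial_limit_at_right_real by blast
    then show ?case by (simp add: F_def)
  qed
  then show ?thesis by (simp add: c_def)
qed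

section \<open>Tails of laws on the natural numbers\<close>

lemma tail_eq_suminf:
  fixes d :: "nat \<Rightarrow> real"
  assumes "d sums s"
  shows "s - (\<Sum>k\<le>n. d k) = (\<Sum>k. d (k + Suc n))"
  using sums_split_initial_segment[OF assms, of "Suc n"] by (simp add: sums_iff lessThan_Suc_atMost)

text \<open>For independent summands with laws \<open>p\<close> and \<open>d\<close> this is the
  event that the total exceeds n but the first summand alone does not, split by the value k \<le> n
  of the first.\<close>

lemma conv_tail:
  fixes p d :: "nat \<Rightarrow> real"
  defines "db \<equiv> (\<lambda>n. 1 - (\<Sum>k\<le>n. d k))"
  shows "(1 - (\<Sum>k\<le>n. conv p d k)) - (1 - (\<Sum>k\<le>n. p k)) = conv p db n"
proof (induction n)
  case 0
  then show ?case by (simp add: conv_def db_def algebra_simps)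
next
  case (Suc n)
  have "conv p db (Suc n) = (\<Sum>k\<le>n. p k * db (Suc n - k)) + p (Suc n) * (1 - d 0)"
    by (simp add: conv_def db_def)
  also have "(\<Sum>k\<le>n. p k * db (Suc n - k)) = (\<Sum>k\<le>n. p k * db (n - k) - p k * d (Suc n - k))"
    by (intro sum.cong) (auto simp: db_def Suc_diff_le algebra_simps)
  also have "\<dots> = conv p db n - (\<Sum>k\<le>n. p k * d (Suc n - k))"
    by (simp add: conv_def sum_subtractf)
  also have "(\<Sum>k\<le>n. p k * d (Suc n - k)) = conv p d (Suc n) - p (Suc n) * d 0"
    by (simp add: conv_def)
  finally show ?case using Suc by (simp add: algebra_simps)
qed

lemma tail_sums_mean:
  fixes d :: "nat \<Rightarrow> real"
  assumes d: "\<And>n. d n \<ge> 0" "d sums 1" and m: "(\<lambda>n. real (Suc n) * d (Suc n)) sums m"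
  shows "(\<lambda>n. 1 - (\<Sum>k\<le>n. d k)) sums m"
proof -
  have "(\<lambda>j. \<Sum>n. if j \<le> n then d (Suc n) else 0) sums m"
  proof (rule sums_swap_nonneg)
    show "(\<lambda>j. if j \<le> n then d (Suc n) else 0) sums (real (Suc n) * d (Suc n))" for n
    proof -
      have "(\<lambda>j. if j \<in> {..n} then d (Suc n) else 0) sums (\<Sum>j\<in>{..n}. d (Suc n))"
        by (rule sums_If_finite_set) simp
      then show ?thesis by simp
    qed
  qed (use d m in auto)
  moreover have "(\<Sum>n. if j \<le> n then d (Suc n) else 0) = 1 - (\<Sum>k\<le>j. d k)" for j
  proof -
    have s: "summable (\<lambda>n. if j \<le> n then d (Suc n) else 0)"
    proof (rule summable_comparison_test')
      show "summable (\<lambda>n. d (Suc n))" using d by (simp add: summable_Suc_iff sums_iff)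
      show "norm (if j \<le> n then d (Suc n) else 0) \<le> d (Suc n)" for n using d by auto
    qed
    have "(\<Sum>n. if j \<le> n then d (Suc n) else 0) = (\<Sum>n. d (n + Suc j)) + (\<Sum>n<j. if j \<le> n then d (Suc n) else 0)"
      using suminf_split_initial_segment[OF s, of j] by simp
    also have "(\<Sum>n<j. if j \<le> n then d (Suc n) else 0) = 0" by (intro sum.neutral) auto
    finally show ?thesis using tail_eq_suminf[OF d(2), of j] by simp
  qed
  ultimately show ?thesis by simp
qed

text \<open>Since the law \<open>p\<close> is given, \<open>e\<close> is read off from it, so its
  nonnegativity and its total mass come from \<open>p\<close>, and the renewal equation follows by
  comparing coefficients. The algebra rests on A(z) - z = (1 - z) * (1 - R(z)), which removes the
  singularity at 1.\<close>

lemma standard_queue_renewal: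
  fixes r p :: "nat \<Rightarrow> real"
  assumes r: "\<And>n. r n \<ge> 0" "r sums \<rho>" and \<rho>: "\<rho> < 1"
    and p: "\<And>n. p n \<ge> 0" "p sums 1"
    and r_gf: "\<And>z. 0 \<le> z \<Longrightarrow> z < 1 \<Longrightarrow> (\<lambda>n. r n * z ^ n) sums ((1 - A z) / (1 - z))"
    and p_gf: "\<And>z. 0 \<le> z \<Longrightarrow> z < 1 \<Longrightarrow>
      (\<lambda>n. p n * z ^ n) sums (A z * ((1 - \<rho>) * (1 - z) / (A z - z)))"
  defines "e \<equiv> (\<lambda>n. (if n = 0 then 1 else 0) + p (Suc n) / (1 - \<rho>))"
  shows "\<And>z. 0 \<le> z \<Longrightarrow> z < 1 \<Longrightarrow> (1 - A z) / (1 - z) < 1"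
    and "\<And>n. e n = (if n = 0 then 1 else 0) + conv r e n"
    and "e sums (1 / (1 - \<rho>))"
    and "\<And>z. 0 < z \<Longrightarrow> z < 1 \<Longrightarrow> (\<lambda>n. e n * z ^ n) sums (1 / (1 - (1 - A z) / (1 - z)))"
proof -
  define R where "R z = (1 - A z) / (1 - z)" for z
  have R1: "R z < 1" if z: "0 \<le> z" "z < 1" for z
  proof -
    have "R z \<le> \<rho>" unfolding R_def
      by (rule sums_le[OF _ r_gf[OF z] r(2)]) (use r z in \<open>auto intro!: mult_left_le power_le_one\<close>)
    then show ?thesis using \<rho> by simp
  qed
  then show "\<And>z. 0 \<le> z \<Longrightarrow> z < 1 \<Longrightarrow> (1 - A z) / (1 - z) < 1" by (simp add: R_def)
  have A: "A z = 1 - (1 - z) * R z" if "z < 1" for z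
    using that by (simp add: R_def)
  have p0: "p 0 = 1 - \<rho>"
  proof -
    have "(\<lambda>n. p n * 0 ^ n) sums (A 0 * ((1 - \<rho>) * (1 - 0) / (A 0 - 0)))" by (rule p_gf) auto
    moreover have "(\<lambda>n. p n * 0 ^ n) sums p 0" by (rule powser_sums_zero)
    moreover have "A 0 \<noteq> 0" using A[of 0] R1[of 0] by simp
    ultimately show ?thesis by (simp add: sums_iff)
  qed
  show gf: "(\<lambda>n. e n * z ^ n) sums (1 / (1 - (1 - A z) / (1 - z)))" if z: "0 < z" "z < 1" for z
  proof -
    have Az: "A z - z = (1 - z) * (1 - R z)" unfolding A[OF z(2)] by (simp add: algebra_simps)
    have nz: "1 - R z \<noteq> 0" "1 - z \<noteq> 0" "1 - \<rho> \<noteq> 0" using R1[of z] z \<rho> by auto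
    have "(\<lambda>n. p n * z ^ n) sums (A z * ((1 - \<rho>) * (1 - z) / (A z - z)))" using z by (intro p_gf) auto
    also have "A z * ((1 - \<rho>) * (1 - z) / (A z - z)) = (1 - \<rho>) * (A z / (1 - R z))"
      unfolding Az using nz by simp
    finally have "(\<lambda>n. p (Suc n) * z ^ Suc n) sums ((1 - \<rho>) * (A z / (1 - R z)) - p 0)"
      by (subst sums_Suc_iff) simp
    then have "(\<lambda>n. p (Suc n) * z ^ Suc n / (z * (1 - \<rho>))) sums (((1 - \<rho>) * (A z / (1 - R z)) - (1 - \<rho>)) / (z * (1 - \<rho>)))"
      unfolding p0 by (rule sums_divide)
    moreover have "p (Suc n) * z ^ Suc n / (z * (1 - \<rho>)) = p (Suc n) / (1 - \<rho>) * z ^ n" for n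
      using z by simp
    moreover have "((1 - \<rho>) * (A z / (1 - R z)) - (1 - \<rho>)) / (z * (1 - \<rho>)) = (A z / (1 - R z) - 1) / z"
    proof -
      have "(1 - \<rho>) * (A z / (1 - R z)) - (1 - \<rho>) = (1 - \<rho>) * (A z / (1 - R z) - 1)"
        by (simp add: right_diff_distrib)
      then show ?thesis using nz by simp
    qed
    moreover have "A z / (1 - R z) - 1 = z * R z / (1 - R z)"
      using nz unfolding A[OF z(2)] by (simp add: divide_simps) (simp add: algebra_simps)
    ultimately have "(\<lambda>n. p (Suc n) / (1 - \<rho>) * z ^ n) sums (R z / (1 - R z))"
      using z by simp
    moreover have "(\<lambda>n. (if n = 0 then 1 else 0) * z ^ n) sums (1 * z ^ 0)"
      using sums_single[of 0 "\<lambda>n. z ^ n"] by (simp add: if_distrib[of "\<lambda>x. x * _"] cong: if_cong)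
    ultimately have "(\<lambda>n. (if n = 0 then 1 else 0) * z ^ n + p (Suc n) / (1 - \<rho>) * z ^ n) sums (1 * z ^ 0 + R z / (1 - R z))"
      by (intro sums_add)
    moreover have "1 * z ^ 0 + R z / (1 - R z) = 1 / (1 - R z)"
      using nz by (simp add: field_simps)
    ultimately show ?thesis by (simp only: e_def distrib_right R_def)
  qed
  have e0: "e n \<ge> 0" for n using p \<rho> by (simp add: e_def)
  show "e n = (if n = 0 then 1 else 0) + conv r e n" for n
  proof (rule powser_eq_on_unit_interval[where f = "\<lambda>z. 1 / (1 - R z)"])
    fix z :: real assume z: "0 < z" "z < 1"
    show "(\<lambda>n. e n * z ^ n) sums (1 / (1 - R z))" unfolding R_def by (rule gf[OF z])
    have "(\<lambda>n. (if n = 0 then 1 else 0) * z ^ n) sums (1 * z ^ 0)"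
      using sums_single[of 0 "\<lambda>n. z ^ n"] by (simp add: if_distrib[of "\<lambda>x. x * _"] cong: if_cong)
    moreover have "(\<lambda>n. conv r e n * z ^ n) sums (R z * (1 / (1 - R z)))"
      unfolding R_def using z r_gf gf[OF z] e0 r by (intro conv_sums) auto
    ultimately have "(\<lambda>n. (if n = 0 then 1 else 0) * z ^ n + conv r e n * z ^ n) sums (1 * z ^ 0 + R z * (1 / (1 - R z)))"
      by (rule sums_add)
    moreover have "1 * z ^ 0 + R z * (1 / (1 - R z)) = 1 / (1 - R z)"
      using R1[of z] z by (simp add: field_simps)
    ultimately show "(\<lambda>n. ((if n = 0 then 1 else 0) + conv r e n) * z ^ n) sums (1 / (1 - R z))"
      by (simp only: distrib_right)
  qed
  have "(\<lambda>n. p (Suc n)) sums (1 - (1 - \<rho>))"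
    using p(2) by (subst sums_Suc_iff) (simp add: p0)
  then have "(\<lambda>n. p (Suc n) / (1 - \<rho>)) sums (\<rho> / (1 - \<rho>))"
    using sums_divide[of _ _ "1 - \<rho>"] by simp
  moreover have "(\<lambda>n. if n = 0 then 1 else 0) sums (1 :: real)"
    using sums_single[of 0 "\<lambda>_. 1 :: real"] by simp
  ultimately have "e sums (1 + \<rho> / (1 - \<rho>))"
    unfolding e_def by (intro sums_add)
  moreover have "1 + \<rho> / (1 - \<rho>) = 1 / (1 - \<rho>)" using \<rho> by (simp add: field_simps)
  ultimately show "e sums (1 / (1 - \<rho>))" by simp
qed

text \<open>Differentiating the exponential gives D' = q * I * D on (0, 1), and a comparison of
  power series coefficients turns this into the recursion.\<close>

lemma exp_integral_coefficients:
  fixes h d :: "nat \<Rightarrow> real" and I D :: "real \<Rightarrow> real"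
  assumes h: "\<And>n. h n \<ge> 0" "summable h" and d: "\<And>n. d n \<ge> 0"
    and d_gf: "\<And>z. 0 \<le> z \<Longrightarrow> z < 1 \<Longrightarrow> (\<lambda>n. d n * z ^ n) sums D z"
    and D: "\<And>z. 0 \<le> z \<Longrightarrow> z < 1 \<Longrightarrow> D z = exp (- q * integral {z..1} I)"
    and I: "\<And>u. 0 < u \<Longrightarrow> u < 1 \<Longrightarrow> (\<lambda>n. h n * u ^ n) sums I u" and q: "q > 0"
  shows "real (Suc n) * d (Suc n) = q * conv h d n"
proof -
  define H where "H u = (\<Sum>n. h n * u ^ n)" for u
  have "uniform_limit {0..1} (\<lambda>n u. \<Sum>i<n. h i * u ^ i) H sequentially"
    unfolding H_def
    by (rule Weierstrass_m_test[OF _ h(2)]) (use h in \<open>auto simp: abs_mult power_le_one intro!: mult_left_le\<close>)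
  then have contH: "continuous_on {0..1} H"
    by (rule uniform_limit_theorem[rotated]) (auto intro!: always_eventually continuous_intros)
  have HI: "H u = I u" if "0 < u" "u < 1" for u using I[OF that] by (simp add: H_def sums_iff)
  \<comment> \<open>The series represents \<open>I\<close> only inside (0, 1), but the end points
    form a null set; \<open>H\<close> is continuous up to 1 because \<open>h\<close> is
    summable.\<close>
  have int_eq: "integral {z..1} I = integral {z..1} H" if "0 \<le> z" for z
    by (rule integral_spike[of "{0, 1}"]) (use that HI in auto)
  have "(\<lambda>n. diffs d n * z ^ n) sums (q * (H z * D z))" if z: "0 < z" "z < 1" for z
  proof -
    have sd: "summable (\<lambda>n. d n * x ^ n)" if "norm x < 1" for x
    proof (rule summable_norm_cancel)
      show "summable (\<lambda>n. norm (d n * x ^ n))"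
        using d_gf[of "\<bar>x\<bar>"] that d by (auto simp: sums_iff abs_mult power_abs)
    qed
    have "((\<lambda>x. integral {0..x} H) has_real_derivative H z) (at z within {0..1})"
      using contH z by (intro integral_has_real_derivative) auto
    then have 1: "((\<lambda>x. integral {0..x} H) has_real_derivative H z) (at z)"
      by (simp only: at_within_Icc_at[OF z])
    have d1: "((\<lambda>x. exp (- q * (integral {0..1} H - integral {0..x} H))) has_real_derivative
        exp (- q * (integral {0..1} H - integral {0..z} H)) * (q * H z)) (at z)"
      by (auto intro!: derivative_eq_intros 1)
    have eq: "exp (- q * (integral {0..1} H - integral {0..x} H)) = D x" if "x \<in> {0<..<1}" for x
    proof -
      have "integral {0..x} H + integral {x..1} H = integral {0..1} H"
        by (rule Henstock_Kurzweil_Integration.integral_combine)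
          (use that contH in \<open>auto intro: integrable_continuous_interval\<close>)
      then show ?thesis using that D[of x] int_eq[of x] by (simp flip: \<open>integral {0..x} H + integral {x..1} H = integral {0..1} H\<close>)
    qed
    have "(D has_real_derivative exp (- q * (integral {0..1} H - integral {0..z} H)) * (q * H z)) (at z)"
      by (rule has_field_derivative_transform_within_open[OF d1 open_greaterThanLessThan _ eq]) (use z in simp)
    then have D1: "(D has_real_derivative D z * (q * H z)) (at z)"
      using eq[of z] z by simp
    have "((\<lambda>x. \<Sum>n. d n * x ^ n) has_real_derivative (\<Sum>n. diffs d n * z ^ n)) (at z)"
      by (rule termdiffs_strong'[of 1]) (use sd z in auto)
    then have "(D has_real_derivative (\<Sum>n. diffs d n * z ^ n)) (at z)"
      by (rule has_field_derivative_transform_within_open[where S = "{0<..<1}"])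
        (use z d_gf in \<open>auto simp: sums_iff\<close>)
    then have "(\<Sum>n. diffs d n * z ^ n) = D z * (q * H z)" using D1 by (rule DERIV_unique)
    moreover have "summable (\<lambda>n. diffs d n * z ^ n)"
      by (rule termdiff_converges[of z 1]) (use z sd in auto)
    ultimately show ?thesis by (simp add: sums_iff mult_ac)
  qed
  moreover have "(\<lambda>n. q * conv h d n * z ^ n) sums (q * (H z * D z))" if z: "0 < z" "z < 1" for z
  proof -
    have "(\<lambda>n. conv h d n * z ^ n) sums (H z * D z)"
      unfolding HI[OF z] using z h d by (intro conv_sums I d_gf) auto
    from sums_mult[OF this, of q] show ?thesis by (simp add: mult.assoc)
  qed
  ultimately have "diffs d n = q * conv h d n"
    by (rule powser_eq_on_unit_interval)
  then show ?thesis by (simp add: diffs_def)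
qed

section \<open>Asymptotics of the idle orbit recursion\<close>

context subexponential_weight
begin

text \<open>The division by n + 1 turns the convolution estimate into a contraction once n \<ge> q *
  C1 * C2, which gives d = O(g) by induction. Applied once more, the estimate gives d = o(g), so in
  \<open>conv h d\<close> only the large index of \<open>h\<close> counts, weighted by the total
  mass 1 of \<open>d\<close>.\<close>

lemma log_derivative_recursion_limit:
  assumes h: "\<And>n. h n \<ge> 0" "h sums s" "(\<lambda>n. h n / g n) \<longlonglongrightarrow> ch"
    and d: "\<And>n. d n \<ge> 0" "d sums 1" and q: "q > 0"
    and rec: "\<And>n. real (Suc n) * d (Suc n) = q * conv h d n"
  shows "(\<lambda>n. real (Suc n) * d (Suc n) / g n) \<longlonglongrightarrow> q * ch"
proof -
  have "(\<lambda>n. conv h g n / g n) \<longlonglongrightarrow> s * 1 + suminf g * ch"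
    using summable_weight by (intro conv_limit_nonneg h nonneg weight_limit summable_sums)
  then obtain C1 where C1: "C1 > 0" "\<And>n. \<bar>conv h g n\<bar> \<le> C1 * g n" using bounded_ratio by blast
  have "(\<lambda>n. inverse (g (Suc n) / g n)) \<longlonglongrightarrow> inverse 1" by (intro tendsto_inverse long_tailed) simp
  then have "Bseq (\<lambda>n. inverse (g (Suc n) / g n))" by (intro convergent_imp_Bseq convergentI)
  then obtain C2 where C2: "C2 > 0" "\<And>n. norm (inverse (g (Suc n) / g n)) \<le> C2" unfolding Bseq_def by auto
  have C2': "g n \<le> C2 * g (Suc n)" for n
    using C2(2)[of n] pos[of n] pos[of "Suc n"] by (simp add: field_simps)
  have step: "d (Suc n) \<le> q * M * C1 * C2 / real (Suc n) * g (Suc n)"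
    if M: "M \<ge> 0" "\<And>i. i \<le> n \<Longrightarrow> d i \<le> M * g i" for n M
  proof -
    have "conv h d n \<le> (\<Sum>k\<le>n. h k * (M * g (n - k)))"
      unfolding conv_def using M h by (intro sum_mono mult_left_mono) auto
    also have "\<dots> = M * conv h g n" by (simp add: conv_def sum_distrib_left mult_ac)
    also have "\<dots> \<le> M * (C1 * (C2 * g (Suc n)))"
      using M C1 C2' by (intro mult_left_mono order_trans[OF abs_le_D1[OF C1(2)]]) auto
    finally have "real (Suc n) * d (Suc n) \<le> q * (M * (C1 * (C2 * g (Suc n))))"
      unfolding rec using q by (intro mult_left_mono) auto
    then show ?thesis by (simp add: field_simps)
  qed
  obtain N :: nat where N: "q * C1 * C2 \<le> real N" using real_arch_simple by blast
  define M where "M = Max ((\<lambda>n. d n / g n) ` {..N})"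
  have Max: "d n / g n \<le> M" if "n \<le> N" for n unfolding M_def using that by (intro Max_ge) auto
  have M0: "M \<ge> 0" using Max[of 0] d(1)[of 0] pos[of 0] by (intro order_trans[OF divide_nonneg_pos Max]) auto
  have bd: "d n \<le> M * g n" for n
  proof (induction n rule: less_induct)
    case (less n)
    show ?case
    proof (cases "n \<le> N")
      case True
      then show ?thesis using Max[of n] pos[of n] by (simp add: divide_le_eq)
    next
      case False
      then obtain m where m: "n = Suc m" by (cases n) auto
      have "d n \<le> q * M * C1 * C2 / real (Suc m) * g n"
        unfolding m using less m by (intro step M0) auto
      also have "q * M * C1 * C2 / real (Suc m) * g n = M * (q * C1 * C2 / real n) * g n" by (simp add: m)
      also have "\<dots> \<le> M * 1 * g n"
        using M0 N False nonneg by (intro mult_left_mono mult_right_mono) (auto simp: divide_le_eq)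
      finally show ?thesis by simp
    qed
  qed
  have "(\<lambda>n. d (Suc n) / g (Suc n)) \<longlonglongrightarrow> 0"
  proof (rule tendsto_sandwich[where f = "\<lambda>_. 0" and h = "\<lambda>n. q * M * C1 * C2 / real (Suc n)"])
    show "(\<lambda>n. q * M * C1 * C2 / real (Suc n)) \<longlonglongrightarrow> 0" by real_asymp
    have "d (Suc n) / g (Suc n) \<le> q * M * C1 * C2 / real (Suc n)" for n
      using step[OF M0 bd, of n] by (simp only: pos_divide_le_eq[OF pos])
    then show "eventually (\<lambda>n. d (Suc n) / g (Suc n) \<le> q * M * C1 * C2 / real (Suc n)) sequentially"
      by (intro always_eventually allI)
    show "eventually (\<lambda>n. 0 \<le> d (Suc n) / g (Suc n)) sequentially"
      using d nonneg by (intro always_eventually allI divide_nonneg_nonneg)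
  qed simp
  then have "(\<lambda>n. d n / g n) \<longlonglongrightarrow> 0" by (subst (asm) filterlim_sequentially_Suc)
  then have "(\<lambda>n. conv h d n / g n) \<longlonglongrightarrow> s * 0 + 1 * ch"
    by (intro conv_limit_nonneg h d)
  then have "(\<lambda>n. q * (conv h d n / g n)) \<longlonglongrightarrow> q * (s * 0 + 1 * ch)" by (rule tendsto_mult_left)
  then show ?thesis by (simp add: rec del: of_nat_Suc)
qed

end

text \<open>The injection \<open>i\<close> covers both a law on the natural numbers and the idle
  states (k, False) of the joint law; mass outside its range contributes 0.\<close>

lemma pmf_sums_expectation:
  fixes p :: "'a pmf"
  assumes z: "0 \<le> z" "z \<le> 1" and i: "inj i"
  shows "(\<lambda>k. pmf p (i k) * z ^ k) sums measure_pmf.expectation p (\<lambda>w. \<Sum>k. indicator {i k} w * z ^ k)"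
proof -
  have F: "(\<lambda>k. indicator {i k} w * z ^ k) sums (if w \<in> range i then z ^ (inv i w) else 0)" for w
  proof (cases "w \<in> range i")
    case True
    then have "(\<lambda>k. indicator {i k} w * z ^ k) = (\<lambda>k. if k = inv i w then z ^ k else 0)"
      using i by (auto simp: fun_eq_iff indicator_def inv_f_f)
    then show ?thesis using True sums_single[of "inv i w" "\<lambda>k. z ^ k"] by simp
  next
    case False
    then have "(\<lambda>k. indicator {i k} w * z ^ k) = (\<lambda>k. 0)"
      by (auto simp: fun_eq_iff indicator_def)
    then show ?thesis using False by simp
  qed
  have "(\<lambda>k. measure_pmf.expectation p (\<lambda>w. indicator {i k} w * z ^ k)) sums
      measure_pmf.expectation p (\<lambda>w. \<Sum>k. indicator {i k} w * z ^ k)"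
  proof (rule sums_integral_nonneg)
    show "AE w in measure_pmf p. (\<lambda>k. indicator {i k} w * z ^ k) sums (\<Sum>k. indicator {i k} w * z ^ k)"
      using F by (auto simp: sums_iff)
    have "(\<Sum>k. indicator {i k} w * z ^ k) = (if w \<in> range i then z ^ (inv i w) else 0)" for w
      using F[of w] by (simp add: sums_iff)
    then show "integrable (measure_pmf p) (\<lambda>w. \<Sum>k. indicator {i k} w * z ^ k)"
      using z by (intro measure_pmf.integrable_const_bound[of _ 1]) (auto simp: power_le_one)
  qed (use z in auto)
  then show ?thesis by (simp add: measure_pmf_single)
qed

lemma prob_greaterThan_eq: "measure_pmf.prob (p :: nat pmf) {j<..} = 1 - (\<Sum>k\<le>j. pmf p k)"
proof -
  have "{j<..} = UNIV - {..j}" by auto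
  then have "measure_pmf.prob p {j<..} = 1 - measure_pmf.prob p {..j}"
    using measure_pmf.prob_compl[of "{..j}" p] by simp
  then show ?thesis by (simp add: measure_measure_pmf_finite)
qed

lemma prob_greaterThan_sums:
  assumes "integrable (measure_pmf p) real"
  shows "(\<lambda>j. measure_pmf.prob p {j<..}) sums measure_pmf.expectation p real"
proof -
  have "(\<lambda>j. measure_pmf.expectation p (indicator {j<..})) sums measure_pmf.expectation p real"
  proof (rule sums_integral_nonneg)
    have "(\<lambda>j. if j \<in> {..<n} then 1 else 0) sums (\<Sum>j\<in>{..<n}. 1 :: real)" for n :: nat
      by (rule sums_If_finite_set) simp
    moreover have "(\<lambda>j. if j \<in> {..<n} then 1 else 0) = (\<lambda>j. indicator {j<..} n :: real)" for n :: nat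
      by (auto simp: fun_eq_iff)
    ultimately show "AE n in measure_pmf p. (\<lambda>j. indicator {j<..} n) sums real n" by simp
  qed (use assms in auto)
  then show ?thesis by simp
qed

section \<open>Stationary queue lengths\<close>

lemma (in slow_variation) shift_ratio:
  "(\<lambda>n. (real n powr p * L (real n)) / (real (Suc n) powr p * L (real (Suc n)))) \<longlonglongrightarrow> 1"
proof -
  have "(\<lambda>n. real n / real (Suc n)) \<longlonglongrightarrow> 1" by real_asymp
  from powr_ratio_limit[OF filterlim_real_Suc this, of p] show ?thesis by simp
qed

text \<open>Brings both tails to the common exponent \<open>a\<close>: for p > a the surplus power
  sends the ratio to 0, so the lighter tail gets the coefficient 0.\<close>

lemma (in slow_variation) weight_transfer:
  assumes p: "p \<ge> a" and lim: "(\<lambda>n. f n / (real n powr (- p) * L (real n))) \<longlonglongrightarrow> k"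
  shows "(\<lambda>n. f n / (real (Suc n) powr (- a) * L (real (Suc n)))) \<longlonglongrightarrow> (if p = a then k else 0)"
proof -
  have pw: "(\<lambda>n. real n powr (a - p)) \<longlonglongrightarrow> (if p = a then 1 else 0)"
  proof (cases "p = a")
    case True
    have "eventually (\<lambda>n. real n powr (a - p) = 1) sequentially"
      using eventually_gt_at_top[of 0] by eventually_elim (simp add: True)
    then show ?thesis unfolding if_P[OF True] by (rule tendsto_eventually)
  next
    case False
    then have "a - p < 0" using p by simp
    then have "(\<lambda>n. real n powr (a - p)) \<longlonglongrightarrow> 0" by real_asymp
    then show ?thesis using False by simp
  qed
  have k: "k * (if p = a then 1 else 0) * 1 = (if p = a then k else 0)" by simp
  have "(\<lambda>n. f n / (real n powr (- p) * L (real n)) * real n powr (a - p) *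
      ((real n powr (- a) * L (real n)) / (real (Suc n) powr (- a) * L (real (Suc n)))))
      \<longlonglongrightarrow> (if p = a then k else 0)"
    unfolding k[symmetric] by (intro tendsto_mult lim pw shift_ratio)
  moreover have "eventually (\<lambda>n. f n / (real n powr (- p) * L (real n)) * real n powr (a - p) *
      ((real n powr (- a) * L (real n)) / (real (Suc n) powr (- a) * L (real (Suc n)))) =
      f n / (real (Suc n) powr (- a) * L (real (Suc n)))) sequentially"
    using eventually_gt_at_top[of 0]
  proof eventually_elim
    case (elim n)
    have cancel: "u / (P * l) * Q * (N * l / W) = u / W" if "Q * N = P" "P * l \<noteq> 0" for u P l Q N W :: real
      using that(2) unfolding that(1)[symmetric] by simp
    show ?case
    proof (rule cancel)
      show "real n powr (a - p) * real n powr (- a) = real n powr (- p)"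
        unfolding powr_add[symmetric] by simp
      show "real n powr (- p) * L (real n) \<noteq> 0" using elim L_pos[of "real n"] by simp
    qed
  qed
  ultimately show ?thesis by (rule Lim_transform_eventually)
qed

section \<open>Generating functions of the queue laws\<close>

lemma pgf_sums:
  assumes "0 \<le> z" "z \<le> 1"
  shows "(\<lambda>k. pmf p k * z ^ k) sums pgf p z"
proof -
  have "(\<Sum>k. indicator {k} w * z ^ k) = z ^ w" for w :: nat
    using suminf_finite[of "{w}" "\<lambda>k. indicator {k} w * z ^ k"] by (simp add: indicator_def)
  then show ?thesis
    using pmf_sums_expectation[OF assms, of "\<lambda>k. k" p] by (simp add: pgf_def)
qed

lemma pmf_sums_1: "pmf p sums (1 :: real)" for p :: "nat pmf"
  using pgf_sums[of 1 p] by (simp add: pgf_def)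

text \<open>Also true for a server that is never idle: division by 0 then makes both sides
  0.\<close>

lemma idle_orbit_sums:
  assumes "0 \<le> z" "z \<le> 1"
  shows "(\<lambda>k. pmf S (k, False) / measure_pmf.prob S {(n, c). \<not> c} * z ^ k) sums orbit_gf_given_idle S z"
proof -
  have "(\<Sum>k. indicator {(k, False)} w * z ^ k) = (case w of (n, c) \<Rightarrow> if c then 0 else z ^ n)" for w :: "nat \<times> bool"
  proof (cases w)
    case (Pair n c)
    then show ?thesis
      using suminf_finite[of "{n}" "\<lambda>k. indicator {(k, False)} w * z ^ k"] by (auto simp: indicator_def)
  qed
  then have "(\<lambda>k. pmf S (k, False) * z ^ k) sums measure_pmf.expectation S (\<lambda>(n, c). if c then 0 else z ^ n)"
    using pmf_sums_expectation[OF assms, of "\<lambda>k. (k, False)" S] by (simp add: inj_def)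
  from sums_divide[OF this, of "measure_pmf.prob S {(n, c). \<not> c}"]
  show ?thesis by (simp add: orbit_gf_given_idle_def)
qed

lemma orbit_gf_given_idle_1:
  assumes "measure_pmf.prob S {(n, c). \<not> c} \<noteq> 0"
  shows "orbit_gf_given_idle S 1 = 1"
proof -
  have "measure_pmf.expectation S (\<lambda>(n, c). if c then 0 else (1 :: real) ^ n) = measure_pmf.expectation S (indicator {(n, c). \<not> c})"
    by (intro Bochner_Integration.integral_cong) (auto simp: indicator_def)
  then show ?thesis using assms by (simp add: orbit_gf_given_idle_def)
qed

theorem theorem6p1:
  fixes lam mu dB dX cX \<rho> \<beta>1 \<chi>1 a \<psi> cK cD :: real
    and X :: "nat pmf" and B :: "real measure" and L :: "real \<Rightarrow> real"
    and Linf Lmu :: "nat pmf" and S :: "(nat \<times> bool) pmf"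
  assumes lam: "lam > 0" and mu: "mu > 0"
    and X_pos: "0 \<notin> set_pmf X"
    and X_mean: "integrable (measure_pmf X) real" "\<chi>1 = mean_batch X"
    and B_distr: "real_distribution B" "cdf B 0 = 0"
    and B_mean: "integrable B (\<lambda>x. x)" "\<beta>1 = mean_service B"
    and stable: "\<rho> = lam * \<beta>1 * \<chi>1" "\<rho> < 1"
    and Linf: "standard_queue_law lam X B Linf"
    and Lmu: "retrial_queue_law lam mu X B S" "Lmu = total_customers S"
    and L: "slowly_varying L"
    and A1: "dB > 1"
      "(\<lambda>x. measure B {x<..}) \<sim>[at_top] (\<lambda>x. x powr (- dB) * L x)"
    and A2: "dX > 1" "cX \<ge> 0"
      "cX > 0 \<Longrightarrow> (\<lambda>j. measure_pmf.prob X {j<..})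
         \<sim>[sequentially] (\<lambda>j. cX * real j powr (- dX) * L (real j))"
      "cX = 0 \<Longrightarrow> (\<lambda>j. measure_pmf.prob X {j<..} / (real j powr (- dX) * L (real j)))
         \<longlonglongrightarrow> 0"
    and case_cond: "dX > dB \<or> (dX < dB \<and> cX > 0) \<or> (dX = dB \<and> cX > 0)"
    and a: "a = min dB dX"
    and psi: "\<psi> = lam * (\<rho> + \<chi>1 - 1) / (mu * (1 - \<rho>))"
    and cK: "cK =
      (if dX > dB then (lam * \<chi>1) powr a / ((a - 1) * (1 - \<rho>))
       else if dX < dB then lam * \<beta>1 * cX / ((a - 1) * (1 - \<rho>))
       else ((lam * \<chi>1) powr a + lam * \<beta>1 * cX) / ((a - 1) * (1 - \<rho>)))"
    and cD: "cD =
      (if dX > dB then (lam * \<chi>1) powr (a + 1) / (a * mu * (1 - \<rho>)\<^sup>2)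
       else if dX < dB then lam * cX / (a * mu * (1 - \<rho>)\<^sup>2)
       else ((lam * \<chi>1) powr (a + 1) + lam * cX) / (a * mu * (1 - \<rho>)\<^sup>2))"
  shows "(\<lambda>j. measure_pmf.prob Lmu {j<..})
           \<sim>[sequentially] (\<lambda>j. measure_pmf.prob Linf {j<..})
       \<and> (\<lambda>j. measure_pmf.prob Linf {j<..})
           \<sim>[sequentially] (\<lambda>j. cK * real j powr (- a + 1) * L (real j))
       \<and> (ultimately_decreasing (pmf Linf) \<longrightarrow>
           (\<lambda>j. measure_pmf.prob Lmu {j<..} - measure_pmf.prob Linf {j<..})
             \<sim>[sequentially]
           (\<lambda>j. ((a - 1) * \<psi> * cK + cD) * real j powr (- a) * L (real j)))"
proof -
  define x where "x = pmf X"
  define xb where "xb j = measure_pmf.prob X {j<..}" for j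
  \<comment> \<open>Coefficients on the common scale n^(-a) L(n); through them the three cases of
    the theorem become one computation.\<close>
  define cB where "cB = (if dB = a then 1 else 0 :: real)"
  define c where "c = (if dX = a then cX else 0)"
  define g where "g n = real (Suc n) powr (- a) * L (real (Suc n))" for n
  have a1: "a > 1" using a A1(1) A2(1) by simp
  interpret real_distribution B by (rule B_distr)
  have L_pos: "L t > 0" if "t > 0" for t using L that by (simp add: slowly_varying_def)
  \<comment> \<open>Asymptotic equivalence counts a quotient 0 / 0 as 1; positivity of L turns it
    into a plain limit.\<close>
  have B_lim: "((\<lambda>t. measure B {t<..} / (t powr (- dB) * L t)) \<longlongrightarrow> 1) at_top"
  proof (rule asymp_equivD_strong[OF A1(2)])
    show "eventually (\<lambda>t. measure B {t<..} \<noteq> 0 \<or> t powr (- dB) * L t \<noteq> 0) at_top"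
      using eventually_gt_at_top[of 0] by eventually_elim (use L_pos in force)
  qed
  interpret slow_variation L
  proof (rule slow_variationI[where G = "\<lambda>t. measure B {t<..}" and d = dB])
    show "((\<lambda>x. L (t * x) / L x) \<longlongrightarrow> 1) at_top" if "t > 0" for t
      using L that by (simp add: slowly_varying_def)
    show "measure B {y<..} \<le> measure B {x<..}" if "x \<le> y" for x y
      using that by (intro finite_measure_mono) auto
  qed (use L_pos B_lim A1 in auto)
  have x_sums: "x sums 1" unfolding x_def by (rule pmf_sums_1)
  have x0: "x 0 = 0" using X_pos by (simp add: x_def set_pmf_iff)
  have xb_sums: "xb sums \<chi>1"
    unfolding xb_def X_mean(2) mean_batch_def using X_mean(1) by (rule prob_greaterThan_sums)
  have xb0: "xb 0 = 1" using x0 by (simp add: xb_def x_def prob_greaterThan_eq)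
  have chi1: "\<chi>1 \<ge> 1"
    using sum_le_suminf[of xb "{0}"] xb_sums xb0 by (simp add: sums_iff xb_def)
  have X_lim: "(\<lambda>j. xb j / (real j powr (- dX) * L (real j))) \<longlonglongrightarrow> cX"
  proof (cases "cX = 0")
    case True
    then show ?thesis using A2(4) by (simp add: xb_def)
  next
    case False
    then have cX: "cX > 0" using A2(2) by simp
    have "(\<lambda>j. xb j / (cX * real j powr (- dX) * L (real j))) \<longlonglongrightarrow> 1"
      unfolding xb_def
    proof (rule asymp_equivD_strong[OF A2(3)[OF cX]])
      show "eventually (\<lambda>j. measure_pmf.prob X {j<..} \<noteq> 0 \<or> cX * real j powr (- dX) * L (real j) \<noteq> 0) sequentially"
        using eventually_gt_at_top[of 0] proof eventually_elim
        case (elim j)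
        then show ?case using L_pos[of "real j"] cX by simp
      qed
    qed
    from tendsto_mult_left[OF this, of cX] show ?thesis using cX by (simp add: mult.assoc)
  qed
  interpret compound_service L x xb \<chi>1 a c B lam cB
  proof (intro compound_service.intro regular_batch_sizes.intro batch_sizes.intro
      regular_batch_sizes_axioms.intro compound_service_axioms.intro)
    show "slow_variation L" "prob_space B" by unfold_locales
    show "x sums 1" "xb sums \<chi>1" "a > 1" "lam > 0" "integrable B (\<lambda>b. b)"
      by (rule x_sums xb_sums a1 lam B_mean)+
    show "x k \<ge> 0" for k by (simp add: x_def)
    show "xb j = 1 - (\<Sum>k\<le>j. x k)" for j unfolding xb_def x_def by (rule prob_greaterThan_eq)
    show "subexponential_weight (\<lambda>n. real (Suc n) powr (- a) * L (real (Suc n)))"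
      by (rule subexponential_weight[OF a1])
    show "(\<lambda>n. xb n / (real (Suc n) powr (- a) * L (real (Suc n)))) \<longlonglongrightarrow> c"
      unfolding c_def using a by (intro weight_transfer X_lim) simp
    show "\<chi>1 > 0" using chi1 by simp
    show "sets B = sets borel" by simp
    have "{..0} \<in> null_sets B" using B_distr(2) by (simp add: cdf_def null_sets_def emeasure_eq_measure)
    then show "AE b in B. b > 0" by (rule AE_not_in[THEN eventually_mono]) auto
    show "(\<lambda>j. measure B {\<kappa> * real j<..} / (real (Suc j) powr (- a) * L (real (Suc j)))) \<longlonglongrightarrow> cB * \<kappa> powr (- a)"
      if \<kappa>: "\<kappa> > 0" for \<kappa>
    proof -
      have top: "filterlim (\<lambda>j. \<kappa> * real j) at_top sequentially"
        by (rule filterlim_tendsto_pos_mult_at_top[OF tendsto_const \<kappa> filterlim_real_sequentially])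
      have rat: "(\<lambda>j. \<kappa> * real j / real j) \<longlonglongrightarrow> \<kappa>" by real_asymp
      have "(\<lambda>j. measure B {\<kappa> * real j<..} / ((\<kappa> * real j) powr (- dB) * L (\<kappa> * real j)) *
          (((\<kappa> * real j) powr (- dB) * L (\<kappa> * real j)) / (real j powr (- dB) * L (real j)))) \<longlonglongrightarrow> 1 * \<kappa> powr (- dB)"
        by (intro tendsto_mult filterlim_compose[OF B_lim top] powr_ratio_limit filterlim_real_sequentially rat \<kappa>)
      moreover have "eventually (\<lambda>j. measure B {\<kappa> * real j<..} / ((\<kappa> * real j) powr (- dB) * L (\<kappa> * real j)) *
          (((\<kappa> * real j) powr (- dB) * L (\<kappa> * real j)) / (real j powr (- dB) * L (real j))) =
          measure B {\<kappa> * real j<..} / (real j powr (- dB) * L (real j))) sequentially"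
        using eventually_gt_at_top[of 0]
      proof eventually_elim
        case (elim j)
        then have "(\<kappa> * real j) powr (- dB) * L (\<kappa> * real j) \<noteq> 0" using \<kappa> L_pos[of "\<kappa> * real j"] by simp
        then show ?case by simp
      qed
      ultimately have "(\<lambda>j. measure B {\<kappa> * real j<..} / (real j powr (- dB) * L (real j))) \<longlonglongrightarrow> 1 * \<kappa> powr (- dB)"
        by (rule Lim_transform_eventually)
      moreover have "dB \<ge> a" using a by simp
      ultimately have "(\<lambda>j. measure B {\<kappa> * real j<..} / (real (Suc j) powr (- a) * L (real (Suc j)))) \<longlonglongrightarrow>
          (if dB = a then 1 * \<kappa> powr (- dB) else 0)"
        by (intro weight_transfer)
      then show ?thesis by (cases "dB = a") (simp_all add: cB_def)
    qed
  qed

  have chi_pos: "\<chi>1 > 0" using chi1 by simp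
  define r where "r = arrivals_tail"
  define cA where "cA = cB * (lam * \<chi>1) powr a + lam * \<beta>1 * c"
  define A where "A z = service_arrivals_gf lam X B z" for z
  define p where "p = pmf Linf"
  have mean: "mean_service_time = \<beta>1" by (simp add: mean_service_time_def B_mean(2) mean_service_def)
  have r_nonneg: "r n \<ge> 0" for n unfolding r_def by (rule arrivals_tail_nonneg)
  have r_sums: "r sums \<rho>"
    using arrivals_tail_sums by (simp add: r_def mean stable(1))
  have r_lim: "(\<lambda>n. r n / g n) \<longlonglongrightarrow> cA"
    using arrivals_tail_limit unfolding r_def cA_def g_def mean .
  have X_gf: "(\<lambda>k. x k * z ^ k) sums pgf X z" if "0 \<le> z" "z < 1" for z
    unfolding x_def using that by (intro pgf_sums) auto
  have r_gf: "(\<lambda>n. r n * z ^ n) sums ((1 - A z) / (1 - z))" if z: "0 \<le> z" "z < 1" for z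
  proof -
    have "A z = (\<integral>b. exp (- (lam * b * (1 - pgf X z))) \<partial>B)"
      unfolding A_def service_arrivals_gf_def laplace_stieltjes_def
      by (intro Bochner_Integration.integral_cong refl) (simp add: algebra_simps)
    then show ?thesis using arrivals_tail_gf[OF z X_gf[OF z]] by (simp only: r_def)
  qed
  have p_nonneg: "p n \<ge> 0" for n by (simp add: p_def)
  have p_sums: "p sums 1" unfolding p_def by (rule pmf_sums_1)
  have p_gf: "(\<lambda>n. p n * z ^ n) sums (A z * ((1 - \<rho>) * (1 - z) / (A z - z)))" if z: "0 \<le> z" "z < 1" for z
  proof -
    have "pgf Linf z = A z * ((1 - \<rho>) * (1 - z) / (A z - z))"
      using Linf z by (simp add: standard_queue_law_def standard_queue_gf_def A_def traffic_def
          stable(1) X_mean(2) B_mean(2))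
    then show ?thesis using pgf_sums[of z Linf] z by (simp add: p_def)
  qed
  define e where "e n = (if n = 0 then 1 else 0) + p (Suc n) / (1 - \<rho>)" for n
  note standard = standard_queue_renewal[OF r_nonneg r_sums stable(2) p_nonneg p_sums r_gf p_gf, folded e_def]
  have R_less_1: "(1 - A z) / (1 - z) < 1" if "0 \<le> z" "z < 1" for z
    by (rule standard(1); (assumption | rule that))
  have e_renewal: "e n = (if n = 0 then 1 else 0) + conv r e n" for n
    by (rule standard(2); assumption)
  have e_sums: "e sums (1 / (1 - \<rho>))"
    by (rule standard(3); assumption)
  have e_gf: "(\<lambda>n. e n * z ^ n) sums (1 / (1 - (1 - A z) / (1 - z)))" if "0 < z" "z < 1" for z
    by (rule standard(4); (assumption | rule that))
  have e_nonneg: "e n \<ge> 0" for n using p_nonneg stable(2) by (simp add: e_def)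
  have e_lim: "(\<lambda>n. e n / g n) \<longlonglongrightarrow> cA / (1 - \<rho>)\<^sup>2"
    using renewal_limit[OF r_nonneg r_sums stable(2) r_lim[unfolded g_def] e_nonneg e_sums e_renewal]
    by (simp only: g_def)
  have g_pos: "g n > 0" for n unfolding g_def by (rule pos)
  have g_long: "(\<lambda>n. g (Suc n) / g n) \<longlonglongrightarrow> 1" using long_tailed by (simp only: g_def)
  \<comment> \<open>\<open>e\<close> without its unit mass at 0, with generating function E(z) - 1;
    a change at one index leaves the limit alone.\<close>
  define e' where "e' n = p (Suc n) / (1 - \<rho>)" for n
  have e'_lim: "(\<lambda>n. e' n / g n) \<longlonglongrightarrow> cA / (1 - \<rho>)\<^sup>2"
  proof (rule Lim_transform_eventually[OF e_lim])
    show "eventually (\<lambda>n. e n / g n = e' n / g n) sequentially"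
      using eventually_gt_at_top[of 0] by eventually_elim (simp add: e_def e'_def)
  qed
  have e'_nonneg: "e' n \<ge> 0" for n using p_nonneg stable(2) by (simp add: e'_def)
  have delta_sums: "(\<lambda>n. if n = 0 then 1 else 0) sums (1 :: real)"
    using sums_single[of 0 "\<lambda>_. 1 :: real"] by simp
  have delta_gf: "(\<lambda>n. (if n = 0 then 1 else 0) * z ^ n) sums (1 :: real)" for z
    using sums_single[of 0 "\<lambda>n. z ^ n"] by (simp add: if_distrib[of "\<lambda>x. x * _"] cong: if_cong)
  have e'_eq: "e' = (\<lambda>n. e n - (if n = 0 then 1 else 0))" by (simp add: fun_eq_iff e_def e'_def)
  have e'_sums: "e' sums (1 / (1 - \<rho>) - 1)" unfolding e'_eq by (intro sums_diff e_sums delta_sums)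
  have p_lim: "(\<lambda>n. p n / g n) \<longlonglongrightarrow> cA / (1 - \<rho>)"
  proof -
    have "(\<lambda>n. (1 - \<rho>) * (e' n / g n) / (g (Suc n) / g n)) \<longlonglongrightarrow> (1 - \<rho>) * (cA / (1 - \<rho>)\<^sup>2) / 1"
      by (intro tendsto_intros e'_lim g_long) simp
    moreover have "(1 - \<rho>) * (e' n / g n) / (g (Suc n) / g n) = p (Suc n) / g (Suc n)" for n
      using g_pos[of n] stable(2) by (simp add: e'_def)
    moreover have "(1 - \<rho>) * (cA / (1 - \<rho>)\<^sup>2) / 1 = cA / (1 - \<rho>)"
      using stable(2) by (simp add: power2_eq_square)
    ultimately have "(\<lambda>n. p (Suc n) / g (Suc n)) \<longlonglongrightarrow> cA / (1 - \<rho>)" by (simp only:)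
    then show ?thesis by (subst (asm) filterlim_sequentially_Suc)
  qed
  \<comment> \<open>\<open>y\<close> is the tail and \<open>x'\<close> the law of X - 1, the part of
    a batch that joins the orbit when the server is free.\<close>
  define y where "y n = xb (Suc n)" for n
  define x' where "x' n = x (Suc n)" for n
  have y_nonneg: "y n \<ge> 0" for n unfolding y_def by (rule xb_nonneg)
  have x'_nonneg: "x' n \<ge> 0" for n unfolding x'_def by (rule x_nonneg)
  have y_sums: "y sums (\<chi>1 - 1)"
    unfolding y_def using xb_sums xb0 by (subst sums_Suc_iff) simp
  have x'_sums: "x' sums 1"
    unfolding x'_def using x_sums x0 by (subst sums_Suc_iff) simp
  have shift_lim: "(\<lambda>n. f (Suc n) / g n) \<longlonglongrightarrow> l" if f: "(\<lambda>n. f n / g n) \<longlonglongrightarrow> l" for f l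
  proof -
    have "(\<lambda>n. f (Suc n) / g (Suc n) * (g (Suc n) / g n)) \<longlonglongrightarrow> l * 1"
      by (intro tendsto_mult g_long LIMSEQ_Suc[OF f])
    moreover have "f (Suc n) / g (Suc n) * (g (Suc n) / g n) = f (Suc n) / g n" for n
      using g_pos[of "Suc n"] by simp
    ultimately show ?thesis by (simp only: mult_1_right)
  qed
  have y_lim: "(\<lambda>n. y n / g n) \<longlonglongrightarrow> c"
    unfolding y_def by (rule shift_lim) (use xb_limit in \<open>simp only: g_def\<close>)
  have x'_lim: "(\<lambda>n. x' n / g n) \<longlonglongrightarrow> 0"
    unfolding x'_def by (rule shift_lim) (use x_limit in \<open>simp only: g_def\<close>)
  \<comment> \<open>The integrand equals Y(u) E(u) + X_0(u) (E(u) - 1), with Y and X_0 the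
    generating functions of \<open>y\<close> and \<open>x'\<close>. Although its numerator is a
    difference, its coefficients are thus visibly nonnegative.\<close>
  define h where "h n = conv y e n + conv x' e' n" for n
  define hs where "hs = (\<chi>1 - 1) * (1 / (1 - \<rho>)) + 1 * (1 / (1 - \<rho>) - 1)"
  define ch where "ch = ((\<chi>1 - 1) * (cA / (1 - \<rho>)\<^sup>2) + 1 / (1 - \<rho>) * c) + (1 * (cA / (1 - \<rho>)\<^sup>2) + (1 / (1 - \<rho>) - 1) * 0)"
  have h_nonneg: "h n \<ge> 0" for n
    unfolding h_def by (intro add_nonneg_nonneg conv_nonneg y_nonneg e_nonneg x'_nonneg e'_nonneg)
  have h_sums: "h sums hs"
    unfolding h_def hs_def
    by (intro sums_add conv_sums_1 y_nonneg e_nonneg x'_nonneg e'_nonneg y_sums e_sums x'_sums e'_sums)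
  have h_lim: "(\<lambda>n. h n / g n) \<longlonglongrightarrow> ch"
    unfolding h_def ch_def add_divide_distrib g_def
    by (intro tendsto_add conv_limit_nonneg y_nonneg e_nonneg x'_nonneg e'_nonneg y_sums e_sums x'_sums e'_sums
      y_lim[unfolded g_def] e_lim[unfolded g_def] x'_lim[unfolded g_def] e'_lim[unfolded g_def])
  define I where "I u = (1 - A u * (pgf X u / u)) / (A u - u)" for u
  have h_gf: "(\<lambda>n. h n * u ^ n) sums I u" if u: "0 < u" "u < 1" for u
  proof -
    define R where "R = (1 - A u) / (1 - u)"
    define P where "P = pgf X u"
    have R1: "R < 1" unfolding R_def using u by (intro R_less_1) auto
    have nz: "1 - R \<noteq> 0" "1 - u \<noteq> 0" "u \<noteq> 0" using R1 u by auto
    have Au: "A u = 1 - (1 - u) * R" using u by (simp add: R_def)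
    have P: "(\<lambda>k. x k * u ^ k) sums P" unfolding P_def using u by (intro X_gf) auto
    have "(\<lambda>k. xb k * u ^ k) sums ((1 - P) / (1 - u))" using u P by (intro xb_gf) auto
    then have "(\<lambda>k. xb (Suc k) * u ^ Suc k) sums ((1 - P) / (1 - u) - 1)"
      by (subst sums_Suc_iff) (simp add: xb0)
    then have "(\<lambda>k. xb (Suc k) * u ^ Suc k / u) sums (((1 - P) / (1 - u) - 1) / u)" by (rule sums_divide)
    then have y_gf: "(\<lambda>k. y k * u ^ k) sums (((1 - P) / (1 - u) - 1) / u)"
      using u by (simp add: y_def)
    have "(\<lambda>k. x (Suc k) * u ^ Suc k) sums (P - 0)" using P x0 by (subst sums_Suc_iff) simp
    then have "(\<lambda>k. x (Suc k) * u ^ Suc k / u) sums ((P - 0) / u)" by (rule sums_divide)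
    then have x'_gf: "(\<lambda>k. x' k * u ^ k) sums (P / u)"
      using u by (simp add: x'_def)
    have e_gf': "(\<lambda>k. e k * u ^ k) sums (1 / (1 - R))" unfolding R_def by (rule e_gf[OF u])
    have e'_gf: "(\<lambda>k. e' k * u ^ k) sums (1 / (1 - R) - 1)"
      using sums_diff[OF e_gf' delta_gf] by (simp add: e'_eq left_diff_distrib)
    have "(\<lambda>n. conv y e n * u ^ n + conv x' e' n * u ^ n) sums
        (((1 - P) / (1 - u) - 1) / u * (1 / (1 - R)) + P / u * (1 / (1 - R) - 1))"
      using u by (intro sums_add conv_sums y_nonneg e_nonneg x'_nonneg e'_nonneg y_gf e_gf' x'_gf e'_gf) auto
    moreover have "((1 - P) / (1 - u) - 1) / u * (1 / (1 - R)) + P / u * (1 / (1 - R) - 1) = I u"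
    proof -
      have 1: "(1 - P) / (1 - u) - 1 = (u - P) / (1 - u)" using nz by (simp add: field_simps)
      have 2: "1 / (1 - R) - 1 = R / (1 - R)" using nz by (simp add: field_simps)
      have 3: "I u = (1 - (1 - (1 - u) * R) * (P / u)) / ((1 - u) * (1 - R))"
        unfolding I_def Au P_def by (simp add: algebra_simps)
      have "(u - P) / (1 - u) / u * (1 / (1 - R)) + P / u * (R / (1 - R)) =
          ((u - P) + P * R * (1 - u)) / (u * (1 - u) * (1 - R))"
        using nz by (simp add: add_divide_distrib mult_ac)
      also have "(u - P) + P * R * (1 - u) = u * (1 - (1 - (1 - u) * R) * (P / u))"
        using nz by (simp add: field_simps)
      also have "u * (1 - (1 - (1 - u) * R) * (P / u)) / (u * (1 - u) * (1 - R)) = I u"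
        unfolding 3 by (simp only: mult.assoc mult_divide_mult_cancel_left[OF nz(3)])
      finally show ?thesis unfolding 1 2 .
    qed
    ultimately show ?thesis by (simp only: h_def distrib_right)
  qed
  define d where "d k = pmf S (k, False) / measure_pmf.prob S {(n, c). \<not> c}" for k
  have d_nonneg: "d n \<ge> 0" for n by (simp add: d_def)
  have d_gf: "(\<lambda>k. d k * z ^ k) sums orbit_gf_given_idle S z" if "0 \<le> z" "z \<le> 1" for z
    unfolding d_def using that by (rule idle_orbit_sums)
  have idle: "orbit_gf_given_idle S z = exp (- (lam / mu) * integral {z..1} I)" if "0 \<le> z" "z < 1" for z
    using Lmu(1) that unfolding retrial_queue_law_def idle_orbit_gf_def I_def A_def by auto
  \<comment> \<open>A never idle server would make the quotient 0, whereas \<open>idle\<close> shows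
    it to be a positive exponential.\<close>
  have "measure_pmf.prob S {(n, c). \<not> c} \<noteq> 0"
    using idle[of 0] by (auto simp: orbit_gf_given_idle_def)
  then have d_sums: "d sums 1"
    using d_gf[of 1] orbit_gf_given_idle_1[of S] by simp
  define q where "q = lam / mu"
  have q: "q > 0" using lam mu by (simp add: q_def)
  have d_rec: "real (Suc n) * d (Suc n) = q * conv h d n" for n
  proof (rule exp_integral_coefficients[where I = I and D = "orbit_gf_given_idle S"])
    show "summable h" using h_sums by (simp add: sums_iff)
    show "orbit_gf_given_idle S z = exp (- q * integral {z..1} I)" if "0 \<le> z" "z < 1" for z
      unfolding q_def by (rule idle[OF that])
  qed (use d_gf in \<open>auto intro: h_nonneg d_nonneg h_gf q\<close>)
  have d_lim: "(\<lambda>n. real (Suc n) * d (Suc n) / g n) \<longlonglongrightarrow> q * ch"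
    using log_derivative_recursion_limit[OF h_nonneg h_sums h_lim[unfolded g_def] d_nonneg d_sums q d_rec]
    by (simp only: g_def)
  define db where "db n = 1 - (\<Sum>k\<le>n. d k)" for n
  have db_nonneg: "db n \<ge> 0" for n
    using sum_le_suminf[of d "{..n}"] d_sums d_nonneg by (simp add: sums_iff db_def)
  \<comment> \<open>Summing the recursion for \<open>d\<close> gives the mean orbit size, identified
    with \<psi> in \<open>hs_eq\<close>.\<close>
  have db_sums: "db sums (q * (hs * 1))"
    unfolding db_def
  proof (rule tail_sums_mean[OF d_nonneg d_sums])
    show "(\<lambda>n. real (Suc n) * d (Suc n)) sums (q * (hs * 1))"
      unfolding d_rec by (intro sums_mult conv_sums_1 h_nonneg d_nonneg h_sums d_sums)
  qed
  \<comment> \<open>By the recursion \<open>d\<close> has exponent a + 1, so Karamata's theorem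
    yields exponent a and the factor 1 / a found in \<open>cD\<close>.\<close>
  have db_lim: "(\<lambda>n. db n / g n) \<longlonglongrightarrow> q * ch / a"
  proof -
    have "(\<lambda>n. d (Suc n) / (real (Suc n) powr (- (a + 1)) * L (real (Suc n)))) \<longlonglongrightarrow> q * ch"
    proof (rule Lim_transform_eventually[OF d_lim], rule always_eventually, rule allI)
      fix n
      have "real (Suc n) powr (- (a + 1)) = real (Suc n) powr (- a) / real (Suc n)"
        using powr_diff[of "real (Suc n)" "- a" 1] by simp
      then show "real (Suc n) * d (Suc n) / g n = d (Suc n) / (real (Suc n) powr (- (a + 1)) * L (real (Suc n)))"
        by (simp add: g_def mult_ac)
    qed
    then have "(\<lambda>n. d n / (real n powr (- (a + 1)) * L (real n))) \<longlonglongrightarrow> q * ch"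
      by (subst (asm) filterlim_sequentially_Suc)
    from karamata_tail_sum[OF _ d_nonneg _ this]
    have "(\<lambda>n. (\<Sum>k. d (k + Suc n)) / (real n powr (1 - (a + 1)) * L (real n))) \<longlonglongrightarrow> q * ch / (a + 1 - 1)"
      using a1 d_sums by (simp add: sums_iff)
    moreover have "(\<Sum>k. d (k + Suc n)) = db n" for n
      using tail_eq_suminf[OF d_sums] by (simp add: db_def)
    ultimately have "(\<lambda>n. db n / (real n powr (- a) * L (real n))) \<longlonglongrightarrow> q * ch / a" by simp
    from weight_transfer[OF order_refl this] show ?thesis by (simp add: g_def)
  qed
  have Lmu_pmf: "pmf Lmu n = conv p d n" for n
  proof (rule powser_eq_on_unit_interval[where f = "pgf Lmu"])
    fix z :: real assume z: "0 < z" "z < 1"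
    show "(\<lambda>n. pmf Lmu n * z ^ n) sums pgf Lmu z" using z by (intro pgf_sums) auto
    have "pgf Lmu z = pgf Linf z * orbit_gf_given_idle S z"
      using Lmu Linf z by (simp add: retrial_queue_law_def standard_queue_law_def)
    then show "(\<lambda>n. conv p d n * z ^ n) sums pgf Lmu z"
      using z pgf_sums[of z Linf] d_gf[of z] by (auto simp: p_def intro!: conv_sums d_nonneg)
  qed
  define M where "M n = measure_pmf.prob Lmu {n<..}" for n
  define K where "K n = measure_pmf.prob Linf {n<..}" for n
  have diff_eq: "M n - K n = conv p db n" for n
    unfolding M_def K_def prob_greaterThan_eq Lmu_pmf db_def p_def[symmetric] by (rule conv_tail)
  define t where "t = 1 * (q * ch / a) + q * (hs * 1) * (cA / (1 - \<rho>))"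
  have diff_lim: "(\<lambda>n. (M n - K n) / g n) \<longlonglongrightarrow> t"
    unfolding diff_eq t_def g_def
    by (intro conv_limit_nonneg p_nonneg db_nonneg p_sums db_sums p_lim[unfolded g_def] db_lim[unfolded g_def])
  have unshift: "(\<lambda>n. f n / (real n powr (- a) * L (real n))) \<longlonglongrightarrow> l" if f: "(\<lambda>n. f n / g n) \<longlonglongrightarrow> l" for f l
  proof -
    have "(\<lambda>n. f n / g n / ((real n powr (- a) * L (real n)) / g n)) \<longlonglongrightarrow> l / 1"
      unfolding g_def by (intro tendsto_divide f[unfolded g_def] shift_ratio) simp
    moreover have "f n / g n / ((real n powr (- a) * L (real n)) / g n) = f n / (real n powr (- a) * L (real n))" for n
      using g_pos[of n] by simp
    ultimately show ?thesis by (simp only: div_by_1)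
  qed
  have K_lim: "(\<lambda>n. K n / (real n powr (1 - a) * L (real n))) \<longlonglongrightarrow> cA / (1 - \<rho>) / (a - 1)"
  proof -
    have "(\<lambda>n. (\<Sum>k. p (k + Suc n)) / (real n powr (1 - a) * L (real n))) \<longlonglongrightarrow> cA / (1 - \<rho>) / (a - 1)"
      by (rule karamata_tail_sum[OF a1 p_nonneg _ unshift[OF p_lim]]) (use p_sums in \<open>simp add: sums_iff\<close>)
    then show ?thesis
      using tail_eq_suminf[OF p_sums] by (simp add: K_def prob_greaterThan_eq p_def)
  qed
  \<comment> \<open>The difference of the tails is smaller than either of them by a factor of order
    1 / n.\<close>
  have M_lim: "(\<lambda>n. M n / (real n powr (1 - a) * L (real n))) \<longlonglongrightarrow> cA / (1 - \<rho>) / (a - 1)"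
  proof -
    have inv: "(\<lambda>n. inverse (real n)) \<longlonglongrightarrow> 0" by real_asymp
    have "(\<lambda>n. K n / (real n powr (1 - a) * L (real n)) + (M n - K n) / (real n powr (- a) * L (real n)) * inverse (real n))
        \<longlonglongrightarrow> cA / (1 - \<rho>) / (a - 1) + t * 0"
      by (intro tendsto_intros K_lim unshift[OF diff_lim] inv)
    moreover have "eventually (\<lambda>n. K n / (real n powr (1 - a) * L (real n)) + (M n - K n) / (real n powr (- a) * L (real n)) * inverse (real n)
        = M n / (real n powr (1 - a) * L (real n))) sequentially"
      using eventually_gt_at_top[of 0]
    proof eventually_elim
      case (elim n)
      have "real n powr (1 - a) = real n * real n powr (- a)"
        using elim powr_add[of "real n" 1 "- a"] by simp
      then show ?case using elim by (simp add: diff_divide_distrib field_simps)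
    qed
    ultimately show ?thesis using Lim_transform_eventually by fastforce
  qed
  have cB_c: "(dX > dB \<and> cB = 1 \<and> c = 0) \<or> (dX < dB \<and> cB = 0 \<and> c = cX \<and> cX > 0) \<or> (dX = dB \<and> cB = 1 \<and> c = cX \<and> cX > 0)"
    using case_cond a by (auto simp: cB_def c_def min_def)
  have beta: "lam * \<beta>1 * \<chi>1 = \<rho>" using stable(1) by simp
  have c_nonneg: "c \<ge> 0" using A2(2) by (simp add: c_def)
  \<comment> \<open>In case (2), where \<open>cB\<close> vanishes, positivity of \<open>cA\<close>
    rests on the mean service time.\<close>
  have B1: "\<beta>1 > 0"
  proof -
    have nn: "AE b in B. 0 \<le> b" using B_pos by eventually_elim simp
    have eq: "\<beta>1 = (\<integral>b. b \<partial>B)" by (simp add: B_mean(2) mean_service_def)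
    have "\<beta>1 \<noteq> 0"
    proof
      assume "\<beta>1 = 0"
      then have "AE b in B. b = 0"
        using integral_nonneg_eq_0_iff_AE[OF B_mean(1) nn] eq by simp
      with B_pos have "AE b in B. False" by eventually_elim simp
      then show False by simp
    qed
    moreover have "\<beta>1 \<ge> 0" unfolding eq using nn by (rule integral_nonneg_AE)
    ultimately show ?thesis by simp
  qed
  have \<rho>0: "\<rho> > 0" using B1 lam chi_pos by (simp add: stable(1))
  have cA_pos: "cA > 0"
  proof -
    have "(lam * \<chi>1) powr a > 0" using lam chi_pos by simp
    moreover have "lam * \<beta>1 > 0" using lam B1 by simp
    ultimately show ?thesis using cB_c by (auto simp: cA_def intro: add_pos_pos)
  qed
  have cK_eq: "cK = cA / (1 - \<rho>) / (a - 1)"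
    using cB_c unfolding cK cA_def by (auto simp: mult.commute)
  have cK_pos: "cK > 0" unfolding cK_eq using cA_pos stable(2) a1 by simp
  have hs_eq: "q * (hs * 1) = \<psi>"
  proof -
    have "1 / (1 - \<rho>) - 1 = \<rho> / (1 - \<rho>)" using stable(2) by (simp add: field_simps)
    then have "hs = (\<chi>1 - 1 + \<rho>) / (1 - \<rho>)"
      by (simp only: hs_def add_divide_distrib times_divide_eq_right mult_1_left mult_1_right)
    then have "hs = (\<rho> + \<chi>1 - 1) / (1 - \<rho>)" by (simp only: add.commute add_diff_eq)
    then show ?thesis by (simp add: psi q_def)
  qed
  \<comment> \<open>The batch part of \<chi>1 * cA is lam * \<beta>1 * \<chi>1 * c = \<rho> * c,
    which adds up with c * (1 - \<rho>) to c; this is why \<beta>1 enters \<open>cD\<close> only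
    through \<rho>.\<close>
  have ch_eq: "q * ch / a = cD"
  proof -
    have nz: "1 - \<rho> \<noteq> 0" using stable(2) by simp
    have "ch = \<chi>1 * cA / (1 - \<rho>)\<^sup>2 + c * (1 - \<rho>) / (1 - \<rho>)\<^sup>2"
    proof -
      have "ch = \<chi>1 * (cA / (1 - \<rho>)\<^sup>2) + 1 / (1 - \<rho>) * c" unfolding ch_def by (simp add: left_diff_distrib flip: add_divide_distrib)
      moreover have "1 / (1 - \<rho>) * c = c * (1 - \<rho>) / (1 - \<rho>)\<^sup>2" using nz by (simp add: power2_eq_square)
      ultimately show ?thesis by (simp only: times_divide_eq_right)
    qed
    also have "\<dots> = (cB * \<chi>1 * (lam * \<chi>1) powr a + c) / (1 - \<rho>)\<^sup>2"
      unfolding cA_def add_divide_distrib[symmetric] beta[symmetric] by (simp add: algebra_simps)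
    finally have ch': "ch = (cB * \<chi>1 * (lam * \<chi>1) powr a + c) / (1 - \<rho>)\<^sup>2" .
    have "(lam * \<chi>1) powr (a + 1) = lam * \<chi>1 * (lam * \<chi>1) powr a"
      using lam chi_pos by (simp add: powr_add)
    then have "cD = (cB * (lam * \<chi>1 * (lam * \<chi>1) powr a) + lam * c) / (a * mu * (1 - \<rho>)\<^sup>2)"
      using cB_c unfolding cD by auto
    moreover have "lam * (cB * \<chi>1 * (lam * \<chi>1) powr a + c) = cB * (lam * \<chi>1 * (lam * \<chi>1) powr a) + lam * c"
      by (simp add: algebra_simps)
    moreover have "lam / mu * (u / v) / a = lam * u / (a * mu * v)" for u v
      by (simp add: mult_ac)
    ultimately show ?thesis unfolding ch' q_def by (simp only:)
  qed
  have t_eq: "t = (a - 1) * \<psi> * cK + cD"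
  proof -
    have "(a - 1) * \<psi> * (v / (a - 1)) = \<psi> * v" for v using a1 by simp
    then show ?thesis unfolding t_def ch_eq hs_eq cK_eq by (simp only: mult_1_left add.commute)
  qed
  \<comment> \<open>The limit of the scaled difference gives an asymptotic equivalence only if the
    constant is nonzero.\<close>
  have t_pos: "t > 0"
  proof -
    have "hs \<ge> 0" using h_nonneg h_sums by (rule sums_nonneg)
    then have "q * (hs * 1) * (cA / (1 - \<rho>)) \<ge> 0" using q cA_pos stable(2) by simp
    moreover have "ch > 0"
    proof -
      have "cA / (1 - \<rho>)\<^sup>2 > 0" using cA_pos stable(2) by simp
      moreover from this have "(\<chi>1 - 1) * (cA / (1 - \<rho>)\<^sup>2) \<ge> 0" using chi1 by (intro mult_nonneg_nonneg) auto
      moreover have "1 / (1 - \<rho>) * c \<ge> 0" using c_nonneg stable(2) by simp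
      ultimately show ?thesis unfolding ch_def by linarith
    qed
    then have "q * ch / a > 0" using q a1 by simp
    ultimately show ?thesis by (simp add: t_def)
  qed
  have asymp: "f \<sim>[sequentially] (\<lambda>n. k * w n)" if "(\<lambda>n. f n / w n) \<longlonglongrightarrow> k" "k \<noteq> 0" for f w :: "nat \<Rightarrow> real" and k
  proof (rule asymp_equivI')
    have "(\<lambda>n. f n / w n / k) \<longlonglongrightarrow> k / k" using that by (intro tendsto_intros)
    then show "(\<lambda>n. f n / (k * w n)) \<longlonglongrightarrow> 1" using that(2) by (simp add: mult.commute)
  qed
  have K_asymp: "K \<sim>[sequentially] (\<lambda>n. cK * (real n powr (1 - a) * L (real n)))"
    using K_lim[folded cK_eq] less_imp_neq[OF cK_pos, symmetric] by (rule asymp)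
  have M_asymp: "M \<sim>[sequentially] (\<lambda>n. cK * (real n powr (1 - a) * L (real n)))"
    using M_lim[folded cK_eq] less_imp_neq[OF cK_pos, symmetric] by (rule asymp)
  have diff_asymp: "(\<lambda>n. M n - K n) \<sim>[sequentially] (\<lambda>n. t * (real n powr (- a) * L (real n)))"
    using unshift[OF diff_lim] t_pos by (intro asymp) auto
  have MK: "M \<sim>[sequentially] K"
    by (rule asymp_equiv_trans[OF M_asymp asymp_equiv_symI[OF K_asymp]])
  have exponent: "- a + 1 = 1 - a" by simp
  show ?thesis
    using MK K_asymp diff_asymp unfolding M_def[abs_def] K_def[abs_def] t_eq exponent by (simp add: mult.assoc)
qed

end
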